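(* If one of the following conditions holds for the positive integers $p,q,l,n$: (a) $q\ge l+1=p$; (b) $q=l$ divides $n$, and $\gcd(p,q)=1$; (c) $l=n=2$ and $\gcd(p,q)=1$; (d) $l=n=p-2$ and $q=kp\pm 1$ for some positive integer $k$; then there exist integers $\omega,t,b$ with $0\le b\le \omega-2$ and $t\ge 1$, such that the closure of the braid $$(\sigma_{l-1}\sigma_{l-2}\cdots\sigma_2\sigma_1)^n(\sigma_{p-1}\sigma_{p-2}\cdots\sigma_2\sigma_1)^q$$ and the closure of the braid $$(\sigma_b\sigma_{b-1}\cdots\sigma_2\sigma_1)(\sigma_{\omega-1}\sigma_{\omega-2}\cdots\sigma_2\sigma_1)^t$$ represent the same oriented link in $S^3$.
   Context: $\sigma_1,\sigma_2,\ldots$ denote the standard generators of the braid groups, and braids are given by words in these generators. A product $\sigma_m\sigma_{m-1}\cdots\sigma_2\sigma_1$ with $m=0$ is the empty word. The second braid word, on $\omega$ strands, is the standard word representing the $1$-bridge braid $B(\omega,t,b)$.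
   Formalization: In condition (b) the requirement l ≤ p is added (the first word is a braid on p strands); read on l > p strands the claim fails, e.g. for p=2, q=l=n=5. *)

theory Defs
  imports "HOL-Analysis.Analysis" "HOL-Combinatorics.Transposition"
begin

section \<open>Oriented links in the 3-sphere\<close>

abbreviation S3 :: "(complex \<times> complex) set" where
  "S3 \<equiv> sphere 0 1"

text \<open>
  An oriented link is given by a set of parametrized oriented simple closed curves in \<open>S3\<close>, one or
  more for each component. Curves that differ only by the choice of the base point and by an
  orientation-preserving reparametrization stand for the same oriented component.
\<close>

definition same_oriented_loop :: "(real \<Rightarrow> 'a::topological_space) \<Rightarrow> (real \<Rightarrow> 'a) \<Rightarrow> bool" where
  "same_oriented_loop c d \<longleftrightarrow>
     (\<exists>a\<in>{0..1}. \<exists>h::real \<Rightarrow> real. continuous_on {0..1} h \<and> strict_mono_on {0..1} h \<and> h 0 = 0 \<and> h 1 = 1 \<and>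
        (\<forall>s\<in>{0..1}. d s = shiftpath a c (h s)))"

text \<open>\<open>f\<close> is the final map of an ambient isotopy of \<open>S3\<close>: a homotopy through self-homeomorphisms
  which starts at the identity.\<close>

definition ambient_isotopy_map :: "(complex \<times> complex \<Rightarrow> complex \<times> complex) \<Rightarrow> bool" where
  "ambient_isotopy_map f \<longleftrightarrow>
     homotopic_with_canon (\<lambda>g. \<exists>k. homeomorphism S3 S3 g k) S3 S3 id f"

definition same_oriented_link ::
    "(real \<Rightarrow> complex \<times> complex) set \<Rightarrow> (real \<Rightarrow> complex \<times> complex) set \<Rightarrow> bool" where
  "same_oriented_link L M \<longleftrightarrow>
     (\<exists>f. ambient_isotopy_map f \<and>
        (\<forall>c\<in>L. \<exists>d\<in>M. same_oriented_loop (f \<circ> c) d) \<and>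
        (\<forall>d\<in>M. \<exists>c\<in>L. same_oriented_loop (f \<circ> c) d))"

section \<open>Geometric braids and their closures\<close>

text \<open>
  A list of positive integers is a positive braid word: the letter \<open>k\<close> stands for \<open>\<sigma>\<^sub>k\<close>, and
  words are read from left to right. A geometric braid on \<open>n\<close> strands is a motion of the points
  \<open>1, \<dots>, n\<close> of the complex plane. In \<open>\<sigma>\<^sub>k\<close> the points \<open>k\<close> and \<open>k + 1\<close> are exchanged
  by a counterclockwise half turn about their midpoint; the opposite choice would replace every
  closure below by its mirror image. \<open>generator_strand k j\<close> is the motion of the point \<open>j\<close> under \<open>\<sigma>\<^sub>k\<close>.
\<close>

definition generator_strand :: "nat \<Rightarrow> nat \<Rightarrow> real \<Rightarrow> complex" where
  "generator_strand k j s =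
     (if j = k then of_nat k + 1/2 - cis (pi * s) / 2
      else if j = Suc k then of_nat k + 1/2 + cis (pi * s) / 2
      else of_nat j)"

fun braid_strand :: "nat list \<Rightarrow> nat \<Rightarrow> real \<Rightarrow> complex" where
  "braid_strand [] j = (\<lambda>s. of_nat j)"
| "braid_strand (k # w) j = generator_strand k j +++ braid_strand w (Transposition.transpose k (Suc k) j)"

fun braid_perm :: "nat list \<Rightarrow> nat \<Rightarrow> nat" where
  "braid_perm [] j = j"
| "braid_perm (k # w) j = braid_perm w (Transposition.transpose k (Suc k) j)"

text \<open>
  The closure lies in the open solid torus \<open>\<complex> \<times> S\<^sup>1\<close>, which is embedded without knotting or twisting
  into \<open>S3\<close> by the radial projection \<open>(z, u) \<mapsto> (z, u) / norm (z, u)\<close>. Its image is the complement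
  of the circle \<open>{(z, 0)}\<close>, the braid axis. The strands are oriented by increasing braid parameter.
\<close>

definition closure_arc :: "nat list \<Rightarrow> nat \<Rightarrow> real \<Rightarrow> complex \<times> complex" where
  "closure_arc w j s = sgn (braid_strand w j s, cis (2 * pi * s))"

text \<open>The component through the point \<open>j\<close> traverses one after the other the arcs starting at the
  points of the orbit of \<open>j\<close> under the permutation of the braid.\<close>

definition orbit_length :: "nat list \<Rightarrow> nat \<Rightarrow> nat" where
  "orbit_length w j = (LEAST m. 0 < m \<and> (braid_perm w ^^ m) j = j)"

definition closure_component :: "nat list \<Rightarrow> nat \<Rightarrow> real \<Rightarrow> complex \<times> complex" where
  "closure_component w j s =
     (let x = real (orbit_length w j) * s
      in closure_arc w ((braid_perm w ^^ nat \<lfloor>x\<rfloor>) j) (frac x))"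

text \<open>The closure of \<open>w\<close> as a braid on \<open>n\<close> strands, meaningful if all letters of \<open>w\<close> lie in
  \<open>{1..<n}\<close>.\<close>

definition braid_closure :: "nat \<Rightarrow> nat list \<Rightarrow> (real \<Rightarrow> complex \<times> complex) set" where
  "braid_closure n w = closure_component w ` {1..n}"

section \<open>The braid words\<close>

text \<open>\<open>\<sigma>\<^sub>m \<sigma>\<^sub>m\<^sub>-\<^sub>1 \<dots> \<sigma>\<^sub>1\<close>, the empty word for \<open>m = 0\<close>.\<close>

definition descending_word :: "nat \<Rightarrow> nat list" where
  "descending_word m = rev [1..<Suc m]"

definition word_power :: "nat list \<Rightarrow> nat \<Rightarrow> nat list" where
  "word_power w n = concat (replicate n w)"

definition twisted_torus_word :: "nat \<Rightarrow> nat \<Rightarrow> nat \<Rightarrow> nat \<Rightarrow> nat list" where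
  "twisted_torus_word p q l n =
     word_power (descending_word (l - 1)) n @ word_power (descending_word (p - 1)) q"

definition one_bridge_word :: "nat \<Rightarrow> nat \<Rightarrow> nat \<Rightarrow> nat list" where
  "one_bridge_word \<omega> t b = descending_word b @ word_power (descending_word (\<omega> - 1)) t"

end

(*
  Algebra: in the positive braid monoid, a power of desc m = s_m ... s_1 with exponent p <= m
  equals s_(m-p+1) ... s_m (desc (m-1))^p, so that its closure loses one strand at the cost of a
  factor s_1 ... s_(p-1).  Iterating this, together with conjugation by the half twist, turns the
  braids of (a) and (b) into one-bridge braids.  In (c) one of the two letters s_1 of the full
  twist is moved around the closed braid until it is adjacent to the other; the resulting word is
  s_2 s_1 or s_1 s_2, and exchanging the roles of p and q exchanges the two outcomes.  Conjugation
  by the half twist on p - 2 strands reduces (d) to (a).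

  Topology: a displacement with small Lipschitz constant is an ambient isotopy.  Applied on each
  level of the solid torus this shows that homotopic closed geometric braids are isotopic, which
  covers the braid relations and conjugation.  Applied with the two coordinates of the 3-sphere
  exchanged, it removes a loop of a strand around the braid axis, which is a destabilization.
*)
theory Submission
  imports Defs
begin

section \<open>The positive braid monoid\<close>

text \<open>Only the easy half of Markov's theorem is used, and only with positive words and
  positive destabilizations; no inverse letter is ever needed. Removing strands leaves ascending
  words, while one-bridge words are built from descending ones. The half twist exchanges the two
  kinds, but it can be split off from a positive word only where the power of the descending word
  contains a full twist. Hence the reductions of (a) and (b) stop at the number of strands equal to
  the exponent. In (c) the travelling letter must not be blocked before it arrives; this is
  guaranteed if the inverse of \<open>q\<close> modulo \<open>p\<close> is below
  \<open>p / 2\<close>, and otherwise exchanging \<open>p\<close> and \<open>q\<close> makes the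
  relevant inverse small. On the topological side every isotopy has to be written down as a family
  of homeomorphisms. The identity plus a contraction is bijective by Banach's fixed point theorem,
  and so is every stage with a smaller multiple of the displacement. A map that preserves the levels
  of the solid torus cannot destabilize, because it keeps the number of turns around the axis; a
  shear that moves the angular coordinate can.\<close>

inductive braid_step :: "nat list \<Rightarrow> nat list \<Rightarrow> bool" where
  far: "i + 2 \<le> j \<Longrightarrow> braid_step (u @ [i, j] @ v) (u @ [j, i] @ v)"
| near: "braid_step (u @ [i, Suc i, i] @ v) (u @ [Suc i, i, Suc i] @ v)"

definition braid_equiv :: "nat list \<Rightarrow> nat list \<Rightarrow> bool" where
  "braid_equiv = equivclp braid_step"

lemma equivp_braid_equiv: "equivp braid_equiv"
  unfolding braid_equiv_def by (rule equivp_evquivclp)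

lemma braid_step_equiv: "braid_step v w \<Longrightarrow> braid_equiv v w"
  unfolding braid_equiv_def by (rule r_into_equivclp)

lemma braid_equiv_append:
  assumes "braid_equiv v v'"
  shows "braid_equiv (u @ v @ w) (u @ v' @ w)"
proof -
  have step': "braid_step (u @ x @ w) (u @ y @ w)" if "braid_step x y" for x y
    using that
  proof cases
    case (far i j a b)
    then show ?thesis using braid_step.far[of i j "u @ a" "b @ w"] by simp
  next
    case (near a i b)
    then show ?thesis using braid_step.near[of "u @ a" i "b @ w"] by simp
  qed
  show ?thesis
    using assms unfolding braid_equiv_def
  proof (induction rule: equivclp_induct)
    case base
    then show ?case by simp
  next
    case (step y z)
    then have "braid_step (u @ y @ w) (u @ z @ w) \<or> braid_step (u @ z @ w) (u @ y @ w)"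
      using step' by auto
    with step.IH show ?case by (rule equivclp_into_equivclp)
  qed
qed

text \<open>Both relations keep the set of letters. So one monoid on all generators suffices: an
  element still tells on how many strands it can be closed.\<close>

lemma braid_equiv_set: "braid_equiv v w \<Longrightarrow> set v = set w"
  unfolding braid_equiv_def
proof (induction rule: equivclp_induct)
  case (step y z)
  have "set a = set b" if "braid_step a b" for a b
    using that by cases auto
  with step show ?case by blast
qed simp

quotient_type braid = "nat list" / braid_equiv
  by (rule equivp_braid_equiv)

instantiation braid :: monoid_mult
begin

lift_definition one_braid :: braid is "[]" .

lift_definition times_braid :: "braid \<Rightarrow> braid \<Rightarrow> braid" is "(@)"
proof -
  fix v v' w w' assume "braid_equiv v v'" "braid_equiv w w'"
  then have "braid_equiv (v @ w) (v' @ w)" "braid_equiv (v' @ w) (v' @ w')"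
    using braid_equiv_append[of v v' "[]" w] braid_equiv_append[of w w' v' "[]"] by simp_all
  then show "braid_equiv (v @ w) (v' @ w')"
    by (rule equivp_transp[OF equivp_braid_equiv])
qed

instance
  by standard (transfer, simp add: equivp_reflp[OF equivp_braid_equiv])+

end

lift_definition \<sigma> :: "nat \<Rightarrow> braid" is "\<lambda>k. [k]" .

lift_definition letters :: "braid \<Rightarrow> nat set" is set
  by (rule braid_equiv_set)

lemma letters_one [simp]: "letters 1 = {}"
  by (simp add: one_braid_def letters.abs_eq)

lemma letters_times [simp]: "letters (x * y) = letters x \<union> letters y"
  by transfer simp

lemma letters_\<sigma> [simp]: "letters (\<sigma> k) = {k}"
  by (simp add: \<sigma>_def letters.abs_eq)

lemma letters_power: "letters (x ^ n) \<subseteq> letters x"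
  by (induction n) auto

lemma \<sigma>_far: "i + 2 \<le> j \<Longrightarrow> \<sigma> i * \<sigma> j = \<sigma> j * \<sigma> i"
proof (transfer)
  fix i j :: nat assume "i + 2 \<le> j"
  then show "braid_equiv ([i] @ [j]) ([j] @ [i])"
    using braid_step_equiv[OF braid_step.far[of i j "[]" "[]"]] by simp
qed

lemma \<sigma>_near: "\<sigma> i * \<sigma> (Suc i) * \<sigma> i = \<sigma> (Suc i) * \<sigma> i * \<sigma> (Suc i)"
proof (transfer)
  fix i :: nat
  show "braid_equiv (([i] @ [Suc i]) @ [i]) (([Suc i] @ [i]) @ [Suc i])"
    using braid_step_equiv[OF braid_step.near[of "[]" i "[]"]] by simp
qed

lemma braid_induct [case_names one mult]:
  assumes "P 1" and "\<And>k x. P x \<Longrightarrow> P (\<sigma> k * x)"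
  shows "P x"
proof -
  have "P (abs_braid w)" for w
  proof (induction w)
    case Nil
    then show ?case using assms(1) by (simp add: one_braid_def)
  next
    case (Cons k w)
    have "abs_braid (k # w) = \<sigma> k * abs_braid w"
      by (simp add: \<sigma>_def times_braid.abs_eq)
    then show ?case using assms(2) Cons by simp
  qed
  then have "P (abs_braid (rep_braid x))" .
  then show ?thesis by (simp only: Quotient3_abs_rep[OF Quotient3_braid])
qed

lemma commute_if_letters_commute:
  fixes y :: braid
  assumes "\<And>k. k \<in> letters x \<Longrightarrow> \<sigma> k * y = y * \<sigma> k"
  shows "x * y = y * x"
  using assms
proof (induction x rule: braid_induct)
  case (mult k x)
  have "\<sigma> k * x * y = \<sigma> k * (y * x)" using mult by (simp add: mult.assoc)
  also have "\<dots> = y * \<sigma> k * x" using mult.prems[of k] by (simp add: mult.assoc[symmetric])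
  finally show ?case by (simp add: mult.assoc)
qed simp

lemma commute_far:
  assumes "\<And>k. k \<in> letters x \<Longrightarrow> k + 2 \<le> j"
  shows "x * \<sigma> j = \<sigma> j * x"
proof (rule commute_if_letters_commute)
  fix k assume "k \<in> letters x"
  then show "\<sigma> k * \<sigma> j = \<sigma> j * \<sigma> k" by (rule \<sigma>_far[OF assms])
qed

section \<open>Garside calculus: descending words, ascending words and the half twist\<close>

fun desc :: "nat \<Rightarrow> braid" where
  "desc 0 = 1"
| "desc (Suc m) = \<sigma> (Suc m) * desc m"

fun asc :: "nat \<Rightarrow> braid" where
  "asc 0 = 1"
| "asc (Suc m) = asc m * \<sigma> (Suc m)"

fun half_twist :: "nat \<Rightarrow> braid" where
  "half_twist 0 = 1"
| "half_twist (Suc m) = half_twist m * desc (Suc m)"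

lemma letters_desc: "letters (desc m) = {1..m}"
  by (induction m) auto

lemma letters_asc: "letters (asc m) = {1..m}"
  by (induction m) auto

lemma letters_half_twist: "letters (half_twist m) \<subseteq> {1..m}"
  by (induction m) (auto simp: letters_desc)

lemma letters_pow_le: "letters x \<subseteq> A \<Longrightarrow> letters (x ^ n) \<subseteq> A"
  using letters_power by blast

text \<open>The letters above \<open>Suc j\<close> commute with \<open>\<sigma> j\<close>, one braid
  relation at \<open>Suc j\<close> and \<open>j\<close> turns it into
  \<open>\<sigma> (Suc j)\<close>, and this commutes with the remaining letters below
  \<open>j\<close>.\<close>

lemma \<sigma>_desc: "1 \<le> j \<Longrightarrow> j < m \<Longrightarrow> \<sigma> j * desc m = desc m * \<sigma> (Suc j)"
proof (induction m)
  case (Suc m)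
  show ?case
  proof (cases "j < m")
    case True
    have "\<sigma> j * desc (Suc m) = \<sigma> j * \<sigma> (Suc m) * desc m" by (simp add: mult.assoc)
    also have "\<sigma> j * \<sigma> (Suc m) = \<sigma> (Suc m) * \<sigma> j" using True by (intro \<sigma>_far) simp
    also have "\<sigma> (Suc m) * \<sigma> j * desc m = \<sigma> (Suc m) * (\<sigma> j * desc m)" by (simp only: mult.assoc)
    also have "\<dots> = \<sigma> (Suc m) * (desc m * \<sigma> (Suc j))" using Suc True by simp
    finally show ?thesis by (simp add: mult.assoc)
  next
    case False
    with Suc obtain i where i: "m = Suc i" "j = Suc i"
      by (metis less_antisym not0_implies_Suc not_one_le_zero)
    have c: "desc i * \<sigma> (Suc (Suc i)) = \<sigma> (Suc (Suc i)) * desc i"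
      by (rule commute_far) (simp add: letters_desc)
    have "\<sigma> j * desc (Suc m) = (\<sigma> (Suc i) * \<sigma> (Suc (Suc i)) * \<sigma> (Suc i)) * desc i"
      using i by (simp add: mult.assoc)
    also have "\<dots> = \<sigma> (Suc (Suc i)) * \<sigma> (Suc i) * (\<sigma> (Suc (Suc i)) * desc i)"
      by (simp only: \<sigma>_near) (simp only: mult.assoc)
    also have "\<dots> = \<sigma> (Suc (Suc i)) * \<sigma> (Suc i) * (desc i * \<sigma> (Suc (Suc i)))"
      using c by simp
    finally show ?thesis using i by (simp add: mult.assoc)
  qed
qed simp

fun asc_run :: "nat \<Rightarrow> nat \<Rightarrow> braid" where
  "asc_run k 0 = 1"
| "asc_run k (Suc n) = asc_run k n * \<sigma> (k + n)"

lemma letters_asc_run: "letters (asc_run k n) = {k..<k + n}"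
  by (induction n) auto

lemma asc_run_1: "asc_run 1 n = asc n"
  by (induction n) auto

lemma asc_run_desc: "1 \<le> k \<Longrightarrow> k + n \<le> m \<Longrightarrow> asc_run k n * desc m = desc m * asc_run (Suc k) n"
proof (induction n)
  case (Suc n)
  have "asc_run k (Suc n) * desc m = asc_run k n * (\<sigma> (k + n) * desc m)" by (simp add: mult.assoc)
  also have "\<sigma> (k + n) * desc m = desc m * \<sigma> (Suc (k + n))" using Suc.prems by (intro \<sigma>_desc) auto
  also have "asc_run k n * \<dots> = (asc_run k n * desc m) * \<sigma> (Suc (k + n))" by (simp add: mult.assoc)
  also have "\<dots> = desc m * asc_run (Suc k) (Suc n)" using Suc by (simp add: mult.assoc)
  finally show ?case .
qed simp

text \<open>Each factor \<open>desc m\<close> gives up its top letter \<open>\<sigma> m\<close>. The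
  run collected so far drops by one index when it is moved left across a further factor, so it ends
  in \<open>m - 1\<close> and the new letter \<open>\<sigma> m\<close> prolongs it.\<close>

lemma desc_power:
  "p \<le> m \<Longrightarrow> desc m ^ p = asc_run (Suc (m - p)) p * desc (m - 1) ^ p"
proof (induction p)
  case (Suc p)
  then obtain m' where m: "m = Suc m'" by (cases m) auto
  have 1: "asc_run (m - p) p * desc m = desc m * asc_run (Suc (m - p)) p"
    using Suc.prems by (intro asc_run_desc) auto
  have "desc m ^ Suc p = (desc m * asc_run (Suc (m - p)) p) * desc (m - 1) ^ p"
    using Suc by (simp add: mult.assoc)
  also have "\<dots> = asc_run (m - p) p * (\<sigma> m * desc (m - 1)) * desc (m - 1) ^ p"
    by (simp only: 1[symmetric]) (simp add: m)
  also have "\<dots> = (asc_run (m - p) p * \<sigma> m) * desc (m - 1) ^ Suc p"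
    by (simp add: mult.assoc)
  also have "asc_run (m - p) p * \<sigma> m = asc_run (m - p) (Suc p)" using Suc.prems by simp
  also have "m - p = Suc (m - Suc p)" using Suc.prems by simp
  finally show ?case .
qed simp

lemma desc_power_self: "desc m ^ m = asc m * desc (m - 1) ^ m"
  using desc_power[of m m] by (simp add: asc_run_1[simplified])

fun desc_run :: "nat \<Rightarrow> nat \<Rightarrow> braid" where
  "desc_run k 0 = 1"
| "desc_run k (Suc m) = \<sigma> (Suc (k + m)) * desc_run k m"

lemma letters_desc_run: "letters (desc_run k m) = {Suc k..k + m}"
  by (induction m) auto

lemma desc_run_0: "desc_run 0 m = desc m"
  by (induction m) auto

lemma desc_run_snoc: "desc_run (Suc k) m * \<sigma> (Suc k) = desc_run k (Suc m)"
  by (induction m) (auto simp: mult.assoc)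

lemma desc_times_desc_run: "j < m \<Longrightarrow> desc j * desc m = desc m * desc_run 1 j"
proof (induction j)
  case (Suc j)
  have "desc (Suc j) * desc m = \<sigma> (Suc j) * (desc j * desc m)" by (simp add: mult.assoc)
  also have "\<dots> = (\<sigma> (Suc j) * desc m) * desc_run 1 j" using Suc by (simp add: mult.assoc)
  also have "\<sigma> (Suc j) * desc m = desc m * \<sigma> (Suc (Suc j))" using Suc.prems by (intro \<sigma>_desc) auto
  finally show ?case by (simp add: mult.assoc)
qed simp

lemma desc_square: "desc (Suc m) * desc (Suc m) = desc m * desc (Suc m) * \<sigma> 1"
proof -
  have "desc (Suc m) * desc (Suc m) = desc (Suc m) * (desc_run 1 m * \<sigma> 1)"
    using desc_run_snoc[of 0 m] by (simp add: desc_run_0)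
  also have "\<dots> = (desc (Suc m) * desc_run 1 m) * \<sigma> 1" by (simp only: mult.assoc)
  also have "desc (Suc m) * desc_run 1 m = desc m * desc (Suc m)" using desc_times_desc_run[of m "Suc m"] by simp
  finally show ?thesis .
qed

lemma \<sigma>_desc_square:
  assumes "1 \<le> m"
  shows "\<sigma> m * desc m * desc m = desc m * desc m * \<sigma> 1"
proof -
  obtain i where i: "m = Suc i" using assms by (cases m) auto
  have "\<sigma> m * (desc m * desc m) = \<sigma> m * (desc i * desc m * \<sigma> 1)" using desc_square[of i] i by simp
  then show ?thesis using i by (simp add: mult.assoc)
qed

text \<open>Conjugation by \<open>desc m\<close> rotates the indices modulo \<open>Suc m\<close>.
  Residue 0 would be the crossing of the last with the first strand, which is not a letter. The
  induction therefore steps over it with two factors at once, by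
  \<open>\<sigma>_desc_square\<close>; a letter cannot stop there because the target
  \<open>j\<close> is at least 1.\<close>

lemma \<sigma>_desc_power:
  "\<lbrakk>1 \<le> i; i \<le> m; 1 \<le> j; j \<le> m; (i + n) mod Suc m = j\<rbrakk> \<Longrightarrow> \<sigma> i * desc m ^ n = desc m ^ n * \<sigma> j"
proof (induction n arbitrary: i rule: less_induct)
  case (less n)
  show ?case
  proof (cases n)
    case 0
    then show ?thesis using less by simp
  next
    case (Suc n')
    show ?thesis
    proof (cases "i < m")
      case True
      have "\<sigma> i * desc m ^ n = (\<sigma> i * desc m) * desc m ^ n'" using Suc by (simp add: mult.assoc)
      also have "\<dots> = desc m * (\<sigma> (Suc i) * desc m ^ n')" using True less.prems by (simp add: \<sigma>_desc mult.assoc)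
      also have "\<sigma> (Suc i) * desc m ^ n' = desc m ^ n' * \<sigma> j"
        using less.prems True Suc by (intro less.IH) auto
      finally show ?thesis using Suc by (simp add: mult.assoc)
    next
      case False
      then have im: "i = m" using less by simp
      have "n' \<noteq> 0"
      proof
        assume "n' = 0"
        then have "(i + n) mod Suc m = 0" using Suc im by simp
        then show False using less.prems by simp
      qed
      then obtain n'' where n'': "n' = Suc n''" by (cases n') auto
      have "(1 + n'') mod Suc m = (i + n) mod Suc m"
        using Suc n'' im by (metis add.commute add_Suc_right mod_add_self1 plus_1_eq_Suc add_Suc)
      then have "\<sigma> 1 * desc m ^ n'' = desc m ^ n'' * \<sigma> j"
        using less.prems Suc n'' im by (intro less.IH) auto
      moreover have "\<sigma> i * desc m ^ n = (\<sigma> m * desc m * desc m) * desc m ^ n''"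
        using Suc n'' im by (simp add: mult.assoc)
      moreover have "\<sigma> m * desc m * desc m = desc m * desc m * \<sigma> 1"
        using less.prems im by (intro \<sigma>_desc_square) simp
      ultimately have "\<sigma> i * desc m ^ n = desc m * desc m * (desc m ^ n'' * \<sigma> j)"
        by (metis mult.assoc)
      then show ?thesis using Suc n'' by (simp add: mult.assoc)
    qed
  qed
qed

lemma desc_power_central:
  assumes "letters x \<subseteq> {1..m}"
  shows "x * desc m ^ Suc m = desc m ^ Suc m * x"
proof (rule commute_if_letters_commute)
  fix k assume "k \<in> letters x"
  with assms show "\<sigma> k * desc m ^ Suc m = desc m ^ Suc m * \<sigma> k"
    by (intro \<sigma>_desc_power) (use mod_add_self2[of k "Suc m"] in \<open>auto simp del: mod_add_self2\<close>)
qed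

text \<open>A lower letter is flipped by the smaller half twist and then shifted by the descending
  word. The top letter commutes with all but the last two descending factors, where
  \<open>desc_square\<close> turns it into \<open>\<sigma> 1\<close>.\<close>

lemma \<sigma>_half_twist: "1 \<le> i \<Longrightarrow> i \<le> m \<Longrightarrow> \<sigma> i * half_twist m = half_twist m * \<sigma> (Suc m - i)"
proof (induction m arbitrary: i)
  case (Suc m)
  show ?case
  proof (cases "i \<le> m")
    case True
    have "\<sigma> i * half_twist (Suc m) = (\<sigma> i * half_twist m) * desc (Suc m)" by (simp add: mult.assoc)
    also have "\<dots> = half_twist m * (\<sigma> (Suc m - i) * desc (Suc m))" using Suc True by (simp add: mult.assoc)
    also have "\<sigma> (Suc m - i) * desc (Suc m) = desc (Suc m) * \<sigma> (Suc (Suc m - i))"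
      using True Suc.prems by (intro \<sigma>_desc) auto
    also have "Suc (Suc m - i) = Suc (Suc m) - i" using True by simp
    finally show ?thesis by (simp only: half_twist.simps mult.assoc)
  next
    case False
    then have i: "i = Suc m" using Suc by simp
    show ?thesis
    proof (cases m)
      case 0
      then show ?thesis using i by simp
    next
      case (Suc k)
      have c: "half_twist k * \<sigma> (Suc m) = \<sigma> (Suc m) * half_twist k"
        using letters_half_twist[of k] Suc by (intro commute_far) auto
      have "\<sigma> i * half_twist (Suc m) = \<sigma> (Suc m) * half_twist k * desc m * desc (Suc m)"
        using i Suc by (simp add: mult.assoc)
      also have "\<dots> = half_twist k * (desc (Suc m) * desc (Suc m))"
        by (simp only: c[symmetric]) (simp add: mult.assoc)
      also have "\<dots> = half_twist k * desc m * desc (Suc m) * \<sigma> 1"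
        by (simp only: desc_square) (simp add: mult.assoc)
      finally show ?thesis using i Suc by simp
    qed
  qed
qed simp

lemma half_twist_asc: "half_twist (Suc m) = asc (Suc m) * half_twist m"
proof (induction m)
  case (Suc m)
  have c: "half_twist m * \<sigma> (Suc (Suc m)) = \<sigma> (Suc (Suc m)) * half_twist m"
    using letters_half_twist[of m] by (intro commute_far) auto
  have "asc (Suc (Suc m)) * half_twist (Suc m) = asc (Suc m) * (\<sigma> (Suc (Suc m)) * half_twist m) * desc (Suc m)"
    by (simp add: mult.assoc)
  also have "\<dots> = (asc (Suc m) * half_twist m) * (\<sigma> (Suc (Suc m)) * desc (Suc m))"
    by (simp only: c[symmetric] mult.assoc)
  also have "\<dots> = half_twist (Suc (Suc m))" by (simp only: Suc.IH[symmetric] half_twist.simps desc.simps)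
  finally show ?case ..
qed simp

text \<open>The half twist splits off an ascending word on the left or a descending word on the
  right. Using one splitting for each of the two factors leaves the smaller square in the middle,
  and \<open>desc_power_self\<close> assembles the power.\<close>

lemma half_twist_square: "half_twist m * half_twist m = desc m ^ Suc m"
proof (induction m)
  case (Suc m)
  have "desc (Suc m) ^ Suc (Suc m) = desc (Suc m) ^ Suc m * desc (Suc m)" by (rule power_Suc2)
  also have "\<dots> = asc (Suc m) * desc m ^ Suc m * desc (Suc m)"
    by (simp only: desc_power_self) simp
  also have "\<dots> = (asc (Suc m) * half_twist m) * (half_twist m * desc (Suc m))"
    by (simp only: Suc.IH[symmetric] mult.assoc)
  also have "\<dots> = half_twist (Suc m) * half_twist (Suc m)" by (simp only: half_twist_asc[symmetric] half_twist.simps)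
  finally show ?case ..
qed simp

lemma half_twist_flip_mult:
  assumes "half_twist m * x = x' * half_twist m" "half_twist m * y = y' * half_twist m"
  shows "half_twist m * (x * y) = (x' * y') * half_twist m"
  by (metis assms mult.assoc)

lemma half_twist_flip_power:
  assumes "half_twist m * x = x' * half_twist m"
  shows "half_twist m * x ^ n = x' ^ n * half_twist m"
  using assms by (induction n) (auto intro: half_twist_flip_mult)

lemma half_twist_flip_\<sigma>: "1 \<le> i \<Longrightarrow> i \<le> m \<Longrightarrow> half_twist m * \<sigma> i = \<sigma> (Suc m - i) * half_twist m"
  using \<sigma>_half_twist[of "Suc m - i" m] by simp

lemma half_twist_flip_asc: "k \<le> m \<Longrightarrow> half_twist m * asc k = desc_run (m - k) k * half_twist m"
proof (induction k)
  case (Suc k)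
  then have "half_twist m * asc (Suc k) = (desc_run (m - k) k * \<sigma> (Suc m - Suc k)) * half_twist m"
    by (simp only: asc.simps) (intro half_twist_flip_mult half_twist_flip_\<sigma>; simp)
  moreover have "m - k = Suc (m - Suc k)" using Suc.prems by simp
  ultimately show ?case using desc_run_snoc[of "m - Suc k" k] by simp
qed simp

section \<open>Markov moves on positive braids\<close>

text \<open>In a monoid without inverses, conjugation takes the form of moving a prefix to the
  end.\<close>

inductive markov_step :: "nat \<times> braid \<Rightarrow> nat \<times> braid \<Rightarrow> bool" where
  rotate: "letters (x * y) \<subseteq> {1..<n} \<Longrightarrow> markov_step (n, x * y) (n, y * x)"
| destabilize: "\<lbrakk>1 \<le> n; letters x \<subseteq> {1..<n}\<rbrakk> \<Longrightarrow> markov_step (Suc n, x * \<sigma> n) (n, x)"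

abbreviation markov :: "nat \<times> braid \<Rightarrow> nat \<times> braid \<Rightarrow> bool" where
  "markov \<equiv> equivclp markov_step"

lemma markov_rotate: "letters x \<union> letters y \<subseteq> {1..<n} \<Longrightarrow> markov (n, x * y) (n, y * x)"
  by (intro r_into_equivclp markov_step.rotate) simp

lemma markov_destabilize: "\<lbrakk>1 \<le> n; letters x \<subseteq> {1..<n}\<rbrakk> \<Longrightarrow> markov (Suc n, x * \<sigma> n) (n, x)"
  by (intro r_into_equivclp markov_step.destabilize)

section \<open>Removing strands from powers of the descending word\<close>

lemma letters_desc_power: "letters (desc m ^ n) \<subseteq> {1..m}"
  using letters_power letters_desc by metis

lemma letters_asc_power: "letters (asc m ^ n) \<subseteq> {1..m}"
  using letters_power letters_asc by metis

text \<open>The congruence is demanded of nonempty runs only: in the reduction of two strands to one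
  the run is empty, the modulus is 1, and the congruence to 1 would fail.\<close>

lemma asc_run_desc_power:
  "\<lbrakk>1 \<le> k; k + n \<le> Suc m; 1 \<le> k'; k' + n \<le> Suc m; 0 < n \<Longrightarrow> (k + q) mod Suc m = k'\<rbrakk>
   \<Longrightarrow> asc_run k n * desc m ^ q = desc m ^ q * asc_run k' n"
proof (induction n)
  case (Suc n)
  have "(k + n + q) mod Suc m = ((k + q) mod Suc m + n) mod Suc m"
    by (simp add: mod_simps ac_simps)
  also have "\<dots> = k' + n" using Suc.prems by simp
  finally have "\<sigma> (k + n) * desc m ^ q = desc m ^ q * \<sigma> (k' + n)"
    using Suc.prems by (intro \<sigma>_desc_power) auto
  moreover have "asc_run k n * desc m ^ q = desc m ^ q * asc_run k' n" using Suc by simp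
  ultimately show ?case by (metis asc_run.simps(2) mult.assoc)
qed simp

text \<open>By \<open>desc_power\<close> the power is \<open>V * \<sigma> m * E\<close> with a
  single occurrence of \<open>\<sigma> m\<close>. Rotating \<open>E\<close> to the front puts this
  letter last, where it can be removed. What remains of the run, \<open>V\<close>, starts at index
  \<open>m - p + 1\<close>; passing \<open>E\<close> adds \<open>p\<close> modulo \<open>m\<close>,
  so it becomes the run starting at 1.\<close>

lemma markov_reduce_strand:
  assumes "1 \<le> p" "p \<le> m" "letters x \<subseteq> {1..<m}"
  shows "markov (Suc m, x * desc m ^ p) (m, asc (p - 1) * x * desc (m - 1) ^ p)"
proof -
  define V where "V = asc_run (Suc (m - p)) (p - 1)"
  define E where "E = desc (m - 1) ^ p"
  have lV: "letters V \<subseteq> {1..<m}" using assms by (auto simp: V_def letters_asc_run)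
  have lE: "letters E \<subseteq> {1..<m}" using letters_desc_power[of "m - 1" p] assms by (force simp: E_def)
  have lU: "letters (asc (p - 1)) \<subseteq> {1..<m}" using assms by (auto simp: letters_asc)
  have "asc_run (Suc (m - p)) (Suc (p - 1)) = V * \<sigma> m"
    using assms by (simp only: asc_run.simps V_def) simp
  then have desc: "desc m ^ p = V * \<sigma> m * E"
    using assms desc_power[of p m] by (simp add: E_def)
  have shift: "V * E = E * asc (p - 1)"
  proof -
    obtain m' where m': "m = Suc m'" using assms by (cases m) auto
    have "(Suc (m - p) + p) mod m = 1" if "0 < p - 1"
    proof -
      have "Suc (m - p) + p = m + 1" using assms by simp
      then show ?thesis using assms that by (simp only: mod_add_self1) simp
    qed
    then have "asc_run (Suc (m - p)) (p - 1) * desc m' ^ p = desc m' ^ p * asc_run 1 (p - 1)"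
      using assms by (intro asc_run_desc_power) (auto simp: m')
    then show ?thesis by (simp add: V_def E_def m' asc_run_1[simplified])
  qed
  have "markov (Suc m, (x * V * \<sigma> m) * E) (Suc m, E * (x * V * \<sigma> m))"
    by (rule markov_rotate) (use assms lV lE in auto)
  also have "E * (x * V * \<sigma> m) = (E * x * V) * \<sigma> m" by (simp only: mult.assoc)
  also have "markov (Suc m, (E * x * V) * \<sigma> m) (m, E * x * V)"
    by (rule markov_destabilize) (use assms lV lE in auto)
  also have "markov (m, (E * x) * V) (m, V * (E * x))"
    by (rule markov_rotate) (use assms lV lE in auto)
  also have "V * (E * x) = E * (asc (p - 1) * x)" by (metis shift mult.assoc)
  also have "markov (m, E * (asc (p - 1) * x)) (m, asc (p - 1) * x * E)"
    by (rule markov_rotate) (use assms lU lE in auto)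
  finally show ?thesis by (simp add: desc mult.assoc E_def)
qed

lemma markov_reduce_strands:
  "\<lbrakk>1 \<le> t; t \<le> b; letters x \<subseteq> {1..<b}\<rbrakk>
   \<Longrightarrow> markov (b + d, x * desc (b + d - 1) ^ t) (b, asc (t - 1) ^ d * x * desc (b - 1) ^ t)"
proof (induction d arbitrary: x)
  case (Suc d)
  have "markov (Suc (b + d), x * desc (b + d) ^ t) (b + d, asc (t - 1) * x * desc (b + d - 1) ^ t)"
    by (rule markov_reduce_strand) (use Suc.prems in auto)
  also have "markov (b + d, asc (t - 1) * x * desc (b + d - 1) ^ t) (b, asc (t - 1) ^ d * (asc (t - 1) * x) * desc (b - 1) ^ t)"
    by (rule Suc.IH) (use Suc.prems in \<open>auto simp: letters_asc\<close>)
  also have "asc (t - 1) ^ d * (asc (t - 1) * x) = asc (t - 1) ^ Suc d * x"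
    by (simp only: power_Suc2 mult.assoc)
  finally show ?case by simp
qed simp

text \<open>The power is a full twist, that is, two half twists. Carrying one of them around the
  closed braid conjugates \<open>x\<close>.\<close>

lemma markov_flip:
  assumes "half_twist m * x = y * half_twist m" "letters x \<subseteq> {1..m}"
  shows "markov (Suc m, x * desc m ^ Suc m) (Suc m, y * desc m ^ Suc m)"
proof -
  have "markov (Suc m, (x * half_twist m) * half_twist m) (Suc m, half_twist m * (x * half_twist m))"
    by (rule markov_rotate) (use assms letters_half_twist[of m] in auto)
  also have "half_twist m * (x * half_twist m) = y * half_twist m * half_twist m" using assms by (metis mult.assoc)
  finally show ?thesis by (simp only: mult.assoc half_twist_square)
qed

text \<open>\<open>desc_run 1 (M - 1)\<close> is \<open>desc (M - 1)\<close> with all indices raised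
  by one; a single factor \<open>desc M\<close> undoes the shift, and this is where \<open>q\<close>
  must be positive.\<close>

lemma markov_conjugate_shift:
  assumes "M \<ge> 1" "q \<ge> 1"
  shows "markov (Suc M, desc M ^ q * desc_run 1 (M - 1) ^ n) (Suc M, desc (M - 1) ^ n * desc M ^ q)"
proof -
  have shift: "desc M * desc_run 1 (M - 1) ^ k = desc (M - 1) ^ k * desc M" for k
  proof (induction k)
    case (Suc k)
    have "desc (M - 1) * desc M = desc M * desc_run 1 (M - 1)"
      using assms by (intro desc_times_desc_run) simp
    with Suc show ?case by (metis power_Suc2 power_Suc mult.assoc)
  qed simp
  obtain r where r: "q = Suc r" using assms by (cases q) auto
  have "desc M ^ q * desc_run 1 (M - 1) ^ n = (desc M ^ r * desc (M - 1) ^ n) * desc M"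
    by (simp only: r power_Suc2 mult.assoc shift)
  also have "markov (Suc M, \<dots>) (Suc M, desc M * (desc M ^ r * desc (M - 1) ^ n))"
    using letters_desc_power[of M r] letters_desc_power[of "M - 1" n]
    by (intro markov_rotate) (auto simp: letters_desc subset_iff less_Suc_eq_le)
  also have "desc M * (desc M ^ r * desc (M - 1) ^ n) = desc M ^ q * desc (M - 1) ^ n"
    by (simp add: r mult.assoc)
  also have "markov (Suc M, \<dots>) (Suc M, desc (M - 1) ^ n * desc M ^ q)"
    using letters_desc_power[of M q] letters_desc_power[of "M - 1" n]
    by (intro markov_rotate) (auto simp: subset_iff less_Suc_eq_le)
  finally show ?thesis .
qed

section \<open>Reduction of (a) and (b)\<close>

lemma letters_subset_mono: "letters x \<subseteq> {1..m} \<Longrightarrow> m < n \<Longrightarrow> letters x \<subseteq> {1..<n}"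
  by (meson atLeastLessThan_iff atLeastAtMost_iff order_le_less_trans subset_iff)

text \<open>The reduction runs from the one-bridge side, with \<omega> = \<open>q + n\<close>, t =
  \<open>M\<close> and b = \<open>q - 1\<close>. After \<open>n\<close> strands are removed, the
  factor \<open>desc (q - 1)\<close> is a complete descending word on \<open>q\<close> strands and
  raises the exponent to \<open>Suc M\<close>. Removing \<open>r\<close> further strands makes the
  number of strands equal to this exponent, so the power is a full twist and the ascending words can
  be flipped.\<close>

lemma markov_one_bridge_a:
  assumes "1 \<le> M" "Suc M \<le> q"
  shows "markov (Suc M, desc (M - 1) ^ n * desc M ^ q) (q + n, desc (q - 1) * desc (q + n - 1) ^ M)"
proof -
  define r where "r = q - Suc M"
  have q: "q = Suc M + r" using assms by (simp add: r_def)
  have "markov (q + n, desc (q - 1) * desc (q + n - 1) ^ M) (q, asc (M - 1) ^ n * desc (q - 1) * desc (q - 1) ^ M)"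
    by (rule markov_reduce_strands) (use assms in \<open>auto simp: letters_desc\<close>)
  also have "asc (M - 1) ^ n * desc (q - 1) * desc (q - 1) ^ M = asc (M - 1) ^ n * desc (Suc M + r - 1) ^ Suc M"
    by (simp add: mult.assoc q)
  also have "markov (q, asc (M - 1) ^ n * desc (Suc M + r - 1) ^ Suc M)
      (Suc M, asc (Suc M - 1) ^ r * asc (M - 1) ^ n * desc (Suc M - 1) ^ Suc M)"
    unfolding q by (rule markov_reduce_strands)
      (use assms letters_subset_mono[OF letters_asc_power, of "M - 1" "Suc M" n] in auto)
  also have "asc (Suc M - 1) ^ r * asc (M - 1) ^ n * desc (Suc M - 1) ^ Suc M = asc M ^ r * asc (M - 1) ^ n * desc M ^ Suc M"
    by simp
  also have "markov (Suc M, \<dots>) (Suc M, desc M ^ r * desc_run 1 (M - 1) ^ n * desc M ^ Suc M)"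
  proof (rule markov_flip)
    have "half_twist M * asc M = desc M * half_twist M" using half_twist_flip_asc[of M M] by (simp add: desc_run_0)
    moreover have "half_twist M * asc (M - 1) = desc_run 1 (M - 1) * half_twist M"
      using half_twist_flip_asc[of "M - 1" M] assms by simp
    ultimately show "half_twist M * (asc M ^ r * asc (M - 1) ^ n) = desc M ^ r * desc_run 1 (M - 1) ^ n * half_twist M"
      by (intro half_twist_flip_mult half_twist_flip_power)
    show "letters (asc M ^ r * asc (M - 1) ^ n) \<subseteq> {1..M}"
      using letters_asc_power[of M r] letters_asc_power[of "M - 1" n] by fastforce
  qed
  also have "desc M ^ r * desc_run 1 (M - 1) ^ n * desc M ^ Suc M = desc M ^ q * desc_run 1 (M - 1) ^ n"
  proof -
    have "letters (desc_run 1 (M - 1) ^ n) \<subseteq> {1..M}"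
      by (rule letters_pow_le) (auto simp: letters_desc_run)
    then have "desc_run 1 (M - 1) ^ n * desc M ^ Suc M = desc M ^ Suc M * desc_run 1 (M - 1) ^ n"
      by (rule desc_power_central)
    then have "desc M ^ r * desc_run 1 (M - 1) ^ n * desc M ^ Suc M = (desc M ^ r * desc M ^ Suc M) * desc_run 1 (M - 1) ^ n"
      by (metis mult.assoc)
    also have "desc M ^ r * desc M ^ Suc M = desc M ^ q"
      by (simp only: power_add[symmetric] q add.commute)
    finally show ?thesis .
  qed
  also have "markov (Suc M, desc M ^ q * desc_run 1 (M - 1) ^ n) (Suc M, desc (M - 1) ^ n * desc M ^ q)"
    using assms by (intro markov_conjugate_shift) auto
  finally show ?thesis by (rule equivclp_sym)
qed

definition one_bridge :: "nat \<Rightarrow> braid \<Rightarrow> bool" where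
  "one_bridge n x \<longleftrightarrow> (\<exists>\<omega> t b. b + 2 \<le> \<omega> \<and> 1 \<le> t \<and> markov (n, x) (\<omega>, desc b * desc (\<omega> - 1) ^ t))"

lemma one_bridgeI:
  "\<lbrakk>b + 2 \<le> \<omega>; 1 \<le> t; markov (n, x) (\<omega>, desc b * desc (\<omega> - 1) ^ t)\<rbrakk> \<Longrightarrow> one_bridge n x"
  unfolding one_bridge_def by blast

lemma one_bridge_torus: "\<lbrakk>2 \<le> \<omega>; 1 \<le> t; markov (n, x) (\<omega>, desc (\<omega> - 1) ^ t)\<rbrakk> \<Longrightarrow> one_bridge n x"
  by (rule one_bridgeI[of 0]) auto

lemma one_bridge_markov: "markov (n, x) (m, y) \<Longrightarrow> one_bridge m y \<Longrightarrow> one_bridge n x"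
  unfolding one_bridge_def by (meson equivclp_trans)

lemma one_bridge_a:
  assumes "1 \<le> M" "Suc M \<le> q" "1 \<le> n"
  shows "one_bridge (Suc M) (desc (M - 1) ^ n * desc M ^ q)"
  using markov_one_bridge_a[OF assms(1,2)] assms by (intro one_bridgeI[of "q - 1" "q + n" M]) auto

text \<open>On \<open>q\<close> strands the power \<open>desc (p - 1) ^ q\<close> leaves a full
  twist behind, and \<open>desc m ^ n\<close> is a power of full twists because \<open>q\<close>
  divides \<open>n\<close>. It survives the flip unchanged, and everything merges into the torus
  braid on \<open>q\<close> strands with exponent \<open>p + n\<close>.\<close>

lemma one_bridge_b:
  assumes "1 \<le> q" "q \<le> p" "q dvd n"
  shows "one_bridge p (desc (q - 1) ^ n * desc (p - 1) ^ q)"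
proof -
  define d where "d = p - q"
  have p: "p = q + d" using assms by (simp add: d_def)
  obtain k where k: "n = q * k" using assms by (elim dvdE)
  obtain m where m: "q = Suc m" using assms by (cases q) auto
  have "markov (q + d, desc m ^ n * desc (q + d - 1) ^ q) (q, asc (q - 1) ^ d * desc m ^ n * desc (q - 1) ^ q)"
    using letters_desc_power[of m n] m
    by (intro markov_reduce_strands) (auto simp: subset_iff less_Suc_eq_le)
  then have "markov (p, desc m ^ n * desc (p - 1) ^ q) (q, asc m ^ d * desc m ^ n * desc m ^ Suc m)"
    by (simp only: p m diff_Suc_1)
  also have "markov (q, asc m ^ d * desc m ^ n * desc m ^ Suc m) (q, desc m ^ d * desc m ^ n * desc m ^ Suc m)"
    unfolding m
  proof (rule markov_flip)
    have "desc m ^ n = (desc m ^ Suc m) ^ k" by (simp only: k m power_mult)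
    moreover have "half_twist m * desc m ^ Suc m = desc m ^ Suc m * half_twist m"
      by (rule desc_power_central) (rule letters_half_twist)
    ultimately have desc: "half_twist m * desc m ^ n = desc m ^ n * half_twist m"
      using half_twist_flip_power[of m "desc m ^ Suc m" "desc m ^ Suc m" k] by simp
    have "half_twist m * asc m = desc m * half_twist m" using half_twist_flip_asc[of m m] by (simp add: desc_run_0)
    then have asc: "half_twist m * asc m ^ d = desc m ^ d * half_twist m" by (rule half_twist_flip_power)
    show "half_twist m * (asc m ^ d * desc m ^ n) = desc m ^ d * desc m ^ n * half_twist m"
      by (rule half_twist_flip_mult[OF asc desc])
    show "letters (asc m ^ d * desc m ^ n) \<subseteq> {1..m}"
      using letters_asc_power letters_desc_power by fastforce
  qed
  also have "desc m ^ d * desc m ^ n * desc m ^ Suc m = desc m ^ (p + n)"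
    by (simp add: power_add[symmetric] p m ac_simps del: power_Suc)
  finally have *: "markov (p, desc m ^ n * desc (p - 1) ^ q) (q, desc m ^ (p + n))" .
  show ?thesis
  \<comment> \<open>For \<open>q = 1\<close> the reduction ends on one strand, but \<omega> has to
    be at least 2; the trivial braid is stabilized once, to \<open>\<sigma> 1\<close> on two
    strands.\<close>
  proof (cases "m = 0")
    case True
    then have "markov (2, desc (2 - 1) ^ 1) (q, desc m ^ (p + n))"
      using markov_destabilize[of 1 1] m by (simp add: numeral_2_eq_2)
    then have "markov (p, desc m ^ n * desc (p - 1) ^ q) (2, desc (2 - 1) ^ 1)"
      by (rule equivclp_trans[OF * equivclp_sym])
    then have "one_bridge p (desc m ^ n * desc (p - 1) ^ q)"
      by (rule one_bridge_torus[of 2 1, rotated 2]) simp_all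
    then show ?thesis using m by simp
  next
    case False
    then have "one_bridge p (desc m ^ n * desc (p - 1) ^ q)"
      using * m assms by (intro one_bridge_torus[of q "p + n"]) auto
    then show ?thesis using m by simp
  qed
qed

section \<open>The four families\<close>

text \<open>
  The right one of the two letters is moved around the closed braid; whenever it comes back to the
  left one at distance at least two, it is moved past it and starts another turn.
\<close>

lemma markov_move_letter:
  assumes "2 \<le> m"
  shows "\<lbrakk>1 \<le> k; j \<in> {1..m}; (j + k * q) mod Suc m = 2;
     \<And>i. 1 \<le> i \<Longrightarrow> i < k \<Longrightarrow> 2 < (j + i * q) mod Suc m\<rbrakk>
   \<Longrightarrow> markov (Suc m, \<sigma> 1 * \<sigma> j * desc m ^ q) (Suc m, \<sigma> 2 * \<sigma> 1 * desc m ^ q)"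
proof (induction k arbitrary: j)
  case (Suc k)
  define j' where "j' = (j + q) mod Suc m"
  have j': "(j' + i * q) mod Suc m = (j + Suc i * q) mod Suc m" for i
    unfolding j'_def by (simp add: mod_simps ac_simps)
  have j'_ge: "j' \<ge> 2" "j' \<le> m"
  proof -
    show "j' \<le> m" unfolding j'_def by (metis less_Suc_eq_le mod_less_divisor zero_less_Suc)
    show "j' \<ge> 2"
    proof (cases "k = 0")
      case True
      then show ?thesis using Suc.prems(3) by (simp add: j'_def)
    next
      case False
      then show ?thesis using Suc.prems(4)[of 1] by (simp add: j'_def)
    qed
  qed
  have lD: "letters (desc m ^ q) \<subseteq> {1..<Suc m}"
    using letters_desc_power[of m q] by (auto simp: subset_iff less_Suc_eq_le)
  have "\<sigma> j * desc m ^ q = desc m ^ q * \<sigma> j'"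
    using Suc.prems j'_ge by (intro \<sigma>_desc_power) (auto simp: j'_def)
  then have "\<sigma> 1 * \<sigma> j * desc m ^ q = (\<sigma> 1 * desc m ^ q) * \<sigma> j'"
    by (simp only: mult.assoc)
  also have "markov (Suc m, \<dots>) (Suc m, \<sigma> j' * (\<sigma> 1 * desc m ^ q))"
    using lD assms j'_ge by (intro markov_rotate) auto
  finally have step: "markov (Suc m, \<sigma> 1 * \<sigma> j * desc m ^ q) (Suc m, \<sigma> j' * \<sigma> 1 * desc m ^ q)"
    by (simp only: mult.assoc)
  show ?case
  proof (cases "k = 0")
    case True
    then show ?thesis using step Suc.prems(3) by (simp add: j'_def)
  next
    case False
    then have "j' > 2" using Suc.prems(4)[of 1] by (simp add: j'_def)
    then have "\<sigma> j' * \<sigma> 1 = \<sigma> 1 * \<sigma> j'" using \<sigma>_far[of 1 j'] by simp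
    moreover have "markov (Suc m, \<sigma> 1 * \<sigma> j' * desc m ^ q) (Suc m, \<sigma> 2 * \<sigma> 1 * desc m ^ q)"
      using False j'_ge Suc.prems(3) Suc.prems(4)[of "Suc _"]
      by (intro Suc.IH) (auto simp only: j' atLeastAtMost_iff)
    ultimately show ?thesis using step by (simp add: equivclp_trans)
  qed
qed simp

text \<open>Here \<open>k\<close> is the inverse of \<open>q\<close> modulo \<open>p\<close>. A
  letter starting at index 1 has index \<open>1 + i * q\<close> modulo \<open>p\<close> after
  \<open>i\<close> turns and so reaches index 2 after \<open>k\<close> turns. The bound
  \<open>2 * k < p\<close> keeps it away from the residues 0, 1 and 2 on the way.\<close>

lemma one_bridge_full_twist_2_small:
  assumes "3 \<le> p" "0 < k" "2 * k < p" "k * q = n * p + 1"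
  shows "one_bridge p (\<sigma> 1 * \<sigma> 1 * desc (p - 1) ^ q)"
proof -
  define m where "m = p - 1"
  have p: "p = Suc m" "2 \<le> m" using assms by (auto simp: m_def)
  have notdvd: "\<not> int p dvd x" if "0 < \<bar>x\<bar>" "\<bar>x\<bar> < int p" for x
    using that zdvd_imp_le[of "int p" "\<bar>x\<bar>"] by auto
  have key: "2 < (1 + i * q) mod Suc m" if i: "1 \<le> i" "i < k" for i
  proof (rule ccontr)
    define c where "c = (1 + i * q) mod p"
    assume "\<not> ?thesis"
    then have c: "c \<in> {0, 1, 2}" unfolding c_def p by auto
    have "int p dvd int (1 + i * q) - int c"
      unfolding c_def by (simp only: zmod_int mod_eq_dvd_iff[symmetric] mod_mod_trivial)
    \<comment> \<open>Multiplication by \<open>k\<close> replaces \<open>i * q\<close> by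
      \<open>i\<close> modulo \<open>p\<close>. For \<open>c\<close> = 0, 1, 2 the result is
      \<open>k + i\<close>, \<open>i\<close>, \<open>i - k\<close>: nonzero and of absolute value
      below \<open>2 * k\<close>, hence not divisible by \<open>p\<close>.\<close>
    then have "int p dvd int k * (int (1 + i * q) - int c)" by simp
    also have "int k * (int (1 + i * q) - int c) = int k * (1 - int c) + int i * int (k * q)"
      by (simp add: algebra_simps)
    also have "\<dots> = (int k * (1 - int c) + int i) + int p * int (i * n)"
      by (simp only: assms(4)) (simp add: algebra_simps)
    finally have "int p dvd int k * (1 - int c) + int i"
      using dvd_add_left_iff[of "int p" "int p * int (i * n)"] by simp
    moreover have "\<bar>int k * (1 - int c) + int i\<bar> < int p" "0 < \<bar>int k * (1 - int c) + int i\<bar>"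
      using c i assms(3) by auto
    ultimately show False using notdvd by blast
  qed
  have "(1 + k * q) mod Suc m = (2 + n * Suc m) mod Suc m"
    using assms(4) p by (simp add: ac_simps)
  also have "\<dots> = 2" using p by (simp only: mod_mult_self3 mod_less mod_mult_self1)
  finally have "(1 + k * q) mod Suc m = 2" .
  then have *: "markov (Suc m, \<sigma> 1 * \<sigma> 1 * desc m ^ q) (Suc m, \<sigma> 2 * \<sigma> 1 * desc m ^ q)"
    using p key assms(2) by (intro markov_move_letter[of m k]) auto
  have D2: "desc 2 = \<sigma> 2 * \<sigma> 1" by (simp add: numeral_2_eq_2)
  show ?thesis
  \<comment> \<open>On three strands \<open>desc 2\<close> is the complete descending word, and b =
    2 would exceed \<omega> - 2; it is absorbed into the power instead.\<close>
  proof (cases "m = 2")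
    case True
    with * show ?thesis
      by (intro one_bridge_torus[of 3 "Suc q"]) (simp_all add: p D2)
  next
    case False
    have "0 < q" by (rule ccontr) (use assms(4) in simp)
    with * False show ?thesis
      using p by (intro one_bridgeI[of 2 p q]) (auto simp: D2)
  qed
qed

text \<open>This is the symmetry of torus links in \<open>p\<close> and \<open>q\<close>, which
  persists in the presence of a full twist on two strands: reducing to \<open>q\<close> strands and
  flipping moves the twist to the other end, and the descending power carries it back.\<close>

lemma markov_swap_full_twist_2:
  assumes "2 \<le> q" "q \<le> p"
  shows "markov (p, \<sigma> 1 * \<sigma> 1 * desc (p - 1) ^ q) (q, \<sigma> 1 * \<sigma> 1 * desc (q - 1) ^ p)"
proof -
  define d where "d = p - q"
  define m where "m = q - 1"
  have p: "p = q + d" and q: "q = Suc m" "1 \<le> m" using assms by (auto simp: d_def m_def)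
  have "markov (q + d, \<sigma> 1 * \<sigma> 1 * desc (q + d - 1) ^ q) (q, asc (q - 1) ^ d * (\<sigma> 1 * \<sigma> 1) * desc (q - 1) ^ q)"
    using assms by (intro markov_reduce_strands) auto
  then have "markov (p, \<sigma> 1 * \<sigma> 1 * desc (p - 1) ^ q) (Suc m, asc m ^ d * (\<sigma> 1 * \<sigma> 1) * desc m ^ Suc m)"
    by (simp only: p q diff_Suc_1)
  also have "markov (Suc m, asc m ^ d * (\<sigma> 1 * \<sigma> 1) * desc m ^ Suc m) (Suc m, desc m ^ d * (\<sigma> m * \<sigma> m) * desc m ^ Suc m)"
  proof (rule markov_flip)
    have "half_twist m * asc m = desc m * half_twist m" using half_twist_flip_asc[of m m] by (simp add: desc_run_0)
    then have asc: "half_twist m * asc m ^ d = desc m ^ d * half_twist m" by (rule half_twist_flip_power)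
    have \<sigma>: "half_twist m * \<sigma> 1 = \<sigma> m * half_twist m" using half_twist_flip_\<sigma>[of 1 m] q by simp
    show "half_twist m * (asc m ^ d * (\<sigma> 1 * \<sigma> 1)) = desc m ^ d * (\<sigma> m * \<sigma> m) * half_twist m"
      by (rule half_twist_flip_mult[OF asc half_twist_flip_mult[OF \<sigma> \<sigma>]])
    show "letters (asc m ^ d * (\<sigma> 1 * \<sigma> 1)) \<subseteq> {1..m}"
      using letters_asc_power[of m d] q by auto
  qed
  \<comment> \<open>The full twist is split with exponents 2 and \<open>m - 1\<close>, because
    \<open>desc m ^ (m - 1)\<close> is the power that exchanges \<open>\<sigma> m\<close> for
    \<open>\<sigma> 1\<close>. The exponents \<open>m - 1\<close> and \<open>d + 2\<close> then add
    up to \<open>p\<close>.\<close>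
  also have "desc m ^ d * (\<sigma> m * \<sigma> m) * desc m ^ Suc m = desc m ^ (d + 2) * (\<sigma> 1 * \<sigma> 1 * desc m ^ (m - 1))"
  proof -
    have "(\<sigma> m * \<sigma> m) * desc m ^ Suc m = desc m ^ Suc m * (\<sigma> m * \<sigma> m)"
      by (rule desc_power_central) (use q in auto)
    also have "desc m ^ Suc m * (\<sigma> m * \<sigma> m) = desc m ^ 2 * ((desc m ^ (m - 1) * \<sigma> m) * \<sigma> m)"
    proof -
      have "desc m ^ Suc m = desc m ^ 2 * desc m ^ (m - 1)"
        using q by (simp add: power_add[symmetric] del: power_Suc)
      then show ?thesis by (simp only: mult.assoc)
    qed
    also have "desc m ^ (m - 1) * \<sigma> m = \<sigma> 1 * desc m ^ (m - 1)"
      using q by (intro \<sigma>_desc_power[symmetric]) auto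
    also have "\<sigma> 1 * desc m ^ (m - 1) * \<sigma> m = \<sigma> 1 * \<sigma> 1 * desc m ^ (m - 1)"
    proof -
      have "\<sigma> 1 * desc m ^ (m - 1) = desc m ^ (m - 1) * \<sigma> m"
        using q by (intro \<sigma>_desc_power) auto
      then show ?thesis by (metis mult.assoc)
    qed
    finally show ?thesis by (simp only: mult.assoc power_add)
  qed
  also have "markov (Suc m, \<dots>) (Suc m, (\<sigma> 1 * \<sigma> 1 * desc m ^ (m - 1)) * desc m ^ (d + 2))"
    using letters_desc_power[of m "m - 1"] letters_desc_power[of m "d + 2"] q
    by (intro markov_rotate) (auto simp: subset_iff less_Suc_eq_le)
  also have "(\<sigma> 1 * \<sigma> 1 * desc m ^ (m - 1)) * desc m ^ (d + 2) = \<sigma> 1 * \<sigma> 1 * desc m ^ p"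
    using q by (simp add: mult.assoc power_add[symmetric] p del: power_Suc)
  finally show ?thesis by (simp add: q)
qed

lemma coprime_inverse_mod:
  fixes p q :: nat
  assumes "coprime p q" "2 \<le> p" "0 < q"
  obtains k n where "0 < k" "k < p" "k * q = n * p + 1"
proof -
  obtain d x y where d: "d dvd q" "d dvd p" "q * x = p * y + d"
    using bezout_add_strong_nat[of q p] assms by auto
  then have d1: "d = 1" using assms by (metis coprime_common_divisor_nat)
  define k where "k = x mod p"
  have x: "x = k + p * (x div p)" by (simp add: k_def)
  have "q * k + p * (q * (x div p)) = p * y + 1"
    using d(3) d1 by (subst (asm) x) (simp add: algebra_simps)
  moreover have "k \<noteq> 0"
  proof
    assume "k = 0"
    then have "p dvd p * y + 1" using d(3) d1 x by (metis add_0 dvd_triv_left dvd_mult)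
    then have "p dvd 1" using dvd_add_right_iff[of p "p * y" 1] by simp
    then show False using assms by simp
  qed
  moreover from this have "q * k \<ge> 1" using assms by simp
  ultimately have "p * (q * (x div p)) \<le> p * y" by linarith
  moreover have "(y - q * (x div p)) * p = p * y - p * (q * (x div p))"
    by (simp only: mult.commute[of _ p] diff_mult_distrib2)
  ultimately have "k * q = (y - q * (x div p)) * p + 1"
    using \<open>q * k + p * (q * (x div p)) = p * y + 1\<close> mult.commute[of k q] by linarith
  moreover have "k < p" using assms by (simp add: k_def)
  ultimately show thesis using that \<open>k \<noteq> 0\<close> by blast
qed

text \<open>Subtracting \<open>k * q = n * p + 1\<close> from \<open>p * q\<close> exhibits
  \<open>q - n\<close> as the inverse of \<open>p\<close> modulo \<open>q\<close>. If
  \<open>k\<close> exceeds \<open>p / 2\<close>, then \<open>n\<close> exceeds \<open>q / 2\<close>,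
  so this inverse is below \<open>q / 2\<close>. Equality \<open>2 * k = p\<close> would make
  \<open>k\<close> a divisor of 1.\<close>

lemma coprime_inverse_swap:
  fixes p q k n :: nat
  assumes "3 \<le> p" "3 \<le> q" "k < p" "k * q = n * p + 1" "\<not> 2 * k < p"
  shows "n < q" "q < 2 * n" "(q - n) * p = (p - k) * q + 1"
proof -
  have kq: "k * q < p * q" by (rule mult_strict_right_mono) (use assms in auto)
  then have "n * p < q * p" using assms(4) mult.commute[of p q] by linarith
  then show "n < q" by simp
  have "2 * k \<noteq> p"
  proof
    assume p: "2 * k = p"
    have "n * p = k * (2 * n)" by (simp add: p[symmetric])
    then have "k dvd n * p" by (metis dvd_triv_left)
    moreover have "k dvd n * p + 1" using assms(4) by (metis dvd_triv_left)
    ultimately have "k dvd 1" by (rule dvd_add_right_iff[THEN iffD1])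
    then show False using p assms(1) by simp
  qed
  then have "(p + 1) * q \<le> (2 * k) * q" using assms(5) by (intro mult_le_mono1) simp
  also have "(2 * k) * q = 2 * (n * p) + 2" using assms(4) by (simp only: mult.assoc) simp
  finally have "q * p + q \<le> 2 * (n * p) + 2" by (simp add: mult.commute)
  then have "q * p < (2 * n) * p" using assms(2) mult.assoc[of 2 n p] by linarith
  then show "q < 2 * n" by simp
  have "(q - n) * p = q * p - n * p" "(p - k) * q = p * q - k * q"
    by (rule diff_mult_distrib)+
  then show "(q - n) * p = (p - k) * q + 1"
    using kq assms(4) mult.commute[of p q] by linarith
qed

lemma one_bridge_c:
  assumes "coprime p q" "0 < p" "0 < q"
  shows "one_bridge (max p 2) (desc 1 ^ 2 * desc (p - 1) ^ q)"
proof -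
  have D1: "desc 1 ^ 2 = \<sigma> 1 * \<sigma> 1" by (simp add: power2_eq_square)
  \<comment> \<open>For \<open>p = 1\<close> the letter \<open>\<sigma> 1\<close> needs a second
    strand, hence \<open>max p 2\<close>. All cases but the last end in torus braids on two strands;
    the last needs both parameters to be at least 3 for the exchange of inverses.\<close>
  consider "p = 1" | "p = 2" | "p \<ge> 3" "q = 1" | "p \<ge> 3" "q = 2" | "p \<ge> 3" "q \<ge> 3"
    using assms by linarith
  then show ?thesis
  proof cases
    case 1
    then show ?thesis by (intro one_bridge_torus[of 2 2]) (auto simp: max_def numeral_2_eq_2)
  next
    case 2
    then show ?thesis by (intro one_bridge_torus[of 2 "2 + q"]) (auto simp: power2_eq_square mult.assoc)
  next
    case 3
    have "markov (2 + (p - 2), desc 1 ^ 2 * desc (2 + (p - 2) - 1) ^ 1) (2, asc (1 - 1) ^ (p - 2) * desc 1 ^ 2 * desc (2 - 1) ^ 1)"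
      by (rule markov_reduce_strands) (auto simp: power2_eq_square)
    moreover have "2 + (p - 2) = p" using 3 by simp
    ultimately have "markov (p, desc 1 ^ 2 * desc (p - 1)) (2, desc 1 ^ 3)"
      by (simp add: numeral_3_eq_3 power2_eq_square mult.assoc del: add_2_eq_Suc)
    then show ?thesis using 3
      by (intro one_bridge_torus[of 2 3]) (auto simp: max_def)
  next
    case 4
    then show ?thesis using markov_swap_full_twist_2[of 2 p]
      by (intro one_bridge_torus[of 2 "2 + p"]) (auto simp: power_add power2_eq_square max_def mult.assoc)
  next
    case 5
    have "p \<noteq> q" using assms 5 by auto
    obtain k n where kn: "0 < k" "k < p" "k * q = n * p + 1"
      using coprime_inverse_mod[OF assms(1)] 5 by auto
    have "one_bridge p (\<sigma> 1 * \<sigma> 1 * desc (p - 1) ^ q)"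
    proof (cases "2 * k < p")
      case True
      then show ?thesis using one_bridge_full_twist_2_small 5 kn by blast
    next
      case False
      have n: "n < q" "q < 2 * n" "(q - n) * p = (p - k) * q + 1"
        by (rule coprime_inverse_swap[OF 5 kn(2,3) False])+
      have sw: "one_bridge q (\<sigma> 1 * \<sigma> 1 * desc (q - 1) ^ p)"
        using 5 n by (intro one_bridge_full_twist_2_small[of q "q - n" p "p - k"]) auto
      show ?thesis
      proof (cases "q \<le> p")
        case True
        then have "markov (p, \<sigma> 1 * \<sigma> 1 * desc (p - 1) ^ q) (q, \<sigma> 1 * \<sigma> 1 * desc (q - 1) ^ p)"
          using 5 by (intro markov_swap_full_twist_2) auto
        then show ?thesis using sw by (rule one_bridge_markov)
      next
        case False
        then have "markov (p, \<sigma> 1 * \<sigma> 1 * desc (p - 1) ^ q) (q, \<sigma> 1 * \<sigma> 1 * desc (q - 1) ^ p)"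
          using 5 by (intro equivclp_sym[OF markov_swap_full_twist_2]) auto
        then show ?thesis using sw by (rule one_bridge_markov)
      qed
    qed
    then show ?thesis using 5 by (simp add: power2_eq_square max_def)
  qed
qed

text \<open>With \<open>m = p - 1\<close>, the extra factor is a full twist \<open>g * g\<close> on
  \<open>p - 2\<close> strands. Both parts rest on \<open>g * E = V * g\<close> and
  \<open>V * (g * g) = E ^ (m - 1)\<close>: once an ascending \<open>V\<close> stands next to the
  full twist, the two fuse into a power of the descending word \<open>E\<close> on
  \<open>p - 1\<close> strands, as required in (a). For exponent 1 modulo \<open>p\<close>,
  \<open>V\<close> is produced from \<open>E\<close> by carrying one \<open>g\<close> around; for
  exponent \<open>m\<close> modulo \<open>p\<close>, it is already contained in
  \<open>desc m ^ m\<close>.\<close>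

lemma one_bridge_d:
  assumes "2 \<le> m"
  shows one_bridge_d_plus: "0 < k \<Longrightarrow> one_bridge (Suc m) (desc (m - 2) ^ (m - 1) * desc m ^ (k * Suc m + 1))"
    and one_bridge_d_minus: "one_bridge (Suc m) (desc (m - 2) ^ (m - 1) * desc m ^ (j * Suc m + m))"
proof -
  define g where "g = half_twist (m - 2)"
  define E where "E = desc (m - 1)"
  define V where "V = asc (m - 1)"
  obtain m' where m': "m = Suc (Suc m')" using assms by (metis add_2_eq_Suc le_Suc_ex)
  have lg: "letters g \<subseteq> {1..m - 2}" and lE: "letters E \<subseteq> {1..m - 1}" and lV: "letters V \<subseteq> {1..m - 1}"
    by (simp_all only: g_def letters_half_twist E_def letters_desc V_def letters_asc order_refl)
  have le: "letters x \<subseteq> {1..<Suc m}" if "letters x \<subseteq> {1..k}" "k \<le> m" for x k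
    using that by (auto simp: subset_iff less_Suc_eq_le)
  note le_g = le[OF lg] and le_E = le[OF lE] and le_V = le[OF lV]
  note le_E_pow = le[OF letters_pow_le[OF lE]]
  note le_desc = le[OF letters_desc_power, of m]
  have gg: "desc (m - 2) ^ (m - 1) = g * g"
    using half_twist_square[of "m - 2"] by (simp add: g_def m')
  have Vgg: "V * (g * g) = E ^ (m - 1)"
    using desc_power_self[of "m - 1"] gg by (simp add: V_def E_def m')
  have gE: "g * E = V * g"
    using half_twist_asc[of m'] by (simp add: g_def E_def V_def m')
  have Dm: "desc m = \<sigma> m * E" by (simp add: E_def m')
  have g\<sigma>: "g * \<sigma> m = \<sigma> m * g"
    by (rule commute_far) (use lg m' in auto)
  have central: "x * desc m ^ (i * Suc m) = desc m ^ (i * Suc m) * x" if "letters x \<subseteq> {1..<Suc m}" for x i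
  proof -
    have "letters x \<subseteq> {1..m}" using that by (auto simp: subset_iff less_Suc_eq_le)
    then have "x * desc m ^ Suc m = desc m ^ Suc m * x" by (rule desc_power_central)
    then have "x * (desc m ^ Suc m) ^ i = (desc m ^ Suc m) ^ i * x" by (metis power_commuting_commutes)
    then show ?thesis by (simp only: power_mult[symmetric] mult.commute)
  qed
  have exp: "m - 1 = Suc (m - 2)" using m' by simp
  show "one_bridge (Suc m) (desc (m - 2) ^ (m - 1) * desc m ^ (k * Suc m + 1))" if "0 < k"
  proof -
    define Z where "Z = desc m ^ (k * Suc m)"
    have lZ: "letters Z \<subseteq> {1..<Suc m}" unfolding Z_def by (rule le_desc) simp
    have Zc: "x * Z = Z * x" if "letters x \<subseteq> {1..<Suc m}" for x
      unfolding Z_def using that by (rule central)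
    have "desc (m - 2) ^ (m - 1) * desc m ^ (k * Suc m + 1) = (g * g) * (desc m * Z)"
      by (simp only: gg Z_def power_add power_one_right)
         (simp only: power_commutes[symmetric] power_one_right)
    also have "\<dots> = (g * g * \<sigma> m) * (E * Z)" by (simp only: Dm mult.assoc)
    also have "markov (Suc m, \<dots>) (Suc m, (E * Z) * (g * g * \<sigma> m))"
      by (rule markov_rotate) (use le_g le_E lZ m' in auto)
    also have "(E * Z) * (g * g * \<sigma> m) = (E * Z * g * \<sigma> m) * g"
      by (metis mult.assoc g\<sigma>)
    also have "markov (Suc m, \<dots>) (Suc m, g * (E * Z * g * \<sigma> m))"
      by (rule markov_rotate) (use le_g le_E lZ m' in auto)
    also have "g * (E * Z * g * \<sigma> m) = (g * E) * (Z * (g * \<sigma> m))" by (simp only: mult.assoc)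
    also have "Z * (g * \<sigma> m) = g * \<sigma> m * Z" by (rule Zc[symmetric]) (use le_g m' in auto)
    also have "(g * E) * (g * \<sigma> m * Z) = (V * (g * g)) * (\<sigma> m * Z)" by (simp only: gE mult.assoc)
    also have "\<dots> = E * (E ^ (m - 2) * \<sigma> m * Z)" by (simp only: Vgg exp power_Suc mult.assoc)
    also have "markov (Suc m, \<dots>) (Suc m, (E ^ (m - 2) * \<sigma> m * Z) * E)"
      by (rule markov_rotate) (use le_E le_E_pow[of "m - 2"] lZ m' in auto)
    also have "(E ^ (m - 2) * \<sigma> m * Z) * E = E ^ (m - 2) * (desc m * Z)"
    proof -
      have "Z * E = E * Z" using Zc[OF le_E] by simp
      then show ?thesis by (metis Dm mult.assoc)
    qed
    also have "desc m * Z = desc m ^ (k * Suc m + 1)" by (simp add: Z_def)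
    finally have *: "markov (Suc m, desc (m - 2) ^ (m - 1) * desc m ^ (k * Suc m + 1))
        (Suc m, E ^ (m - 2) * desc m ^ (k * Suc m + 1))" .
    show ?thesis
    \<comment> \<open>For three strands the exponent \<open>m - 2\<close> of the extra factor is 0,
      and the braid is a torus braid.\<close>
    proof (cases "m' = 0")
      case True
      then show ?thesis using * by (intro one_bridge_torus[of 3 "k * Suc m + 1"]) (simp_all add: m' numeral_2_eq_2 numeral_3_eq_3)
    next
      case False
      have "1 * Suc m \<le> k * Suc m" using that by (intro mult_le_mono1) simp
      then have "one_bridge (Suc m) (E ^ (m - 2) * desc m ^ (k * Suc m + 1))"
        unfolding E_def using False m' by (intro one_bridge_a) auto
      with * show ?thesis by (rule one_bridge_markov)
    qed
  qed
  show "one_bridge (Suc m) (desc (m - 2) ^ (m - 1) * desc m ^ (j * Suc m + m))"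
  proof -
    define Z where "Z = desc m ^ (j * Suc m)"
    define Y where "Y = E ^ m"
    have lZ: "letters Z \<subseteq> {1..<Suc m}" unfolding Z_def by (rule le_desc) simp
    have lY: "letters Y \<subseteq> {1..<Suc m}" unfolding Y_def by (rule le_E_pow) simp
    have Zc: "x * Z = Z * x" if "letters x \<subseteq> {1..<Suc m}" for x
      unfolding Z_def using that by (rule central)
    have gY: "g * Y = Y * g"
      using desc_power_central[of g "m - 1"] lg m' by (force simp: Y_def E_def)
    have "desc m ^ m = V * \<sigma> m * Y"
      using desc_power_self[of m] by (simp add: m' V_def E_def Y_def)
    then have "desc (m - 2) ^ (m - 1) * desc m ^ (j * Suc m + m) = (g * g) * (V * \<sigma> m * Y * Z)"
      by (simp only: gg Z_def power_add[symmetric] add.commute[of _ m]) (simp only: power_add mult.assoc)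
    also have "markov (Suc m, \<dots>) (Suc m, (V * \<sigma> m * Y * Z) * (g * g))"
      by (rule markov_rotate) (use le_g le_V lZ lY m' in auto)
    also have "(V * \<sigma> m * Y * Z) * (g * g) = V * (\<sigma> m * (Y * (Z * (g * g))))" by (simp only: mult.assoc)
    also have "Z * (g * g) = g * g * Z" by (rule Zc[symmetric]) (use le_g m' in auto)
    also have "Y * (g * g * Z) = g * g * (Y * Z)" by (metis gY mult.assoc)
    also have "\<sigma> m * (g * g * (Y * Z)) = g * g * \<sigma> m * (Y * Z)" by (metis g\<sigma> mult.assoc)
    also have "V * (g * g * \<sigma> m * (Y * Z)) = (V * (g * g)) * (\<sigma> m * Y * Z)" by (simp only: mult.assoc)
    also have "\<dots> = E * (E ^ (m - 2) * \<sigma> m * Y * Z)" by (simp only: Vgg exp power_Suc mult.assoc)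
    also have "markov (Suc m, \<dots>) (Suc m, (E ^ (m - 2) * \<sigma> m * Y * Z) * E)"
      by (rule markov_rotate) (use le_E le_E_pow[of "m - 2"] lZ lY m' in auto)
    also have "(E ^ (m - 2) * \<sigma> m * Y * Z) * E = (E ^ (m - 2) * (\<sigma> m * E) * Z) * Y"
    proof -
      have "Z * E = E * Z" "Z * Y = Y * Z" using Zc le_E lY m' by auto
      moreover have "Y * E = E * Y" unfolding Y_def by (rule power_commutes)
      ultimately show ?thesis by (metis mult.assoc)
    qed
    also have "\<dots> = (E ^ (m - 2) * desc m * Z) * Y" by (simp only: Dm)
    also have "markov (Suc m, \<dots>) (Suc m, Y * (E ^ (m - 2) * desc m * Z))"
      by (rule markov_rotate) (use le_E_pow[of "m - 2"] lZ lY le[of "desc m" m] letters_desc[of m] in auto)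
    also have "Y * (E ^ (m - 2) * desc m * Z) = E ^ (2 * m - 2) * desc m ^ (j * Suc m + 1)"
    proof -
      have "m + (m - 2) = 2 * m - 2" using m' by simp
      then have "E ^ (2 * m - 2) = Y * E ^ (m - 2)" unfolding Y_def by (metis power_add)
      moreover have "desc m ^ (j * Suc m + 1) = desc m * Z" unfolding Z_def by (simp only: Suc_eq_plus1[symmetric] power_Suc)
      ultimately show ?thesis by (simp only: mult.assoc)
    qed
    finally have *: "markov (Suc m, desc (m - 2) ^ (m - 1) * desc m ^ (j * Suc m + m))
        (Suc m, E ^ (2 * m - 2) * desc m ^ (j * Suc m + 1))" .
    show ?thesis
    \<comment> \<open>For \<open>j = 0\<close> the remaining exponent 1 is too small for (a). The
      letter \<open>\<sigma> m\<close> then occurs only once, and removing it leaves a torus braid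
      on \<open>m\<close> strands.\<close>
    proof (cases "j = 0")
      case True
      have "E ^ (2 * m - 2) * desc m = (E ^ (2 * m - 2) * \<sigma> m) * E" by (simp add: Dm mult.assoc)
      also have "markov (Suc m, \<dots>) (Suc m, E * (E ^ (2 * m - 2) * \<sigma> m))"
        by (rule markov_rotate) (use le_E le_E_pow[of "2 * m - 2"] m' in auto)
      also have "E * (E ^ (2 * m - 2) * \<sigma> m) = E ^ (2 * m - 1) * \<sigma> m"
        by (simp add: m' mult.assoc)
      also have "markov (Suc m, \<dots>) (m, E ^ (2 * m - 1))"
        using letters_pow_le[OF lE, of "2 * m - 1"] m'
        by (intro markov_destabilize) (auto simp: subset_iff less_Suc_eq_le)
      finally have "markov (Suc m, E ^ (2 * m - 2) * desc m) (m, desc (m - 1) ^ (2 * m - 1))"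
        by (simp only: E_def)
      then show ?thesis using * True assms
        by (intro one_bridge_markov[OF *] one_bridge_torus[of m "2 * m - 1"]) auto
    next
      case False
      have "1 * Suc m \<le> j * Suc m" using False by (intro mult_le_mono1) simp
      then have "one_bridge (Suc m) (E ^ (2 * m - 2) * desc m ^ (j * Suc m + 1))"
        unfolding E_def using m' by (intro one_bridge_a) auto
      with * show ?thesis by (rule one_bridge_markov)
    qed
  qed
qed

lemma one_bridge_twisted_torus:
  fixes p q l n :: nat
  assumes pos: "0 < p" "0 < q" "0 < l" "0 < n"
    and "(q \<ge> l + 1 \<and> l + 1 = p)
       \<or> (q = l \<and> l dvd n \<and> coprime p q \<and> l \<le> p)
       \<or> (l = 2 \<and> n = 2 \<and> coprime p q)
       \<or> (l = n \<and> int n = int p - 2 \<and>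
            (\<exists>k::nat. 0 < k \<and> (int q = int k * int p + 1 \<or> int q = int k * int p - 1)))"
  shows "one_bridge (max p l) (desc (l - 1) ^ n * desc (p - 1) ^ q)"
  using assms(5)
proof (elim disjE conjE exE)
  assume "q \<ge> l + 1" "l + 1 = p"
  then show ?thesis using one_bridge_a[of l q n] pos by auto
next
  assume "q = l" "l dvd n" "l \<le> p"
  then show ?thesis using one_bridge_b[of q p n] pos by (simp add: max_def)
next
  assume "l = 2" "n = 2" "coprime p q"
  then show ?thesis using one_bridge_c[of p q] pos by simp
next
  fix k :: nat assume ln: "l = n" "int n = int p - 2" and k: "0 < k" "int q = int k * int p + 1"
  define m where "m = p - 1"
  have m: "p = Suc m" "n = m - 1" "l = m - 1" "2 \<le> m" using ln pos by (auto simp: m_def)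
  have "int q = int (k * p + 1)" using k by simp
  then have "q = k * p + 1" by (simp only: of_nat_eq_iff)
  then have "q = k * Suc m + 1" using m by simp
  moreover have "max p l = Suc m" "l - 1 = m - 2" "p - 1 = m" using m by auto
  ultimately show ?thesis using one_bridge_d_plus[of m k] m(2,4) k by (simp only:)
next
  fix k :: nat assume ln: "l = n" "int n = int p - 2" and k: "0 < k" "int q = int k * int p - 1"
  define m where "m = p - 1"
  have m: "p = Suc m" "n = m - 1" "l = m - 1" "2 \<le> m" using ln pos by (auto simp: m_def)
  \<comment> \<open>The exponent \<open>k * p - 1\<close> is \<open>(k - 1) * p + m\<close>, which
    avoids truncated subtraction.\<close>
  obtain j where j: "k = Suc j" using k by (cases k) auto
  have "int q = int (j * Suc m + m)" using k j m by (simp add: algebra_simps)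
  then have "q = j * Suc m + m" by (simp only: of_nat_eq_iff)
  moreover have "max p l = Suc m" "l - 1 = m - 2" "p - 1 = m" using m by auto
  ultimately show ?thesis using one_bridge_d_minus[of m j] m(2,4) by (simp only:)
qed

section \<open>Oriented links and ambient isotopies\<close>

text \<open>\<open>H\<close> is the lift to the real line of an orientation-preserving homeomorphism
  of the circle. Base point and reparametrization are treated together, so that transitivity and
  symmetry come from composing and inverting lifts.\<close>

definition loop_eq :: "(real \<Rightarrow> 'a) \<Rightarrow> (real \<Rightarrow> 'a) \<Rightarrow> bool" where
  "loop_eq c d \<longleftrightarrow> (\<exists>H. continuous_on UNIV H \<and> strict_mono H \<and> (\<forall>t. H (t + 1) = H t + 1) \<and>
      (\<forall>t. d (frac t) = c (frac (H t))))"

lemma loop_eq_refl [simp]: "loop_eq c c"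
  unfolding loop_eq_def by (rule exI[of _ id]) (auto simp: strict_mono_def)

lemma loop_eq_trans:
  assumes "loop_eq b c" "loop_eq c d"
  shows "loop_eq b d"
proof -
  obtain H where H: "continuous_on UNIV H" "strict_mono H" "\<And>t. H (t + 1) = H t + 1"
      "\<And>t. c (frac t) = b (frac (H t))"
    using assms(1) unfolding loop_eq_def by metis
  obtain K where K: "continuous_on UNIV K" "strict_mono K" "\<And>t. K (t + 1) = K t + 1"
      "\<And>t. d (frac t) = c (frac (K t))"
    using assms(2) unfolding loop_eq_def by metis
  have "continuous_on UNIV (H \<circ> K)"
    using H(1) K(1) continuous_on_compose continuous_on_subset by blast
  moreover have "strict_mono (H \<circ> K)"
    using H(2) K(2) by (simp add: strict_mono_def)
  ultimately show ?thesis
    unfolding loop_eq_def using H(3,4) K(3,4) by (intro exI[of _ "H \<circ> K"]) simp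
qed

lemma shift_of_int:
  fixes H :: "real \<Rightarrow> real"
  assumes "\<And>t. H (t + 1) = H t + 1"
  shows "H (t + of_int k) = H t + of_int k"
proof (induction k rule: int_induct[of _ 0])
  case (step1 i)
  then show ?case using assms[of "t + of_int i"] by (simp add: add.assoc)
next
  case (step2 i)
  then show ?case using assms[of "t + of_int (i - 1)"] by (simp add: add.assoc)
qed simp

lemma loop_eq_sym:
  assumes "loop_eq c d"
  shows "loop_eq d c"
proof -
  obtain H where H: "continuous_on UNIV H" "strict_mono H" "\<And>t. H (t + 1) = H t + 1"
      "\<And>t. d (frac t) = c (frac (H t))"
    using assms(1) unfolding loop_eq_def by metis
  have surj: "\<exists>t. H t = y" for y
  proof -
    define a :: real where "a = of_int \<lfloor>y - H 0\<rfloor>"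
    have "H a = H 0 + a" "H (a + 1) = H 0 + a + 1"
      using shift_of_int[of H 0, OF H(3)] H(3) by (simp_all add: a_def)
    moreover have "H 0 + a \<le> y" "y \<le> H 0 + a + 1"
      unfolding a_def by linarith+
    ultimately show ?thesis
      using IVT'[of H a y "a + 1"] continuous_on_subset[OF H(1)] by auto
  qed
  define K where "K = inv H"
  have HK: "H (K y) = y" for y unfolding K_def using surj by (metis f_inv_into_f rangeI)
  have KH: "K (H t) = t" for t unfolding K_def using strict_mono_imp_inj_on[OF H(2)] by simp
  have "isCont K (H t)" for t
    by (rule isCont_inverse_function[of 1]) (use KH H(1) in \<open>auto simp: continuous_on_eq_continuous_at\<close>)
  then have "continuous_on UNIV K" by (metis HK continuous_at_imp_continuous_on)
  moreover have "strict_mono K"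
    using strict_mono_less[OF H(2)] by (metis HK strict_monoI)
  moreover have "K (y + 1) = K y + 1" for y by (metis H(3) HK KH)
  ultimately show ?thesis
    unfolding loop_eq_def using H(4) HK by (intro exI[of _ K]) metis
qed

lemma loop_eq_image: "loop_eq c d \<Longrightarrow> loop_eq (f \<circ> c) (f \<circ> d)"
  unfolding loop_eq_def by (metis comp_apply)

text \<open>The lift splits into the base point \<open>frac (H 0)\<close> and the reparametrization
  \<open>H s - H 0\<close> of the unit interval. Closedness is needed because
  \<open>shiftpath\<close> reads the value at 1 where \<open>frac\<close> reads the value at
  0.\<close>

lemma loop_eq_imp_same_oriented_loop:
  assumes "loop_eq c d" "c 0 = c 1" "d 0 = d 1"
  shows "same_oriented_loop c d"
proof -
  obtain H where H: "continuous_on UNIV H" "strict_mono H" "\<And>t. H (t + 1) = H t + 1"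
      "\<And>t. d (frac t) = c (frac (H t))"
    using assms(1) unfolding loop_eq_def by metis
  define h where "h s = H s - H 0" for s
  have h01: "h 0 = 0" "h 1 = 1" using H(3)[of 0] by (auto simp: h_def)
  have mono: "strict_mono_on {0..1} h"
    using H(2) by (auto simp: strict_mono_on_def strict_mono_def h_def)
  have hbd: "0 \<le> h s" "h s \<le> 1" if "s \<in> {0..1}" for s
    using that strict_mono_less_eq[OF H(2), of 0 s] strict_mono_less_eq[OF H(2), of s 1] h01
    by (auto simp: h_def)
  have dfrac: "d s = d (frac s)" if "s \<in> {0..1}" for s
    using that assms(3) by (cases "s = 1") (auto simp: frac_eq)
  have "d s = shiftpath (frac (H 0)) c (h s)" if s: "s \<in> {0..1}" for s
  proof -
    define a where "a = frac (H 0)"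
    have a: "0 \<le> a" "a < 1" by (auto simp: a_def frac_lt_1)
    have "H s = of_int \<lfloor>H 0\<rfloor> + (a + h s)" by (simp add: a_def h_def frac_def)
    then have fr: "frac (H s) = frac (a + h s)" by (simp add: frac_def)
    have "c (frac (a + h s)) = (if a + h s \<le> 1 then c (a + h s) else c (a + h s - 1))"
    proof -
      consider "a + h s < 1" | "a + h s = 1" | "1 < a + h s" "a + h s < 2"
        using a hbd[OF s] by linarith
      then show ?thesis
      proof cases
        case 1
        then have "frac (a + h s) = a + h s" using a hbd[OF s] by (simp add: frac_eq)
        then show ?thesis using 1 by simp
      next
        case 2
        then show ?thesis using assms(2) by simp
      next
        case 3
        then have "frac (a + h s) = a + h s - 1" by (simp add: frac_unique_iff)
        then show ?thesis using 3 by simp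
      qed
    qed
    then show ?thesis using dfrac[OF s] H(4)[of s] fr by (simp add: shiftpath_def a_def)
  qed
  moreover have "continuous_on {0..1} h"
    unfolding h_def by (intro continuous_intros continuous_on_subset[OF H(1)]) auto
  moreover have "frac (H 0) \<in> {0..1}" by (simp add: frac_lt_1 less_imp_le)
  ultimately show ?thesis
    unfolding same_oriented_loop_def using mono h01 by (intro bexI[of _ "frac (H 0)"] exI[of _ h]) auto
qed

section \<open>Ambient isotopies of the 3-sphere\<close>

abbreviation is_homeo_S3 :: "(complex \<times> complex \<Rightarrow> complex \<times> complex) \<Rightarrow> bool" where
  "is_homeo_S3 g \<equiv> \<exists>k. homeomorphism S3 S3 g k"

lemma is_homeo_S3_compose: "is_homeo_S3 f \<Longrightarrow> is_homeo_S3 g \<Longrightarrow> is_homeo_S3 (g \<circ> f)"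
  using homeomorphism_compose by blast

lemma is_homeo_S3_cong:
  assumes "\<And>x. x \<in> S3 \<Longrightarrow> f x = g x"
  shows "is_homeo_S3 f \<longleftrightarrow> is_homeo_S3 g"
proof -
  have "is_homeo_S3 g" if f: "is_homeo_S3 f" and fg: "\<And>x. x \<in> S3 \<Longrightarrow> f x = g x"
    for f g :: "complex \<times> complex \<Rightarrow> complex \<times> complex"
  proof -
    obtain k where k: "homeomorphism S3 S3 f k" using f by blast
    have "homeomorphism S3 S3 g k"
      by (rule homeomorphism_cong[OF k]) (use fg in auto)
    then show ?thesis by blast
  qed
  from this[of f g] this[of g f] show ?thesis using assms by auto
qed

lemma homeo_S3_map:
  assumes "is_homeo_S3 f"
  shows "continuous_on S3 f" "f \<in> S3 \<rightarrow> S3"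
  using assms by (auto simp: homeomorphism_def)

lemma ambient_isotopy_map_imp_homeo: "ambient_isotopy_map f \<Longrightarrow> is_homeo_S3 f"
  unfolding ambient_isotopy_map_def by (drule homotopic_with_imp_property) simp

lemma is_homeo_S3_id: "is_homeo_S3 id"
  unfolding id_def by (rule exI[of _ "\<lambda>a. a"]) (rule homeomorphism_ident)

lemma ambient_isotopy_map_id: "ambient_isotopy_map id"
  unfolding ambient_isotopy_map_def homotopic_with_refl
  by (intro conjI is_homeo_S3_id) simp

lemma homotopic_homeos_compose_right:
  assumes "homotopic_with_canon is_homeo_S3 S3 S3 f g" and h: "is_homeo_S3 h"
  shows "homotopic_with_canon is_homeo_S3 S3 S3 (f \<circ> h) (g \<circ> h)"
proof (rule homotopic_with_compose_continuous_right)
  show "homotopic_with_canon (\<lambda>j. is_homeo_S3 (j \<circ> h)) S3 S3 f g"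
    using assms(1) by (rule homotopic_with_mono) (rule is_homeo_S3_compose[OF h])
qed (use homeo_S3_map[OF h] in auto)

lemma homotopic_homeos_compose_left:
  assumes "homotopic_with_canon is_homeo_S3 S3 S3 f g" and h: "is_homeo_S3 h"
  shows "homotopic_with_canon is_homeo_S3 S3 S3 (h \<circ> f) (h \<circ> g)"
proof (rule homotopic_with_compose_continuous_left)
  show "homotopic_with_canon (\<lambda>j. is_homeo_S3 (h \<circ> j)) S3 S3 f g"
    using assms(1) by (rule homotopic_with_mono) (rule is_homeo_S3_compose[OF _ h])
qed (use homeo_S3_map[OF h] in auto)

lemma ambient_isotopy_map_compose:
  assumes "ambient_isotopy_map f" "ambient_isotopy_map g"
  shows "ambient_isotopy_map (g \<circ> f)"
proof -
  note f = ambient_isotopy_map_imp_homeo[OF assms(1)]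
  have "homotopic_with_canon is_homeo_S3 S3 S3 (id \<circ> f) (g \<circ> f)"
    using assms(2) f unfolding ambient_isotopy_map_def by (rule homotopic_homeos_compose_right)
  then show ?thesis
    using assms(1) unfolding ambient_isotopy_map_def id_o by (rule homotopic_with_trans[rotated])
qed

text \<open>Composing the isotopy from \<open>id\<close> to \<open>f\<close> with \<open>g\<close>
  on the left gives one from \<open>g\<close> to the identity, to be traversed backwards.\<close>

lemma ambient_isotopy_map_inverse:
  assumes "ambient_isotopy_map f" "homeomorphism S3 S3 f g"
  shows "ambient_isotopy_map g"
proof -
  have g: "is_homeo_S3 g" using assms(2) homeomorphism_symD by blast
  have "homotopic_with_canon is_homeo_S3 S3 S3 (g \<circ> id) (g \<circ> f)"
    using assms(1) g unfolding ambient_isotopy_map_def by (rule homotopic_homeos_compose_left)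
  then have "homotopic_with_canon is_homeo_S3 S3 S3 g id"
  proof (rule homotopic_with_eq)
    show "id x = (g \<circ> f) x" if "x \<in> topspace (top_of_set S3)" for x
      using that homeomorphism_apply1[OF assms(2)] by simp
    show "is_homeo_S3 h \<longleftrightarrow> is_homeo_S3 k" if "\<And>x. x \<in> topspace (top_of_set S3) \<Longrightarrow> h x = k x" for h k
      using that by (intro is_homeo_S3_cong) simp
  qed simp
  then show ?thesis unfolding ambient_isotopy_map_def by (rule homotopic_with_symD)
qed

definition link_eq :: "(real \<Rightarrow> complex \<times> complex) set \<Rightarrow> (real \<Rightarrow> complex \<times> complex) set \<Rightarrow> bool" where
  "link_eq L M \<longleftrightarrow> (\<exists>f. ambient_isotopy_map f \<and>
      (\<forall>c\<in>L. \<exists>d\<in>M. loop_eq (f \<circ> c) d) \<and> (\<forall>d\<in>M. \<exists>c\<in>L. loop_eq (f \<circ> c) d))"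

lemma link_eqI:
  assumes "\<And>c. c \<in> L \<Longrightarrow> \<exists>d\<in>M. loop_eq c d" "\<And>d. d \<in> M \<Longrightarrow> \<exists>c\<in>L. loop_eq c d"
  shows "link_eq L M"
  unfolding link_eq_def using assms ambient_isotopy_map_id by (intro exI[of _ id]) auto

lemma link_eq_refl: "link_eq L L"
  by (rule link_eqI) (use loop_eq_refl in blast)+

lemma link_eq_trans [trans]:
  assumes "link_eq L M" "link_eq M N"
  shows "link_eq L N"
proof -
  obtain f where f: "ambient_isotopy_map f"
    "\<And>c. c \<in> L \<Longrightarrow> \<exists>d\<in>M. loop_eq (f \<circ> c) d" "\<And>d. d \<in> M \<Longrightarrow> \<exists>c\<in>L. loop_eq (f \<circ> c) d"
    using assms(1) unfolding link_eq_def by blast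
  obtain g where g: "ambient_isotopy_map g"
    "\<And>c. c \<in> M \<Longrightarrow> \<exists>d\<in>N. loop_eq (g \<circ> c) d" "\<And>d. d \<in> N \<Longrightarrow> \<exists>c\<in>M. loop_eq (g \<circ> c) d"
    using assms(2) unfolding link_eq_def by blast
  have comp: "loop_eq (g \<circ> f \<circ> c) e" if "loop_eq (f \<circ> c) d" "loop_eq (g \<circ> d) e" for c d e
    using loop_eq_trans[OF loop_eq_image[OF that(1), of g] that(2)] by (simp add: comp_assoc)
  show ?thesis
    unfolding link_eq_def
  proof (intro exI[of _ "g \<circ> f"] conjI ballI)
    show "ambient_isotopy_map (g \<circ> f)" by (rule ambient_isotopy_map_compose[OF f(1) g(1)])
    show "\<exists>e\<in>N. loop_eq (g \<circ> f \<circ> c) e" if "c \<in> L" for c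
      using f(2)[OF that] g(2) comp by blast
    show "\<exists>c\<in>L. loop_eq (g \<circ> f \<circ> c) e" if "e \<in> N" for e
      using g(3)[OF that] f(3) comp by blast
  qed
qed

text \<open>The curves must lie in \<open>S3\<close>, since \<open>g\<close> inverts
  \<open>f\<close> only there.\<close>

lemma link_eq_sym:
  assumes "link_eq L M" and L: "\<And>c t. c \<in> L \<Longrightarrow> c t \<in> S3"
  shows "link_eq M L"
proof -
  obtain f where f: "ambient_isotopy_map f"
    "\<And>c. c \<in> L \<Longrightarrow> \<exists>d\<in>M. loop_eq (f \<circ> c) d" "\<And>d. d \<in> M \<Longrightarrow> \<exists>c\<in>L. loop_eq (f \<circ> c) d"
    using assms(1) unfolding link_eq_def by blast
  obtain g where g: "homeomorphism S3 S3 f g"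
    using ambient_isotopy_map_imp_homeo[OF f(1)] by blast
  have inv: "loop_eq (g \<circ> d) c" if "c \<in> L" "loop_eq (f \<circ> c) d" for c d
  proof -
    have "g \<circ> (f \<circ> c) = c"
    proof
      fix t
      show "(g \<circ> (f \<circ> c)) t = c t" using homeomorphism_apply1[OF g L[OF that(1)]] by simp
    qed
    then show ?thesis using loop_eq_image[OF that(2), of g] loop_eq_sym by metis
  qed
  show ?thesis
    unfolding link_eq_def
  proof (intro exI[of _ g] conjI ballI)
    show "ambient_isotopy_map g" by (rule ambient_isotopy_map_inverse[OF f(1) g])
    show "\<exists>c\<in>L. loop_eq (g \<circ> d) c" if "d \<in> M" for d
      using f(3)[OF that] inv by blast
    show "\<exists>d\<in>M. loop_eq (g \<circ> d) c" if "c \<in> L" for c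
      using f(2)[OF that] inv[OF that] by blast
  qed
qed

lemma link_eq_imp_same_oriented_link:
  assumes "link_eq L M" "\<And>c. c \<in> L \<Longrightarrow> c 0 = c 1" "\<And>c. c \<in> M \<Longrightarrow> c 0 = c 1"
  shows "same_oriented_link L M"
proof -
  have loops: "same_oriented_loop (f \<circ> c) d" if "c \<in> L" "d \<in> M" "loop_eq (f \<circ> c) d" for c d f
    using that(3) assms(2)[OF that(1)] assms(3)[OF that(2)]
    by (intro loop_eq_imp_same_oriented_loop) simp_all
  obtain f where f: "ambient_isotopy_map f"
    "\<And>c. c \<in> L \<Longrightarrow> \<exists>d\<in>M. loop_eq (f \<circ> c) d" "\<And>d. d \<in> M \<Longrightarrow> \<exists>c\<in>L. loop_eq (f \<circ> c) d"
    using assms(1) unfolding link_eq_def by blast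
  show ?thesis
    unfolding same_oriented_link_def
  proof (intro exI[of _ f] conjI ballI f(1))
    show "\<exists>d\<in>M. same_oriented_loop (f \<circ> c) d" if "c \<in> L" for c
      using f(2)[OF that] loops[OF that] by blast
    show "\<exists>c\<in>L. same_oriented_loop (f \<circ> c) d" if "d \<in> M" for d
      using f(3)[OF that] loops[OF _ that] by blast
  qed
qed

text \<open>
  A displacement of the first coordinate, prescribed on \<open>\<complex> \<times> S\<^sup>1\<close> and extended to \<open>\<complex> \<times> \<complex>\<close> by
  homogeneity; boundedness makes the extension continuous across the axis.
\<close>

lemma exists_ambient_shear:
  fixes D :: "complex \<Rightarrow> complex \<Rightarrow> complex"
  assumes cont: "continuous_on (UNIV \<times> sphere 0 1) (\<lambda>(z, u). D z u)"
    and bound: "\<And>z u. norm u = 1 \<Longrightarrow> norm (D z u) \<le> B"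
    and c: "0 \<le> c" "c < 1"
    and lip: "\<And>z z' u. norm u = 1 \<Longrightarrow> norm (D z u - D z' u) \<le> c * norm (z - z')"
  obtains f where "ambient_isotopy_map f"
    "\<And>z u. norm u = 1 \<Longrightarrow> f (sgn (z, u)) = sgn (z + D z u, u)"
proof -
  define K where "K p = norm (snd p) *\<^sub>R D (fst p /\<^sub>R norm (snd p)) (sgn (snd p))" for p :: "complex \<times> complex"
  define G where "G t p = (fst p + t *\<^sub>R K p, snd p)" for t :: real and p
  have K0: "K (z, 0) = 0" for z by (simp add: K_def)
  have Klip: "norm (K (z, v) - K (z', v)) \<le> c * norm (z - z')" for z z' v
  proof (cases "v = 0")
    case False
    have "norm (K (z, v) - K (z', v)) =
        norm v * norm (D (z /\<^sub>R norm v) (sgn v) - D (z' /\<^sub>R norm v) (sgn v))"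
      by (simp add: K_def scaleR_diff_right[symmetric])
    also have "\<dots> \<le> norm v * (c * norm (z /\<^sub>R norm v - z' /\<^sub>R norm v))"
      using False by (intro mult_left_mono lip) (simp_all add: norm_sgn)
    also have "\<dots> = c * norm (z - z')"
      using False by (simp add: scaleR_diff_right[symmetric])
    finally show ?thesis .
  qed (use c in \<open>simp add: K0\<close>)
  have Kbound: "norm (K p) \<le> \<bar>B\<bar> * norm (snd p)" for p
  proof (cases "snd p = 0")
    case False
    then have "norm (D (fst p /\<^sub>R norm (snd p)) (sgn (snd p))) \<le> \<bar>B\<bar>"
      using bound[of "sgn (snd p)"] by (meson abs_ge_self norm_sgn order_trans)
    then show ?thesis by (simp add: K_def mult.commute[of "\<bar>B\<bar>"] mult_left_mono)
  qed (simp add: K_def)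
  have Kcont: "continuous_on UNIV K"
  proof -
    have "isCont K p" for p
    proof (cases "snd p = 0")
      case True
      have "(K \<longlongrightarrow> 0) (at p)"
      proof (rule Lim_null_comparison)
        show "\<forall>\<^sub>F q in at p. norm (K q) \<le> \<bar>B\<bar> * norm (snd q)" using Kbound by simp
        have "((\<lambda>q. \<bar>B\<bar> * norm (snd q)) \<longlongrightarrow> \<bar>B\<bar> * norm (snd p)) (at p)"
          by (intro tendsto_intros)
        then show "((\<lambda>q. \<bar>B\<bar> * norm (snd q)) \<longlongrightarrow> 0) (at p)" using True by simp
      qed
      moreover have "K p = 0" using True by (simp add: K_def)
      ultimately show ?thesis by (simp add: continuous_at)
    next
      case False
      have "continuous_on {q. snd q \<noteq> 0}
          (\<lambda>q. (\<lambda>(z, u). D z u) (fst q /\<^sub>R norm (snd q), sgn (snd q)))"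
        by (rule continuous_on_compose2[OF cont])
           (auto intro!: continuous_intros simp: norm_sgn)
      then have "continuous_on {q. snd q \<noteq> 0} K"
        unfolding K_def by (auto intro!: continuous_intros)
      moreover have "open {q :: complex \<times> complex. snd q \<noteq> 0}"
        by (intro open_Collect_neq continuous_intros)
      ultimately show ?thesis using False continuous_on_eq_continuous_at by blast
    qed
    then show ?thesis by (simp add: continuous_at_imp_continuous_on)
  qed
  \<comment> \<open>\<open>G t\<close> commutes with positive scaling and so maps rays to rays; its
    bijectivity on the whole space therefore passes to the radial projection onto
    \<open>S3\<close>.\<close>
  have G_scale: "G t (r *\<^sub>R p) = r *\<^sub>R G t p" if "r > 0" for t r p
  proof -
    have e: "inverse r * inverse x * r = inverse x" for x using that by simp
    show ?thesis
      using that by (cases p) (simp add: G_def K_def sgn_scaleR scaleR_add_right mult.left_commute e)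
  qed
  have G_nz: "G t p \<noteq> 0" if "p \<noteq> 0" for t p
    using that by (cases p) (auto simp: G_def K0 zero_prod_def)
  have sgn_G: "sgn (G t (sgn p)) = sgn (G t p)" if "p \<noteq> 0" for t p
  proof -
    have "sgn (G t (sgn p)) = sgn (inverse (norm p) *\<^sub>R G t p)"
      using that by (simp add: sgn_div_norm[of p] G_scale)
    then show ?thesis using that by (simp add: sgn_scaleR)
  qed
  have G_inj: "p = q" if "G t p = G t q" "t \<in> {0..1}" for t p q
  proof -
    obtain z v z' v' where pq: "p = (z, v)" "q = (z', v')" by (cases p, cases q)
    have v: "v' = v" and "z - z' = t *\<^sub>R (K (z', v) - K (z, v))"
      using that(1) by (auto simp: G_def pq scaleR_diff_right algebra_simps)
    then have "norm (z - z') = t * norm (K (z', v) - K (z, v))" using that(2) by simp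
    also have "\<dots> \<le> 1 * norm (K (z', v) - K (z, v))"
      using that(2) by (intro mult_right_mono) auto
    also have "\<dots> \<le> c * norm (z - z')" using Klip[of z' v z] by (simp add: norm_minus_commute)
    finally have "(1 - c) * norm (z - z') \<le> 0" by (simp add: algebra_simps)
    then have "z = z'" using c by (simp add: mult_le_0_iff)
    then show ?thesis using v pq by simp
  qed
  \<comment> \<open>A preimage of \<open>(w, v)\<close> is a fixed point of the contraction that
    sends \<open>z\<close> to \<open>w - t *\<^sub>R K (z, v)\<close>.\<close>
  have G_surj: "\<exists>p. G t p = q" if "t \<in> {0..1}" for t q
  proof -
    obtain w v where q: "q = (w, v)" by (cases q)
    have "\<exists>!z. w - t *\<^sub>R K (z, v) = z"
    proof (rule banach_fix_type[OF c], intro allI)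
      fix x y
      have "dist (w - t *\<^sub>R K (x, v)) (w - t *\<^sub>R K (y, v)) = t * norm (K (y, v) - K (x, v))"
        using that by (simp add: dist_norm scaleR_diff_right[symmetric])
      also have "\<dots> \<le> 1 * norm (K (y, v) - K (x, v))"
        using that by (intro mult_right_mono) auto
      also have "\<dots> \<le> c * dist x y" using Klip[of y v x] by (simp add: dist_norm norm_minus_commute)
      finally show "dist (w - t *\<^sub>R K (x, v)) (w - t *\<^sub>R K (y, v)) \<le> c * dist x y" .
    qed
    then obtain z where "w - t *\<^sub>R K (z, v) = z" by blast
    then have "z + t *\<^sub>R K (z, v) = w" by (metis diff_add_cancel)
    then have "G t (z, v) = q" by (simp add: G_def q)
    then show ?thesis ..
  qed
  define h where "h p = sgn (G (fst p) (snd p))" for p :: "real \<times> complex \<times> complex"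
  have S3_nz: "p \<noteq> 0" if "p \<in> S3" for p :: "complex \<times> complex" using that by auto
  have S3_sgn: "sgn p = p" if "p \<in> S3" for p :: "complex \<times> complex" using that by (simp add: sgn_div_norm)
  have sgn_S3: "sgn p \<in> S3" if "p \<noteq> 0" for p :: "complex \<times> complex" using that by (simp add: norm_sgn)
  have hcont: "continuous_on ({0..1} \<times> S3) h"
    unfolding h_def
  proof (rule continuous_on_sgn)
    have "continuous_on ({0..1} \<times> S3) (\<lambda>p::real \<times> complex \<times> complex. K (snd p))"
      by (rule continuous_on_compose2[OF Kcont]) (auto intro: continuous_intros)
    then show "continuous_on ({0..1} \<times> S3) (\<lambda>p. G (fst p) (snd p))"
      unfolding G_def by (intro continuous_intros)
    show "\<forall>x\<in>{0..1} \<times> S3. G (fst x) (snd x) \<noteq> 0" using G_nz S3_nz by auto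
  qed
  have h_S3: "h (t, p) \<in> S3" if "p \<in> S3" for t p
    unfolding h_def fst_conv snd_conv by (intro sgn_S3 G_nz S3_nz that)
  have homeo: "is_homeo_S3 (\<lambda>p. h (t, p))" if t: "t \<in> {0..1}" for t
  proof (rule homeomorphism_compact)
    show "continuous_on S3 (\<lambda>p. h (t, p))"
      by (rule continuous_on_compose2[OF hcont]) (use t in \<open>auto intro: continuous_intros\<close>)
    show "(\<lambda>p. h (t, p)) ` S3 = S3"
    proof
      show "(\<lambda>p. h (t, p)) ` S3 \<subseteq> S3" using h_S3 by blast
      show "S3 \<subseteq> (\<lambda>p. h (t, p)) ` S3"
      proof
        fix q :: "complex \<times> complex" assume q: "q \<in> S3"
        obtain p where p: "G t p = q" using G_surj[OF t] by blast
        have "p \<noteq> 0"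
        proof
          assume "p = 0"
          then have "q = 0" using p by (simp add: G_def K_def zero_prod_def)
          then show False using q by simp
        qed
        then have "h (t, sgn p) = q" "sgn p \<in> S3"
          using sgn_G[of p t] p S3_sgn[OF q] sgn_S3 by (simp_all add: h_def)
        then show "q \<in> (\<lambda>p. h (t, p)) ` S3" by force
      qed
    qed
    show "inj_on (\<lambda>p. h (t, p)) S3"
    proof
      fix p q assume pq: "p \<in> S3" "q \<in> S3" "h (t, p) = h (t, q)"
      define r where "r = norm (G t p) / norm (G t q)"
      have r: "r > 0" using G_nz S3_nz pq by (simp add: r_def)
      have "G t p = norm (G t p) *\<^sub>R sgn (G t p)"
        using G_nz[OF S3_nz[OF pq(1)]] by (simp add: sgn_div_norm)
      also have "\<dots> = norm (G t p) *\<^sub>R sgn (G t q)" using pq(3) by (simp add: h_def)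
      also have "\<dots> = G t (r *\<^sub>R q)"
        using G_scale[OF r] by (simp add: r_def sgn_div_norm divide_inverse)
      finally have "p = r *\<^sub>R q" using G_inj t by blast
      then show "p = q" using pq r by simp
    qed
  qed simp
  define f where "f p = h (1, p)" for p
  have "ambient_isotopy_map f"
    unfolding ambient_isotopy_map_def
  proof (subst homotopic_with)
    show "is_homeo_S3 h \<longleftrightarrow> is_homeo_S3 k" if "\<And>x. x \<in> topspace (top_of_set S3) \<Longrightarrow> h x = k x" for h k
      using that by (intro is_homeo_S3_cong) simp
    have "h \<in> {0..1} \<times> S3 \<rightarrow> S3" using h_S3 by blast
    then have "continuous_map (prod_topology (top_of_set {0..1}) (top_of_set S3)) (top_of_set S3) h"
      using hcont by (simp add: prod_topology_subtopology_eu continuous_map_in_subtopology image_subset_iff_funcset)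
    moreover have "h (0, x) = x" if "x \<in> S3" for x
      using S3_sgn[OF that] by (simp add: h_def G_def)
    ultimately have "continuous_map (prod_topology (top_of_set {0..1}) (top_of_set S3)) (top_of_set S3) h \<and>
        (\<forall>x\<in>topspace (top_of_set S3). h (0, x) = id x) \<and>
        (\<forall>x\<in>topspace (top_of_set S3). h (1, x) = f x) \<and> (\<forall>t\<in>{0..1}. is_homeo_S3 (\<lambda>x. h (t, x)))"
      using homeo by (simp add: f_def)
    then show "\<exists>h. continuous_map (prod_topology (top_of_set {0..1::real}) (top_of_set S3)) (top_of_set S3) h \<and>
        (\<forall>x\<in>topspace (top_of_set S3). h (0, x) = id x) \<and>
        (\<forall>x\<in>topspace (top_of_set S3). h (1, x) = f x) \<and> (\<forall>t\<in>{0..1}. is_homeo_S3 (\<lambda>x. h (t, x)))"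
      by (rule exI[of _ h])
  qed
  moreover have "f (sgn (z, u)) = sgn (z + D z u, u)" if "norm u = 1" for z u
  proof -
    have "(z, u) \<noteq> 0" using that by (auto simp: zero_prod_def)
    then have "f (sgn (z, u)) = sgn (G 1 (z, u))" by (simp add: f_def h_def sgn_G)
    then show ?thesis using that by (simp add: G_def K_def sgn_div_norm)
  qed
  ultimately show thesis using that by blast
qed

text \<open>Conjugating an isotopy that starts at the identity by the swap of coordinates gives
  again such an isotopy, so the swap itself need not be isotopic to the identity. The factors
  \<open>norm z\<close> come from normalizing the coordinate that now plays the part of the
  angle.\<close>

lemma exists_ambient_shear_swapped:
  fixes D :: "complex \<Rightarrow> complex \<Rightarrow> complex"
  assumes cont: "continuous_on (UNIV \<times> sphere 0 1) (\<lambda>(z, u). D z u)"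
    and bound: "\<And>z u. norm u = 1 \<Longrightarrow> norm (D z u) \<le> B"
    and c: "0 \<le> c" "c < 1"
    and lip: "\<And>z z' u. norm u = 1 \<Longrightarrow> norm (D z u - D z' u) \<le> c * norm (z - z')"
  obtains f where "ambient_isotopy_map f"
    "\<And>z u. z \<noteq> 0 \<Longrightarrow> f (sgn (z, u)) = sgn (z, u + norm z *\<^sub>R D (u /\<^sub>R norm z) (sgn z))"
proof -
  obtain f where f: "ambient_isotopy_map f"
    "\<And>z u. norm u = 1 \<Longrightarrow> f (sgn (z, u)) = sgn (z + D z u, u)"
    using exists_ambient_shear[OF assms] by blast
  have norm_swap: "norm (prod.swap p) = norm p" for p :: "complex \<times> complex"
    by (cases p) (simp add: norm_Pair add.commute)
  have swap_homeo: "homeomorphism S3 S3 prod.swap prod.swap"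
    using norm_swap by (intro homeomorphismI continuous_on_swap) auto
  have sgn_swap: "sgn (prod.swap p) = prod.swap (sgn p)" for p :: "complex \<times> complex"
    using norm_swap[of p] by (cases p) (simp add: sgn_div_norm)
  define g where "g = prod.swap \<circ> (f \<circ> prod.swap)"
  have hs: "is_homeo_S3 prod.swap" using swap_homeo by blast
  have "homotopic_with_canon is_homeo_S3 S3 S3 (id \<circ> prod.swap) (f \<circ> prod.swap)"
    using f(1) hs unfolding ambient_isotopy_map_def by (rule homotopic_homeos_compose_right)
  then have "homotopic_with_canon is_homeo_S3 S3 S3 (prod.swap \<circ> (id \<circ> prod.swap)) (prod.swap \<circ> (f \<circ> prod.swap))"
    using hs by (rule homotopic_homeos_compose_left)
  moreover have "prod.swap \<circ> (id \<circ> prod.swap) = (id :: complex \<times> complex \<Rightarrow> _)" by auto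
  ultimately have "ambient_isotopy_map g" unfolding ambient_isotopy_map_def g_def by simp
  moreover have "g (sgn (z, u)) = sgn (z, u + norm z *\<^sub>R D (u /\<^sub>R norm z) (sgn z))" if "z \<noteq> 0" for z u
  proof -
    define r where "r = inverse (norm z)"
    have r: "r > 0" using that by (simp add: r_def)
    have scale: "sgn (r *\<^sub>R p) = sgn p" for p :: "complex \<times> complex"
      using r by (simp add: sgn_scaleR)
    have "prod.swap (sgn (z, u)) = sgn (u, z)" using sgn_swap[of "(z, u)"] by simp
    also have "\<dots> = sgn (r *\<^sub>R u, sgn z)"
      using scale[of "(u, z)"] by (simp add: r_def sgn_div_norm[of z])
    finally have "g (sgn (z, u)) = prod.swap (sgn (r *\<^sub>R u + D (r *\<^sub>R u) (sgn z), sgn z))"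
      using f(2)[of "sgn z"] that by (simp add: g_def norm_sgn)
    also have "\<dots> = sgn (sgn z, r *\<^sub>R u + D (r *\<^sub>R u) (sgn z))"
      using sgn_swap[of "(r *\<^sub>R u + D (r *\<^sub>R u) (sgn z), sgn z)"] by simp
    also have "(sgn z, r *\<^sub>R u + D (r *\<^sub>R u) (sgn z)) = r *\<^sub>R (z, u + norm z *\<^sub>R D (u /\<^sub>R norm z) (sgn z))"
      using that by (simp add: r_def sgn_div_norm[of z] scaleR_add_right)
    finally show ?thesis by (simp only: scale)
  qed
  ultimately show thesis using that by blast
qed

section \<open>Deformations of closed geometric braids\<close>

definition config :: "nat \<Rightarrow> (nat \<Rightarrow> complex) set" where
  "config n = {x. inj_on x {1..n}}"

definition orbit_period :: "(nat \<Rightarrow> nat) \<Rightarrow> nat \<Rightarrow> nat" where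
  "orbit_period \<pi> j = (LEAST m. 0 < m \<and> (\<pi> ^^ m) j = j)"

text \<open>This is \<open>closure_component\<close> for an arbitrary path of configurations that
  closes up under \<pi>; the intermediate stages of an isotopy are not given by words.\<close>

definition curve_component :: "(nat \<Rightarrow> nat) \<Rightarrow> (real \<Rightarrow> nat \<Rightarrow> complex) \<Rightarrow> nat \<Rightarrow> real \<Rightarrow> complex \<times> complex" where
  "curve_component \<pi> p j s =
     (let x = real (orbit_period \<pi> j) * s
      in sgn (p (frac x) ((\<pi> ^^ nat \<lfloor>x\<rfloor>) j), cis (2 * pi * frac x)))"

definition curve_link :: "nat \<Rightarrow> (nat \<Rightarrow> nat) \<Rightarrow> (real \<Rightarrow> nat \<Rightarrow> complex) \<Rightarrow> (real \<Rightarrow> complex \<times> complex) set" where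
  "curve_link n \<pi> p = curve_component \<pi> p ` {1..n}"

definition braid_path :: "nat list \<Rightarrow> real \<Rightarrow> nat \<Rightarrow> complex" where
  "braid_path w s j = braid_strand w j s"

lemma braid_closure_eq_curve_link: "braid_closure n w = curve_link n (braid_perm w) (braid_path w)"
proof -
  have "closure_component w j = curve_component (braid_perm w) (braid_path w) j" for j
    by (intro ext) (simp add: closure_component_def curve_component_def closure_arc_def
        braid_path_def orbit_length_def orbit_period_def Let_def)
  then show ?thesis by (simp add: braid_closure_def curve_link_def)
qed

lemma curve_component_in_S3: "curve_component \<pi> p j s \<in> S3"
proof -
  have "(z, cis a) \<noteq> 0" for z a by (metis cis_neq_zero prod.inject zero_prod_def)
  then show ?thesis by (simp add: curve_component_def Let_def norm_sgn)
qed

lemma permutes_funpow_in: "\<pi> permutes S \<Longrightarrow> j \<in> S \<Longrightarrow> (\<pi> ^^ m) j \<in> S"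
  by (induction m) (auto simp: permutes_in_image)

lemma orbit_period:
  assumes "\<pi> permutes {1..n}"
  shows "0 < orbit_period \<pi> j" "(\<pi> ^^ orbit_period \<pi> j) j = j"
proof -
  have "\<exists>m. 0 < m \<and> (\<pi> ^^ m) j = j"
  proof -
    have "permutation \<pi>" using assms by (auto simp: permutation_permutes)
    then show ?thesis by (rule permutation_self[of \<pi> j]) blast
  qed
  then show "0 < orbit_period \<pi> j" "(\<pi> ^^ orbit_period \<pi> j) j = j"
    unfolding orbit_period_def by (metis (mono_tags, lifting) LeastI_ex)+
qed

lemma curve_component_closed:
  assumes "\<pi> permutes {1..n}"
  shows "curve_component \<pi> p j 0 = curve_component \<pi> p j 1"
  using orbit_period[OF assms, of j] by (simp add: curve_component_def Let_def frac_def)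

text \<open>\<open>Arg2pi\<close> jumps at 1. On the closed upper and lower half circles the
  argument can be replaced by \<open>arccos (Re u)\<close> and its complement to a full turn, which
  are continuous; the two pieces agree at the jump because \<open>g z 0 = g z 1\<close>.\<close>

lemma continuous_on_circle_lift:
  fixes g :: "'a::t2_space \<Rightarrow> real \<Rightarrow> 'b::topological_space"
  assumes cont: "continuous_on (UNIV \<times> {0..1}) (\<lambda>(z, s). g z s)" and g01: "\<And>z. g z 0 = g z 1"
  shows "continuous_on (UNIV \<times> sphere 0 1) (\<lambda>(z, u). g z (Arg2pi u / (2 * pi)))"
proof -
  define A where "A = (UNIV :: 'a set) \<times> (sphere 0 1 \<inter> {u. 0 \<le> Im u})"
  define B where "B = (UNIV :: 'a set) \<times> (sphere 0 1 \<inter> {u. Im u \<le> 0})"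
  have Re_bd: "- 1 \<le> Re u" "Re u \<le> 1" if "u \<in> sphere 0 1" for u :: complex
    using abs_Re_le_cmod[of u] that by auto
  have u: "Re u = cos (Arg2pi u)" "Im u = sin (Arg2pi u)" if "u \<in> sphere 0 1" for u :: complex
    using Arg2pi_eq[of u] that by (simp_all add: exp_Euler[symmetric] Re_exp Im_exp) (metis Re_exp Im_exp cis.sel cis_conv_exp mult_1 of_real_1)+
  have closed: "closed A" "closed B"
    unfolding A_def B_def
    by (intro closed_Times closed_Int closed_UNIV closed_sphere closed_Collect_le continuous_intros)+
  have "continuous_on A (\<lambda>x. (\<lambda>(z, s). g z s) (fst x, arccos (Re (snd x)) / (2 * pi)))"
    by (rule continuous_on_compose2[OF cont])
       (auto intro!: continuous_intros simp: A_def Re_bd arccos_lbound arccos_ubound order_trans[OF arccos_ubound])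
  moreover have "g z (Arg2pi u / (2 * pi)) = g z (arccos (Re u) / (2 * pi))" if "(z, u) \<in> A" for z u
  proof -
    have "Arg2pi u \<le> pi"
    proof (rule ccontr)
      assume "\<not> Arg2pi u \<le> pi"
      then have "sin (Arg2pi u) < 0" using sin_lt_zero Arg2pi[of u] by auto
      then show False using that u[of u] by (auto simp: A_def)
    qed
    then have "arccos (Re u) = Arg2pi u"
      using that u[of u] Arg2pi[of u] by (auto simp: A_def arccos_cos)
    then show ?thesis by simp
  qed
  ultimately have contA: "continuous_on A (\<lambda>(z, u). g z (Arg2pi u / (2 * pi)))"
    by (subst continuous_on_cong[OF refl]) (auto simp: case_prod_unfold)
  have "continuous_on B (\<lambda>x. (\<lambda>(z, s). g z s) (fst x, 1 - arccos (Re (snd x)) / (2 * pi)))"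
    by (rule continuous_on_compose2[OF cont])
       (auto intro!: continuous_intros simp: B_def Re_bd arccos_lbound arccos_ubound order_trans[OF arccos_ubound])
  moreover have "g z (Arg2pi u / (2 * pi)) = g z (1 - arccos (Re u) / (2 * pi))" if "(z, u) \<in> B" for z u
  proof (cases "Arg2pi u = 0")
    case True
    then have "Re u = 1" using that u[of u] by (auto simp: B_def)
    then show ?thesis using True g01 by simp
  next
    case False
    have "pi \<le> Arg2pi u"
    proof (rule ccontr)
      assume "\<not> pi \<le> Arg2pi u"
      then have "sin (Arg2pi u) > 0" using False Arg2pi[of u] by (intro sin_gt_zero) auto
      then show False using that u[of u] by (auto simp: B_def)
    qed
    moreover have "cos (Arg2pi u) = cos (2 * pi - Arg2pi u)" by simp
    ultimately have "arccos (Re u) = 2 * pi - Arg2pi u"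
      using that u[of u] Arg2pi[of u] arccos_cos[of "2 * pi - Arg2pi u"] by (auto simp: B_def)
    then have "Arg2pi u / (2 * pi) = 1 - arccos (Re u) / (2 * pi)" by (simp add: field_simps)
    then show ?thesis by simp
  qed
  ultimately have contB: "continuous_on B (\<lambda>(z, u). g z (Arg2pi u / (2 * pi)))"
    by (subst continuous_on_cong[OF refl]) (auto simp: case_prod_unfold)
  have "UNIV \<times> sphere 0 1 = A \<union> B" by (auto simp: A_def B_def)
  then show ?thesis using continuous_on_closed_Un[OF closed contA contB] by simp
qed

lemma Arg2pi_cis: "0 \<le> s \<Longrightarrow> s < 1 \<Longrightarrow> Arg2pi (cis (2 * pi * s)) = 2 * pi * s"
  by (rule Arg2pi_unique[of 1]) (auto simp: cis_conv_exp mult.commute)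

lemma bump_lipschitz:
  fixes z z' x :: "'a::real_normed_vector"
  assumes "0 < r"
  shows "\<bar>max 0 (1 - norm (z - x) / r) - max 0 (1 - norm (z' - x) / r)\<bar> \<le> norm (z - z') / r"
proof -
  have "\<bar>norm (z - x) / r - norm (z' - x) / r\<bar> \<le> norm (z - z') / r"
    using norm_triangle_ineq3[of "z - x" "z' - x"] assms
    by (simp add: diff_divide_distrib[symmetric] divide_right_mono)
  then show ?thesis by linarith
qed

text \<open>Each strand carries a cone-shaped bump of height 1 and radius \<open>r\<close>,
  multiplied by the displacement from \<open>p\<close> to \<open>q\<close>. At a strand all other
  bumps vanish by separation, so it moves exactly as prescribed. The bumps have slope
  \<open>1 / r\<close> and the displacements sum to at most \<open>r / 2\<close>, which gives the
  Lipschitz constant 1/2.\<close>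

lemma link_eq_close:
  assumes \<pi>: "\<pi> permutes {1..n}"
    and p: "continuous_on {0..1} p" "p 1 = p 0 \<circ> \<pi>"
    and q: "continuous_on {0..1} q" "q 1 = q 0 \<circ> \<pi>"
    and r: "0 < r"
    and sep: "\<And>s i j. \<lbrakk>s \<in> {0..1}; i \<in> {1..n}; j \<in> {1..n}; i \<noteq> j\<rbrakk> \<Longrightarrow> r \<le> norm (p s i - p s j)"
    and near: "\<And>s j. \<lbrakk>s \<in> {0..1}; j \<in> {1..n}\<rbrakk> \<Longrightarrow> 2 * real n * norm (q s j - p s j) \<le> r"
  shows "link_eq (curve_link n \<pi> p) (curve_link n \<pi> q)"
proof -
  define b where "b z s j = max 0 (1 - norm (z - p s j) / r)" for z s j
  define g where "g z s = (\<Sum>j\<in>{1..n}. b z s j *\<^sub>R (q s j - p s j))" for z s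
  define D where "D z u = g z (Arg2pi u / (2 * pi))" for z u
  have contp: "continuous_on (UNIV \<times> {0..1}) (\<lambda>x. p (snd x) j)"
    and contq: "continuous_on (UNIV \<times> {0..1}) (\<lambda>x. q (snd x) j)" for j
    by (rule continuous_on_compose2[OF continuous_on_product_then_coordinatewise[OF p(1)]]
        continuous_on_compose2[OF continuous_on_product_then_coordinatewise[OF q(1)]];
        auto intro: continuous_intros)+
  have gcont: "continuous_on (UNIV \<times> {0..1}) (\<lambda>(z, s). g z s)"
    unfolding g_def b_def case_prod_unfold
    by (intro continuous_intros contp contq) (use r in auto)
  \<comment> \<open>The two ends of the braid differ by the permutation, which only reorders the
    sum.\<close>
  have "g z 0 = g z 1" for z
    unfolding g_def b_def p(2) q(2)
    by (subst sum.permute[OF \<pi>]) (simp add: comp_def)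
  then have Dcont: "continuous_on (UNIV \<times> sphere 0 1) (\<lambda>(z, u). D z u)"
    unfolding D_def using continuous_on_circle_lift[OF gcont] by simp
  have arg: "Arg2pi u / (2 * pi) \<in> {0..1}" for u
    using Arg2pi[of u] by (simp add: less_imp_le)
  have sum_near: "(\<Sum>j\<in>{1..n}. norm (q s j - p s j)) \<le> r / 2" if "s \<in> {0..1}" for s
  proof (cases "n = 0")
    case False
    have "(\<Sum>j\<in>{1..n}. norm (q s j - p s j)) \<le> (\<Sum>j\<in>{1..n}. r / (2 * real n))"
      using near[OF that] False by (intro sum_mono) (simp add: field_simps)
    then show ?thesis using False by simp
  qed (use r in simp)
  have bound: "norm (D z u) \<le> r / 2" for z u
  proof -
    define s where "s = Arg2pi u / (2 * pi)"
    have s: "s \<in> {0..1}" using arg s_def by simp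
    have "norm (D z u) \<le> (\<Sum>j\<in>{1..n}. norm (b z s j *\<^sub>R (q s j - p s j)))"
      unfolding D_def g_def s_def by (rule norm_sum)
    also have "\<dots> \<le> (\<Sum>j\<in>{1..n}. norm (q s j - p s j))"
    proof (rule sum_mono)
      fix j
      have "\<bar>b z s j\<bar> \<le> 1" using r by (auto simp: b_def)
      then show "norm (b z s j *\<^sub>R (q s j - p s j)) \<le> norm (q s j - p s j)"
        by (simp add: mult_left_le_one_le)
    qed
    finally show ?thesis using sum_near[OF s] by linarith
  qed
  have lip: "norm (D z u - D z' u) \<le> 1 / 2 * norm (z - z')" for z z' u
  proof -
    define s where "s = Arg2pi u / (2 * pi)"
    have s: "s \<in> {0..1}" using arg s_def by simp
    have "D z u - D z' u = (\<Sum>j\<in>{1..n}. (b z s j - b z' s j) *\<^sub>R (q s j - p s j))"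
      unfolding D_def g_def s_def by (simp add: sum_subtractf[symmetric] scaleR_diff_left)
    then have "norm (D z u - D z' u) \<le> (\<Sum>j\<in>{1..n}. \<bar>b z s j - b z' s j\<bar> * norm (q s j - p s j))"
      using norm_sum[of "\<lambda>j. (b z s j - b z' s j) *\<^sub>R (q s j - p s j)"] by simp
    also have "\<dots> \<le> (\<Sum>j\<in>{1..n}. norm (z - z') / r * norm (q s j - p s j))"
      unfolding b_def by (intro sum_mono mult_right_mono bump_lipschitz r) simp
    also have "\<dots> = norm (z - z') / r * (\<Sum>j\<in>{1..n}. norm (q s j - p s j))"
      by (rule sum_distrib_left[symmetric])
    also have "\<dots> \<le> norm (z - z') / r * (r / 2)"
      using r by (intro mult_left_mono sum_near[OF s]) simp
    finally show ?thesis using r by simp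
  qed
  obtain f where f: "ambient_isotopy_map f"
    "\<And>z u. norm u = 1 \<Longrightarrow> f (sgn (z, u)) = sgn (z + D z u, u)"
    using exists_ambient_shear[OF Dcont bound _ _ lip] by auto
  have move: "f (sgn (p s i, cis (2 * pi * s))) = sgn (q s i, cis (2 * pi * s))"
    if s: "0 \<le> s" "s < 1" and i: "i \<in> {1..n}" for s i
  proof -
    have "b (p s i) s j *\<^sub>R (q s j - p s j) = (if j = i then q s i - p s i else 0)"
      if "j \<in> {1..n}" for j
    proof (cases "j = i")
      case False
      then have "r \<le> norm (p s i - p s j)" using sep[of s i j] s i that by auto
      then show ?thesis using r False by (simp add: b_def max_def field_simps)
    qed (simp add: b_def)
    then have "g (p s i) s = q s i - p s i" unfolding g_def using i by simp
    then have "D (p s i) (cis (2 * pi * s)) = q s i - p s i"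
      using s by (simp add: D_def Arg2pi_cis)
    then show ?thesis using f(2)[of "cis (2 * pi * s)" "p s i"] by simp
  qed
  have comp: "f \<circ> curve_component \<pi> p j = curve_component \<pi> q j" if "j \<in> {1..n}" for j
    using move permutes_funpow_in[OF \<pi> that]
    by (intro ext) (simp add: curve_component_def Let_def frac_lt_1)
  show ?thesis
    unfolding link_eq_def curve_link_def
  proof (intro exI[of _ f] conjI ballI f(1); elim imageE)
    fix c j assume "c = curve_component \<pi> p j" "j \<in> {1..n}"
    then show "\<exists>d\<in>curve_component \<pi> q ` {1..n}. loop_eq (f \<circ> c) d"
      using comp by (intro bexI[of _ "curve_component \<pi> q j"]) simp_all
  next
    fix d j assume "d = curve_component \<pi> q j" "j \<in> {1..n}"
    then show "\<exists>c\<in>curve_component \<pi> p ` {1..n}. loop_eq (f \<circ> c) d"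
      using comp by (intro bexI[of _ "curve_component \<pi> p j"]) simp_all
  qed
qed

text \<open>Compactness gives a common separation \<open>r\<close> for all stages, and uniform
  continuity gives a subdivision of the homotopy whose consecutive stages are close enough for
  \<open>link_eq_close\<close>.\<close>

lemma link_eq_homotopy:
  assumes \<pi>: "\<pi> permutes {1..n}"
    and h: "continuous_on ({0..1} \<times> {0..1}) h" "h \<in> {0..1} \<times> {0..1} \<rightarrow> config n"
    and closed: "\<And>\<tau>. \<tau> \<in> {0..1::real} \<Longrightarrow> h (\<tau>, 1::real) = h (\<tau>, 0) \<circ> \<pi>"
  shows "link_eq (curve_link n \<pi> (\<lambda>s. h (0, s))) (curve_link n \<pi> (\<lambda>s. h (1, s)))"
proof (cases "n = 0")
  case True
  then show ?thesis by (simp add: curve_link_def link_eq_refl)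
next
  case False
  define K :: "(real \<times> real) set" where "K = {0..1} \<times> {0..1}"
  have K: "compact K" "K \<noteq> {}" by (auto simp: K_def compact_Times)
  have hj: "continuous_on K (\<lambda>x. h x j)" for j
    unfolding K_def by (rule continuous_on_product_then_coordinatewise[OF h(1)])
  define P where "P = {(i, j). i \<in> {1..n} \<and> j \<in> {1..n} \<and> i \<noteq> j}"
  have finP: "finite P" by (rule finite_subset[of _ "{1..n} \<times> {1..n}"]) (auto simp: P_def)
  have "\<exists>r>0. \<forall>x\<in>K. r \<le> norm (h x (fst ij) - h x (snd ij))" if "ij \<in> P" for ij
  proof -
    have "continuous_on K (\<lambda>x. norm (h x (fst ij) - h x (snd ij)))" by (intro continuous_intros hj)
    then obtain x0 where x0: "x0 \<in> K" "\<And>x. x \<in> K \<Longrightarrow> norm (h x0 (fst ij) - h x0 (snd ij)) \<le> norm (h x (fst ij) - h x (snd ij))"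
      using continuous_attains_inf[OF K] by blast
    have "h x0 \<in> config n" using h(2) x0(1) unfolding K_def by blast
    then have inj: "inj_on (h x0) {1..n}" by (simp add: config_def)
    have "fst ij \<in> {1..n}" "snd ij \<in> {1..n}" "fst ij \<noteq> snd ij" using that by (auto simp: P_def)
    then have "h x0 (fst ij) \<noteq> h x0 (snd ij)" using inj_onD[OF inj] by blast
    then show ?thesis using x0(2) by (intro exI[of _ "norm (h x0 (fst ij) - h x0 (snd ij))"]) simp
  qed
  then obtain R where R: "\<And>ij. ij \<in> P \<Longrightarrow> 0 < R ij" "\<And>ij x. ij \<in> P \<Longrightarrow> x \<in> K \<Longrightarrow> R ij \<le> norm (h x (fst ij) - h x (snd ij))"
    by metis
  \<comment> \<open>The additional element 1 covers a single strand, where there are no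
    pairs.\<close>
  define r where "r = Min (insert 1 (R ` P))"
  have r: "0 < r" using finP R(1) by (simp add: r_def)
  have sep: "r \<le> norm (h x i - h x j)" if "x \<in> K" "i \<in> {1..n}" "j \<in> {1..n}" "i \<noteq> j" for x i j
  proof -
    have "(i, j) \<in> P" using that by (simp add: P_def)
    then have "r \<le> R (i, j)" unfolding r_def using finP by (intro Min_le) auto
    then show ?thesis using R(2)[OF \<open>(i, j) \<in> P\<close> that(1)] by simp
  qed
  have "\<exists>d>0. \<forall>x\<in>K. \<forall>y\<in>K. dist y x < d \<longrightarrow> dist (h y j) (h x j) < r / (2 * real n)" for j
    using compact_uniformly_continuous[OF hj K(1), of j] r False
    unfolding uniformly_continuous_on_def by simp
  then obtain d where d: "\<And>j. 0 < d j" "\<And>j x y. x \<in> K \<Longrightarrow> y \<in> K \<Longrightarrow> dist y x < d j \<Longrightarrow> dist (h y j) (h x j) < r / (2 * real n)"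
    by metis
  define \<delta> where "\<delta> = Min (d ` {1..n})"
  have "0 < \<delta>" using False d(1) by (simp add: \<delta>_def)
  then obtain N :: nat where N: "0 < N" "inverse (real N) < \<delta>"
    using reals_Archimedean[of \<delta>] by (metis zero_less_Suc)
  define p where "p k s = h (real k / real N, s)" for k s
  have inK: "(real k / real N, s) \<in> K" if "k \<le> N" "s \<in> {0..1}" for k s
    using that N(1) by (simp add: K_def)
  have contp: "continuous_on {0..1} (p k)" if "k \<le> N" for k
    unfolding p_def
    by (rule continuous_on_compose2[OF h(1)]) (use inK[OF that] in \<open>auto intro: continuous_intros simp: K_def\<close>)
  have "k \<le> N \<Longrightarrow> link_eq (curve_link n \<pi> (p 0)) (curve_link n \<pi> (p k))" for k
  proof (induction k)
    case (Suc k)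
    have "link_eq (curve_link n \<pi> (p k)) (curve_link n \<pi> (p (Suc k)))"
    proof (rule link_eq_close[OF \<pi> _ _ _ _ r])
      show "p k 1 = p k 0 \<circ> \<pi>" "p (Suc k) 1 = p (Suc k) 0 \<circ> \<pi>"
        using closed Suc.prems N(1) by (simp_all add: p_def)
      show "r \<le> norm (p k s i - p k s j)" if "s \<in> {0..1}" "i \<in> {1..n}" "j \<in> {1..n}" "i \<noteq> j" for s i j
        using sep[OF inK] that Suc.prems by (simp add: p_def)
      show "2 * real n * norm (p (Suc k) s j - p k s j) \<le> r" if s: "s \<in> {0..1}" and j: "j \<in> {1..n}" for s j
      proof -
        have "real (Suc k) / real N - real k / real N = inverse (real N)"
          using N(1) by (simp add: field_simps)
        then have "dist (real (Suc k) / real N, s) (real k / real N, s) = inverse (real N)"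
          by (simp add: dist_Pair_Pair dist_real_def)
        also have "\<dots> < d j"
          using N(2) j by (simp add: \<delta>_def)
        finally have "dist (p (Suc k) s j) (p k s j) < r / (2 * real n)"
          unfolding p_def using Suc.prems s by (intro d(2) inK) auto
        then show ?thesis using False by (simp add: dist_norm field_simps)
      qed
    qed (use contp Suc.prems in auto)
    then show ?case using Suc link_eq_trans by simp
  qed (simp add: link_eq_refl)
  from this[of N] have "link_eq (curve_link n \<pi> (p 0)) (curve_link n \<pi> (p N))" by simp
  moreover have "p 0 = (\<lambda>s. h (0, s))" "p N = (\<lambda>s. h (1, s))"
    using N(1) by (simp_all add: p_def fun_eq_iff)
  ultimately show ?thesis by simp
qed

section \<open>Braid words as paths of configurations\<close>

abbreviation swap_pos :: "nat \<Rightarrow> nat \<Rightarrow> nat" where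
  "swap_pos k \<equiv> Transposition.transpose k (Suc k)"

text \<open>
  Strand labels range over all natural numbers, so that one configuration space serves braids on any
  number of strands: all labels above the number of strands stay fixed.
\<close>

definition injections :: "(nat \<Rightarrow> complex) set" where
  "injections = {x. inj x}"

lemma injections_subset_config: "injections \<subseteq> config n"
  by (auto simp: injections_def config_def intro: inj_on_subset)

definition generator_path :: "nat \<Rightarrow> real \<Rightarrow> nat \<Rightarrow> complex" where
  "generator_path k s j = generator_strand k j s"

lemma braid_path_Nil: "braid_path [] = (\<lambda>s j. of_nat j)"
  by (simp add: braid_path_def fun_eq_iff)

lemma braid_path_Cons:
  "braid_path (k # w) = generator_path k +++ (\<lambda>s. braid_path w s \<circ> swap_pos k)"
  by (simp add: braid_path_def generator_path_def joinpaths_def fun_eq_iff)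

lemma generator_path_0: "generator_path k 0 = of_nat"
  by (auto simp: generator_path_def generator_strand_def fun_eq_iff)

lemma generator_path_1: "generator_path k 1 = of_nat \<circ> swap_pos k"
  by (auto simp: generator_path_def generator_strand_def fun_eq_iff Transposition.transpose_def)

lemma braid_path_0: "braid_path w 0 = of_nat"
  by (cases w) (simp_all add: braid_path_Nil braid_path_Cons joinpaths_def generator_path_0)

lemma braid_path_1: "braid_path w 1 = of_nat \<circ> braid_perm w"
  by (induction w) (auto simp: braid_path_Nil braid_path_Cons joinpaths_def fun_eq_iff)

lemma braid_perm_append: "braid_perm (u @ v) = braid_perm v \<circ> braid_perm u"
  by (induction u) (auto simp: fun_eq_iff)

lemma braid_perm_permutes: "set w \<subseteq> {1..<n} \<Longrightarrow> braid_perm w permutes {1..n}"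
proof (induction w)
  case Nil
  have "braid_perm [] = id" by (auto simp: fun_eq_iff)
  then show ?case by (simp only: permutes_id)
next
  case (Cons k w)
  have "swap_pos k permutes {1..n}" using Cons.prems by (intro permutes_swap_id) auto
  moreover have "braid_perm w permutes {1..n}" using Cons by simp
  moreover have perm: "braid_perm (k # w) = braid_perm w \<circ> swap_pos k" by (auto simp: fun_eq_iff)
  ultimately show ?case unfolding perm by (intro permutes_compose)
qed

lemma path_fun_iff: "path p \<longleftrightarrow> (\<forall>j. path (\<lambda>s. p s j))"
  unfolding path_def
  by (auto intro: continuous_on_coordinatewise_then_product continuous_on_product_then_coordinatewise)

lemma continuous_on_relabel: "continuous_on S (\<lambda>x :: nat \<Rightarrow> complex. x \<circ> \<tau>)"
  unfolding comp_def
  by (intro continuous_on_coordinatewise_then_product continuous_on_subset[OF continuous_on_product_coordinates]) simp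

lemma path_relabel: "path p \<Longrightarrow> path (\<lambda>s. p s \<circ> \<tau>)" for p :: "real \<Rightarrow> nat \<Rightarrow> complex"
  by (simp add: path_fun_iff)

lemma path_generator_path: "path (generator_path k)"
  unfolding path_fun_iff
proof
  fix j
  show "path (\<lambda>s. generator_path k s j)"
    unfolding path_def generator_path_def generator_strand_def cis_conv_exp
    by (cases "j = k"; cases "j = Suc k"; auto intro!: continuous_intros)
qed

lemma path_braid_path: "path (braid_path w)"
proof (induction w)
  case Nil
  show ?case unfolding path_fun_iff path_def braid_path_Nil by simp
next
  case (Cons k w)
  have "pathfinish (generator_path k) = pathstart (\<lambda>s. braid_path w s \<circ> swap_pos k)"
    by (simp add: pathfinish_def pathstart_def generator_path_1 braid_path_0)
  with Cons show ?case by (simp add: braid_path_Cons path_generator_path path_relabel)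
qed

lemma Re_generator_path:
  "Re (generator_path k s j) = (if j = k then real k + 1/2 - cos (pi * s) / 2
     else if j = Suc k then real k + 1/2 + cos (pi * s) / 2 else real j)"
  by (simp add: generator_path_def generator_strand_def)

lemma Im_generator_path:
  "Im (generator_path k s j) = (if j = k then - sin (pi * s) / 2
     else if j = Suc k then sin (pi * s) / 2 else 0)"
  by (simp add: generator_path_def generator_strand_def)

lemma Re_generator_path_bounds:
  "j \<in> {k, Suc k} \<Longrightarrow> Re (generator_path k s j) \<in> {real k..real k + 1}"
  using cos_le_one[of "pi * s"] cos_ge_minus_one[of "pi * s"]
  by (auto simp: Re_generator_path simp del: cos_le_one cos_ge_minus_one)

lemma Re_generator_path_eq:
  assumes "Re (generator_path k s i) = Re (generator_path k s j)" "i \<noteq> j"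
  shows "(i = k \<and> j = Suc k \<or> i = Suc k \<and> j = k) \<and> cos (pi * s) = 0"
proof -
  have other: "x \<in> {k, Suc k}"
    if "Re (generator_path k s x) = Re (generator_path k s y)" "y \<in> {k, Suc k}" for x y
  proof (rule ccontr)
    assume x: "x \<notin> {k, Suc k}"
    then have "Re (generator_path k s x) = real x" by (auto simp: Re_generator_path)
    then have "real k \<le> real x" "real x \<le> real (Suc k)"
      using Re_generator_path_bounds[OF that(2), of s] that(1) by auto
    then show False using x by auto
  qed
  have "i \<in> {k, Suc k} \<or> j \<in> {k, Suc k}"
    using assms by (auto simp: Re_generator_path split: if_splits)
  then have "i \<in> {k, Suc k}" "j \<in> {k, Suc k}"
    using other[of i j] other[of j i] assms(1) by auto
  then show ?thesis using assms by (auto simp: Re_generator_path)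
qed

lemma generator_path_inj: "generator_path k s \<in> injections"
proof -
  have "generator_path k s i \<noteq> generator_path k s j" if "i \<noteq> j" for i j
  proof
    assume eq: "generator_path k s i = generator_path k s j"
    then have "(i = k \<and> j = Suc k \<or> i = Suc k \<and> j = k) \<and> cos (pi * s) = 0"
      using Re_generator_path_eq that by metis
    moreover from this have "sin (pi * s) = 0"
      using arg_cong[OF eq, of Im] by (auto simp: Im_generator_path)
    ultimately show False using sin_cos_squared_add[of "pi * s"] by simp
  qed
  then show ?thesis unfolding injections_def by (auto intro: injI)
qed

lemma injections_relabel: "x \<in> injections \<Longrightarrow> inj \<tau> \<Longrightarrow> x \<circ> \<tau> \<in> injections"
  by (simp add: injections_def inj_compose)

lemma braid_path_inj: "braid_path w s \<in> injections"
proof (induction w arbitrary: s)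
  case Nil
  show ?case by (simp add: braid_path_Nil injections_def inj_def)
next
  case (Cons k w)
  show ?case
    using Cons generator_path_inj by (auto simp: braid_path_Cons joinpaths_def intro!: injections_relabel)
qed

lemma path_image_braid_path: "path_image (braid_path w) \<subseteq> injections"
  using braid_path_inj by (auto simp: path_image_def)

lemma curve_link_cong:
  assumes "\<And>s. s \<in> {0..<1} \<Longrightarrow> p s = q s"
  shows "curve_link n \<pi> p = curve_link n \<pi> q"
proof -
  have "curve_component \<pi> p j = curve_component \<pi> q j" for j
    using assms by (intro ext) (simp add: curve_component_def Let_def frac_lt_1)
  then show ?thesis by (simp add: curve_link_def)
qed

lemma link_eq_homotopic_paths:
  assumes hom: "homotopic_paths injections p q" and \<pi>: "\<pi> permutes {1..n}" and p: "p 1 = p 0 \<circ> \<pi>"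
  shows "link_eq (curve_link n \<pi> p) (curve_link n \<pi> q)"
proof -
  obtain h where h: "continuous_on ({0..1} \<times> {0..1}) h" "h \<in> {0..1} \<times> {0..1} \<rightarrow> injections"
    "\<And>x. x \<in> {0..1} \<Longrightarrow> h (0, x) = p x" "\<And>x. x \<in> {0..1} \<Longrightarrow> h (1, x) = q x"
    "\<And>t. t \<in> {0..1::real} \<Longrightarrow> h (t, 0) = p 0 \<and> h (t, 1) = p 1"
    using hom unfolding homotopic_paths by (auto simp: pathstart_def pathfinish_def)
  have "link_eq (curve_link n \<pi> (\<lambda>s. h (0, s))) (curve_link n \<pi> (\<lambda>s. h (1, s)))"
  proof (rule link_eq_homotopy[OF \<pi> h(1)])
    show "h \<in> {0..1} \<times> {0..1} \<rightarrow> config n" using h(2) injections_subset_config by blast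
    show "h (\<tau>, 1) = h (\<tau>, 0) \<circ> \<pi>" if "\<tau> \<in> {0..1}" for \<tau> using h(5)[OF that] p by simp
  qed
  moreover have "curve_link n \<pi> (\<lambda>s. h (0, s)) = curve_link n \<pi> p"
    "curve_link n \<pi> (\<lambda>s. h (1, s)) = curve_link n \<pi> q"
    using h(3,4) by (auto intro!: curve_link_cong)
  ultimately show ?thesis by simp
qed

lemma linear_homotopy_continuous:
  fixes p q :: "real \<Rightarrow> nat \<Rightarrow> complex"
  assumes "path p" "path q"
  shows "continuous_on ({0..1} \<times> {0..1}) (\<lambda>x j. (1 - fst x) *\<^sub>R p (snd x) j + fst x *\<^sub>R q (snd x) j)"
proof (rule continuous_on_coordinatewise_then_product)
  fix j
  have "continuous_on ({0..1} \<times> {0..1}) (\<lambda>x::real \<times> real. p (snd x) j)"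
    "continuous_on ({0..1} \<times> {0..1}) (\<lambda>x::real \<times> real. q (snd x) j)"
    using assms unfolding path_fun_iff path_def
    by (auto intro!: continuous_on_compose2[of "{0..1}" _ _ snd] continuous_intros)
  then show "continuous_on ({0..1} \<times> {0..1}) (\<lambda>x. (1 - fst x) *\<^sub>R p (snd x) j + fst x *\<^sub>R q (snd x) j)"
    by (intro continuous_intros)
qed

lemma homotopic_paths_linear_injections:
  assumes p: "path p" and q: "path q" and ends: "p 0 = q 0" "p 1 = q 1"
    and sep: "\<And>s t i j. \<lbrakk>s \<in> {0..1}; t \<in> {0..1}; i < j\<rbrakk> \<Longrightarrow>
      (1 - t) *\<^sub>R (p s j - p s i) + t *\<^sub>R (q s j - q s i) \<noteq> 0"
  shows "homotopic_paths injections p q"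
  unfolding homotopic_paths
proof (intro exI[of _ "\<lambda>x j. (1 - fst x) *\<^sub>R p (snd x) j + fst x *\<^sub>R q (snd x) j"] conjI ballI)
  show "(\<lambda>x j. (1 - fst x) *\<^sub>R p (snd x) j + fst x *\<^sub>R q (snd x) j) \<in> {0..1} \<times> {0..1} \<rightarrow> injections"
  proof
    fix x :: "real \<times> real" assume x: "x \<in> {0..1} \<times> {0..1}"
    define y where "y j = (1 - fst x) *\<^sub>R p (snd x) j + fst x *\<^sub>R q (snd x) j" for j
    have "y i \<noteq> y j" if "i < j" for i j
    proof -
      have "y j - y i = (1 - fst x) *\<^sub>R (p (snd x) j - p (snd x) i) + fst x *\<^sub>R (q (snd x) j - q (snd x) i)"
        by (simp add: y_def algebra_simps)
      then show ?thesis using sep[of "snd x" "fst x" i j] x that by auto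
    qed
    then have "inj y" by (metis injI linorder_neqE_nat)
    then show "(\<lambda>j. (1 - fst x) *\<^sub>R p (snd x) j + fst x *\<^sub>R q (snd x) j) \<in> injections"
      by (simp add: injections_def y_def[abs_def])
  qed
qed (use linear_homotopy_continuous[OF p q] ends in
      \<open>auto simp: pathstart_def pathfinish_def scaleR_left_distrib[symmetric]\<close>)

text \<open>
  Two braids in which every pair of strands \<open>i < j\<close> crosses only with \<open>j\<close> passing above \<open>i\<close> are
  made disjoint in the imaginary direction, where they can be deformed into each other linearly.
\<close>

lemma homotopic_paths_positive:
  fixes p q :: "real \<Rightarrow> nat \<Rightarrow> complex"
  assumes p: "path p" and q: "path q" and ends: "p 0 = q 0" "p 1 = q 1"
    and pos: "\<And>s i j. \<lbrakk>s \<in> {0..1}; i < j; Re (p s j) = Re (p s i)\<rbrakk> \<Longrightarrow> Im (p s i) < Im (p s j)"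
      "\<And>s i j. \<lbrakk>s \<in> {0..1}; i < j; Re (q s j) = Re (q s i)\<rbrakk> \<Longrightarrow> Im (q s i) < Im (q s j)"
    and start: "\<And>s i j. \<lbrakk>0 \<le> s; s \<le> 1/8; i < j\<rbrakk> \<Longrightarrow> Re (p s i) < Re (p s j) \<and> Re (q s i) < Re (q s j)"
    and final: "\<And>s. 7/8 \<le> s \<Longrightarrow> s \<le> 1 \<Longrightarrow> p s = q s"
    and bound: "\<And>s j. s \<in> {0..1} \<Longrightarrow> \<bar>Im (p s j)\<bar> \<le> 1 \<and> \<bar>Im (q s j)\<bar> \<le> 1"
  shows "homotopic_paths injections p q"
proof -
  \<comment> \<open>On [1/8, 7/8] the product \<open>s * (1 - s)\<close> is at least 7/64, and 20
    times this exceeds 2, the largest possible difference of imaginary parts that lie between -1 and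
    1.\<close>
  define e where "e s j = \<i> * of_real (20 * (s * (1 - s)) * real j)" for s :: real and j :: nat
  define lift where "lift x s j = x s j + e s j" for x :: "real \<Rightarrow> nat \<Rightarrow> complex" and s j
  have e: "Re (e s j) = 0" "Im (e s j) = 20 * (s * (1 - s)) * real j" for s j by (simp_all add: e_def)
  have e_mono: "Im (e s i) \<le> Im (e s j)" if "s \<in> {0..1}" "i < j" for s i j
    using that unfolding e by (intro mult_left_mono) auto
  have e_gap: "Im (e s i) + 2 < Im (e s j)" if "1/8 \<le> s" "s \<le> 7/8" "i < j" for s i j
  proof -
    have "(s - 1/8) * (7/8 - s) \<ge> 0" using that by simp
    moreover have "(s - 1/8) * (7/8 - s) = s * (1 - s) - 7/64" by (simp add: field_simps)
    ultimately have s: "s * (1 - s) \<ge> 7/64" by linarith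
    then have "20 * (s * (1 - s)) * 1 \<le> 20 * (s * (1 - s)) * (real j - real i)"
      using that by (intro mult_left_mono) auto
    then show ?thesis using s unfolding e by (simp add: algebra_simps)
  qed
  have path_e: "path e" unfolding path_fun_iff path_def e_def by (intro allI continuous_intros)
  have path_lift: "path (lift x)" if "path x" for x
    using that path_e unfolding path_fun_iff path_def lift_def by (auto intro: continuous_intros)
  have lift_ends: "lift x 0 = x 0" "lift x 1 = x 1" for x by (auto simp: lift_def e_def)
  have lifting: "homotopic_paths injections x (lift x)"
    if x: "path x" and pos: "\<And>s i j. \<lbrakk>s \<in> {0..1}; i < j; Re (x s j) = Re (x s i)\<rbrakk> \<Longrightarrow> Im (x s i) < Im (x s j)" for x
  proof (rule homotopic_paths_linear_injections[OF x path_lift[OF x]])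
    fix s t :: real and i j :: nat assume st: "s \<in> {0..1}" "t \<in> {0..1}" "i < j"
    have eq: "(1 - t) *\<^sub>R (x s j - x s i) + t *\<^sub>R (lift x s j - lift x s i) = (x s j - x s i) + t *\<^sub>R (e s j - e s i)"
      by (simp add: lift_def algebra_simps)
    show "(1 - t) *\<^sub>R (x s j - x s i) + t *\<^sub>R (lift x s j - lift x s i) \<noteq> 0"
    proof (cases "Re (x s j) = Re (x s i)")
      case True
      have "0 \<le> t * (Im (e s j) - Im (e s i))" using st e_mono[of s i j] by simp
      then have "Im ((x s j - x s i) + t *\<^sub>R (e s j - e s i)) > 0" using pos[OF st(1,3) True] by simp
      then show ?thesis unfolding eq by (metis less_irrefl zero_complex.sel(2))
    next
      case False
      then have "Re ((x s j - x s i) + t *\<^sub>R (e s j - e s i)) \<noteq> 0" by (simp add: e)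
      then show ?thesis unfolding eq by (metis zero_complex.sel(1))
    qed
  qed (simp_all add: lift_ends)
  have lp: "homotopic_paths injections p (lift p)" by (rule lifting[OF p]) (rule pos(1))
  have lq: "homotopic_paths injections q (lift q)" by (rule lifting[OF q]) (rule pos(2))
  have convex_pos: "(1 - t) * a + t * b > 0" if "t \<in> {0..1}" "0 < a" "0 < b" for t a b :: real
    using that by (cases "t = 0") (auto intro!: add_nonneg_pos)
  have "homotopic_paths injections (lift p) (lift q)"
  proof (rule homotopic_paths_linear_injections[OF path_lift[OF p] path_lift[OF q]])
    fix s t :: real and i j :: nat assume st: "s \<in> {0..1}" "t \<in> {0..1}" "i < j"
    let ?d = "(1 - t) *\<^sub>R (lift p s j - lift p s i) + t *\<^sub>R (lift q s j - lift q s i)"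
    \<comment> \<open>Near the start the real parts keep the strands apart, in the middle the lifted
      imaginary parts do, and near the end the two paths coincide.\<close>
    consider "s \<le> 1/8" | "1/8 \<le> s" "s \<le> 7/8" | "7/8 \<le> s" by linarith
    then show "?d \<noteq> 0"
    proof cases
      case 1
      have "Re ?d = (1 - t) * (Re (p s j) - Re (p s i)) + t * (Re (q s j) - Re (q s i))"
        by (simp add: lift_def e)
      also have "\<dots> > 0" using start[of s i j] 1 st by (intro convex_pos) auto
      finally show ?thesis by (metis less_irrefl zero_complex.sel(1))
    next
      case 2
      have "Im (lift x s j) > Im (lift x s i)" if "\<bar>Im (x s i)\<bar> \<le> 1" "\<bar>Im (x s j)\<bar> \<le> 1" for x
        using that e_gap[OF 2 st(3)] by (simp add: lift_def)
      then have "Im ?d > 0" using bound[OF st(1)] st(2)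
        by (simp del: minus_complex.sel) (intro convex_pos; simp)
      then show ?thesis by (metis less_irrefl zero_complex.sel(2))
    next
      case 3
      then have "lift q s = lift p s" using final st by (simp add: lift_def fun_eq_iff)
      then have d: "?d = lift p s j - lift p s i" by (simp add: algebra_simps)
      have "lift p s \<in> injections"
        using homotopic_paths_imp_subset[OF lp] st(1) unfolding path_image_def by blast
      then have "lift p s j \<noteq> lift p s i" using st(3) by (simp add: injections_def inj_eq)
      then show ?thesis unfolding d by simp
    qed
  qed (simp_all add: lift_ends ends)
  then show ?thesis
    by (rule homotopic_paths_trans[OF lp homotopic_paths_trans[OF _ homotopic_paths_sym[OF lq]]])
qed

text \<open>For \<open>a < b\<close> this says that the two strands cross at most once: after a
  crossing \<open>b\<close> lies to the left of \<open>a\<close>, and a second crossing is the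
  excluded case. Words satisfying this for all pairs represent the positive permutation
  braids.\<close>

fun in_order :: "nat list \<Rightarrow> nat \<Rightarrow> nat \<Rightarrow> bool" where
  "in_order [] a b = True"
| "in_order (k # w) a b = (\<not> (a = Suc k \<and> b = k) \<and> in_order w (swap_pos k a) (swap_pos k b))"

text \<open>Real parts of distinct strands coincide only in the middle of a crossing. The half turn
  is counterclockwise, so the strand coming from the left, here \<open>a\<close>, passes
  below.\<close>

lemma in_order_imp_positive:
  "\<lbrakk>in_order w a b; a \<noteq> b; s \<in> {0..1}; Re (braid_path w s b) = Re (braid_path w s a)\<rbrakk>
   \<Longrightarrow> Im (braid_path w s a) < Im (braid_path w s b)"
proof (induction w arbitrary: a b s)
  case Nil
  then show ?case by (simp add: braid_path_Nil)
next
  case (Cons k w)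
  show ?case
  proof (cases "s \<le> 1/2")
    case True
    have path: "braid_path (k # w) s = generator_path k (2 * s)"
      using True by (simp add: braid_path_Cons joinpaths_def)
    have ab: "a = k" "b = Suc k" "cos (pi * (2 * s)) = 0"
      using Re_generator_path_eq[of k "2 * s" b a] Cons.prems unfolding path by auto
    have "sin (pi * (2 * s)) \<ge> 0" using Cons.prems True by (intro sin_ge_zero) auto
    moreover have "sin (pi * (2 * s)) \<noteq> 0" using ab(3) sin_cos_squared_add[of "pi * (2 * s)"] by auto
    ultimately show ?thesis unfolding path using ab(1,2) by (simp add: Im_generator_path)
  next
    case False
    have "inj (swap_pos k)" by simp
    then have "swap_pos k a \<noteq> swap_pos k b" using Cons.prems(2) by (metis injD)
    then show ?thesis
      using Cons.prems Cons.IH[of "swap_pos k a" "swap_pos k b" "2 * s - 1"] False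
      by (simp add: braid_path_Cons joinpaths_def)
  qed
qed

lemma Im_braid_path_bound: "\<bar>Im (braid_path w s j)\<bar> \<le> 1"
proof (induction w arbitrary: s j)
  case (Cons k w)
  have "\<bar>Im (generator_path k x i)\<bar> \<le> 1" for x i
    using abs_sin_le_one[of "pi * x"] by (auto simp: Im_generator_path simp del: abs_sin_le_one)
  with Cons show ?case by (simp add: braid_path_Cons joinpaths_def)
qed (simp add: braid_path_Nil)

text \<open>The first letter occupies [0, 1/2] and its two real parts meet at 1/4; up to 1/8 the
  real parts are still ordered as the labels.\<close>

lemma braid_path_start:
  assumes "0 \<le> s" "s \<le> 1/8" "i < j"
  shows "Re (braid_path w s i) < Re (braid_path w s j)"
proof (cases w)
  case Nil
  then show ?thesis using assms by (simp add: braid_path_Nil)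
next
  case (Cons k v)
  have path: "braid_path w s = generator_path k (2 * s)"
    using assms by (simp add: Cons braid_path_Cons joinpaths_def)
  have "0 \<le> pi * (2 * s)" "pi * (2 * s) \<le> pi * (1 / 4)"
    using assms by (auto intro: mult_left_mono)
  then have "cos (pi * (2 * s)) > 0" using pi_gt_zero by (intro cos_gt_zero_pi) linarith+
  moreover have "cos (pi * (2 * s)) \<le> 1" by simp
  ultimately show ?thesis
    unfolding path using assms(3) by (auto simp: Re_generator_path simp del: cos_le_one)
qed

text \<open>Joins are nested to the right, so every letter takes half of the time that is left, and
  a word of length k is at rest from time 1 - 1/2^k on. The longest word in a braid relation has
  three letters, whence 7/8.\<close>

lemma braid_path_final:
  assumes "length w \<le> 3" "7/8 \<le> s"
  shows "braid_path w s = of_nat \<circ> braid_perm w"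
proof -
  have "braid_path w s = of_nat \<circ> braid_perm w" if "1 - 1 / 2 ^ length w \<le> s" for s
    using that
  proof (induction w arbitrary: s)
    case (Cons k w)
    define y where "y = (1::real) / 2 ^ length w"
    have s: "1 - y / 2 \<le> s" using Cons.prems by (simp add: y_def)
    show ?case
    proof (cases "s \<le> 1/2")
      case True
      then have "1 \<le> (1::real) / 2 ^ length w" using s unfolding y_def[symmetric] by linarith
      then have "(2::real) ^ length w \<le> 2 ^ 0" by (simp add: field_simps)
      then have w: "w = []" using power_increasing_iff[of "2::real" "length w" 0] by simp
      then have s: "s = 1/2" using True Cons.prems by simp
      have "braid_path [k] (1/2) = of_nat \<circ> swap_pos k"
        by (simp add: braid_path_Cons joinpaths_def generator_path_1)
      then show ?thesis unfolding w s by (simp add: fun_eq_iff)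
    next
      case False
      have "1 - 1 / 2 ^ length w \<le> 2 * s - 1" using s unfolding y_def[symmetric] by linarith
      then show ?thesis
        using False Cons.IH by (simp add: braid_path_Cons joinpaths_def fun_eq_iff)
    qed
  qed (simp add: braid_path_Nil fun_eq_iff)
  moreover have "(2::real) ^ length w \<le> 2 ^ 3" using assms(1) by (intro power_increasing) auto
  then have "1 - 1 / 2 ^ length w \<le> (7/8 :: real)" by (simp add: field_simps)
  then have "1 - 1 / 2 ^ length w \<le> s" using assms(2) by (rule order_trans)
  ultimately show ?thesis by blast
qed

text \<open>A positive braid in which any two strands cross at most once is determined by its
  permutation. Both braid relations are instances.\<close>

lemma homotopic_simple_words:
  assumes "length v \<le> 3" "length w \<le> 3" "braid_perm v = braid_perm w"
    and "\<And>a b. a < b \<Longrightarrow> in_order v a b" "\<And>a b. a < b \<Longrightarrow> in_order w a b"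
  shows "homotopic_paths injections (braid_path v) (braid_path w)"
proof (rule homotopic_paths_positive)
  show "Im (braid_path v s i) < Im (braid_path v s j)"
    if "s \<in> {0..1}" "i < j" "Re (braid_path v s j) = Re (braid_path v s i)" for s i j
    using in_order_imp_positive[OF assms(4)] that by blast
  show "Im (braid_path w s i) < Im (braid_path w s j)"
    if "s \<in> {0..1}" "i < j" "Re (braid_path w s j) = Re (braid_path w s i)" for s i j
    using in_order_imp_positive[OF assms(5)] that by blast
qed (use assms in \<open>simp_all add: path_braid_path braid_path_0 braid_path_1 braid_path_start
      braid_path_final Im_braid_path_bound\<close>)

lemma homotopic_far:
  "i + 2 \<le> j \<Longrightarrow> homotopic_paths injections (braid_path [i, j]) (braid_path [j, i])"
  by (rule homotopic_simple_words)
     (auto simp: fun_eq_iff Transposition.transpose_def split: if_splits)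

lemma homotopic_near:
  "homotopic_paths injections (braid_path [i, Suc i, i]) (braid_path [Suc i, i, Suc i])"
  by (rule homotopic_simple_words)
     (auto simp: fun_eq_iff Transposition.transpose_def split: if_splits)

lemma homotopic_paths_const_join:
  assumes "path p" "path_image p \<subseteq> S"
  shows "homotopic_paths S p ((\<lambda>_. pathstart p) +++ p)"
  by (rule homotopic_paths_reparametrize[OF assms, where f = "\<lambda>t. max 0 (2 * t - 1)"])
     (auto intro!: continuous_intros simp: joinpaths_def pathstart_def)

lemma homotopic_paths_join_const:
  assumes "path p" "path_image p \<subseteq> S"
  shows "homotopic_paths S p (p +++ (\<lambda>_. pathfinish p))"
  by (rule homotopic_paths_reparametrize[OF assms, where f = "\<lambda>t. min 1 (2 * t)"])
     (auto intro!: continuous_intros simp: joinpaths_def pathfinish_def)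

lemma homotopic_paths_relabel:
  assumes "homotopic_paths injections p q" "inj \<tau>"
  shows "homotopic_paths injections (\<lambda>s. p s \<circ> \<tau>) (\<lambda>s. q s \<circ> \<tau>)"
  using homotopic_paths_continuous_image[OF assms(1) continuous_on_relabel[of _ \<tau>], of injections]
    injections_relabel[OF _ assms(2)]
  by (auto simp: comp_def)

lemma inj_braid_perm: "inj (braid_perm w)"
proof (induction w)
  case Nil
  show ?case by (simp add: inj_def)
next
  case (Cons k w)
  have perm: "braid_perm (k # w) = braid_perm w \<circ> swap_pos k" by (auto simp: fun_eq_iff)
  have "inj (swap_pos k)" by simp
  with Cons show ?case unfolding perm by (rule inj_compose)
qed

lemma pathstart_relabel_braid_path: "pathstart (\<lambda>s. braid_path w s \<circ> \<tau>) = of_nat \<circ> \<tau>"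
  by (simp add: pathstart_def braid_path_0)

lemma pathfinish_generator_path: "pathfinish (generator_path k) = of_nat \<circ> swap_pos k"
  by (simp add: pathfinish_def generator_path_1)

lemma pathfinish_braid_path: "pathfinish (braid_path w) = of_nat \<circ> braid_perm w"
  by (simp add: pathfinish_def braid_path_1)

lemma homotopic_refl_generator: "homotopic_paths injections (generator_path k) (generator_path k)"
  using path_generator_path generator_path_inj by (auto simp: path_image_def)

lemma homotopic_refl_braid: "homotopic_paths injections (braid_path w) (braid_path w)"
  using path_braid_path path_image_braid_path by simp

lemma homotopic_Cons:
  assumes "homotopic_paths injections (braid_path v) (braid_path w)"
  shows "homotopic_paths injections (braid_path (k # v)) (braid_path (k # w))"
  unfolding braid_path_Cons
  by (intro homotopic_paths_join homotopic_refl_generator homotopic_paths_relabel assms)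
     (simp_all add: pathfinish_generator_path pathstart_relabel_braid_path)

text \<open>The nested joins in \<open>braid_path (u @ v)\<close> do not change from
  \<open>u\<close> to \<open>v\<close> at time 1/2; associativity of joins up to homotopy corrects
  the timing.\<close>

lemma homotopic_append_join:
  "homotopic_paths injections (braid_path (u @ v)) (braid_path u +++ (\<lambda>s. braid_path v s \<circ> braid_perm u))"
proof (induction u)
  case Nil
  have "braid_path [] = (\<lambda>_. pathstart (braid_path v))"
    by (simp add: braid_path_Nil pathstart_def braid_path_0 fun_eq_iff)
  moreover have "(\<lambda>s. braid_path v s \<circ> braid_perm []) = braid_path v" by (simp add: fun_eq_iff)
  ultimately show ?case
    using homotopic_paths_const_join[OF path_braid_path path_image_braid_path, of v] by simp
next
  case (Cons k u)
  define P where "P = generator_path k"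
  define Q where "Q = (\<lambda>s. braid_path u s \<circ> swap_pos k)"
  define R where "R = (\<lambda>s. braid_path v s \<circ> braid_perm (k # u))"
  have inj: "inj (swap_pos k)" by simp
  have "homotopic_paths injections (\<lambda>s. braid_path (u @ v) s \<circ> swap_pos k)
      (\<lambda>s. (braid_path u +++ (\<lambda>s. braid_path v s \<circ> braid_perm u)) s \<circ> swap_pos k)"
    by (rule homotopic_paths_relabel[OF Cons inj])
  also have "(\<lambda>s. (braid_path u +++ (\<lambda>s. braid_path v s \<circ> braid_perm u)) s \<circ> swap_pos k) = Q +++ R"
    by (simp add: Q_def R_def joinpaths_def fun_eq_iff)
  finally have 0: "homotopic_paths injections (\<lambda>s. braid_path (u @ v) s \<circ> swap_pos k) (Q +++ R)" .
  have 1: "homotopic_paths injections (braid_path ((k # u) @ v)) (P +++ (Q +++ R))"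
    unfolding append_Cons braid_path_Cons P_def
    by (rule homotopic_paths_join[OF homotopic_refl_generator 0])
       (simp add: pathfinish_generator_path pathstart_relabel_braid_path)
  have 2: "homotopic_paths injections (P +++ (Q +++ R)) ((P +++ Q) +++ R)"
  proof (rule homotopic_paths_assoc)
    show "path P" "path_image P \<subseteq> injections"
      using homotopic_refl_generator[of k] by (simp_all add: P_def)
    show "path Q" "path_image Q \<subseteq> injections"
      using homotopic_paths_relabel[OF homotopic_refl_braid[of u] inj] by (simp_all add: Q_def)
    show "path R" "path_image R \<subseteq> injections"
      using homotopic_paths_relabel[OF homotopic_refl_braid[of v] inj_braid_perm[of "k # u"]] by (simp_all add: R_def)
    show "pathfinish P = pathstart Q"
      by (simp add: P_def Q_def pathfinish_generator_path pathstart_relabel_braid_path)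
    show "pathfinish Q = pathstart R"
      by (simp add: Q_def R_def pathfinish_def pathstart_def braid_path_0 braid_path_1 fun_eq_iff)
  qed
  have PQ: "P +++ Q = braid_path (k # u)" by (simp add: P_def Q_def braid_path_Cons)
  show ?case using homotopic_paths_trans[OF 1 2] unfolding PQ R_def .
qed

lemma homotopic_append_right:
  assumes "homotopic_paths injections (braid_path u) (braid_path v)" "braid_perm u = braid_perm v"
  shows "homotopic_paths injections (braid_path (u @ w)) (braid_path (v @ w))"
proof -
  have "homotopic_paths injections (braid_path u +++ (\<lambda>s. braid_path w s \<circ> braid_perm u))
      (braid_path v +++ (\<lambda>s. braid_path w s \<circ> braid_perm v))"
    using homotopic_paths_relabel[OF homotopic_refl_braid[of w] inj_braid_perm[of v]]
    by (intro homotopic_paths_join assms(1))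
       (simp_all add: assms(2) pathfinish_braid_path pathstart_relabel_braid_path)
  then show ?thesis
    using homotopic_append_join homotopic_paths_trans homotopic_paths_sym by meson
qed

lemma homotopic_append_left:
  assumes "homotopic_paths injections (braid_path v) (braid_path w)"
  shows "homotopic_paths injections (braid_path (u @ v)) (braid_path (u @ w))"
  by (induction u) (simp_all add: assms homotopic_Cons)

section \<open>Conjugation\<close>

text \<open>A braid read from another level has its strands named after other starting points; the
  closing permutation is then replaced by a conjugate.\<close>

lemma curve_link_relabel:
  assumes \<tau>: "\<tau> permutes {1..n}" and conj: "\<tau> \<circ> \<pi>' = \<pi> \<circ> \<tau>"
  shows "curve_link n \<pi>' (\<lambda>s. p s \<circ> \<tau>) = curve_link n \<pi> p"
proof -
  have pow: "(\<pi> ^^ m) (\<tau> j) = \<tau> ((\<pi>' ^^ m) j)" for m j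
    using conj by (induction m) (auto simp: fun_eq_iff)
  have inj: "inj \<tau>" using \<tau> by (rule permutes_inj)
  have "orbit_period \<pi>' j = orbit_period \<pi> (\<tau> j)" for j
    unfolding orbit_period_def pow using inj by (simp add: inj_eq)
  then have "curve_component \<pi>' (\<lambda>s. p s \<circ> \<tau>) j = curve_component \<pi> p (\<tau> j)" for j
    by (intro ext) (simp add: curve_component_def pow)
  then have "curve_link n \<pi>' (\<lambda>s. p s \<circ> \<tau>) = curve_component \<pi> p ` (\<tau> ` {1..n})"
    unfolding curve_link_def image_image by simp
  then show ?thesis using permutes_image[OF \<tau>] by (simp add: curve_link_def)
qed

text \<open>The isotopy turns the closed braid around the axis by half a revolution. Half is the
  right amount because the first letter of a nonempty word occupies exactly [0, 1/2].\<close>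

lemma link_eq_half_rotation:
  assumes \<pi>: "\<pi> permutes {1..n}" and p: "path p" "path_image p \<subseteq> injections" "p 1 = p 0 \<circ> \<pi>"
  shows "link_eq (curve_link n \<pi> p)
    (curve_link n \<pi> (\<lambda>s. if s \<le> 1/2 then p (s + 1/2) else p (s - 1/2) \<circ> \<pi>))"
proof -
  define h where "h x = (if snd x + fst x / 2 \<le> 1 then p (snd x + fst x / 2)
    else p (snd x + fst x / 2 - 1) \<circ> \<pi>)" for x :: "real \<times> real"
  have pj: "continuous_on {0..1} (\<lambda>s. p s j)" for j
    using p(1) unfolding path_fun_iff path_def by blast
  have cont: "continuous_on ({0..1} \<times> {0..1}) h"
  proof (rule continuous_on_coordinatewise_then_product)
    fix j
    have "continuous_on ({0..1} \<times> {0..1}) (\<lambda>x. if snd x + fst x / 2 \<le> 1 then p (snd x + fst x / 2) j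
        else p (snd x + fst x / 2 - 1) (\<pi> j))"
    proof (rule continuous_on_cases_le)
      show "continuous_on {t \<in> {0..1} \<times> {0..1}. snd t + fst t / 2 \<le> 1} (\<lambda>x. p (snd x + fst x / 2) j)"
        by (rule continuous_on_compose2[OF pj]) (auto intro!: continuous_intros)
      show "continuous_on {t \<in> {0..1} \<times> {0..1}. 1 \<le> snd t + fst t / 2} (\<lambda>x. p (snd x + fst x / 2 - 1) (\<pi> j))"
        by (rule continuous_on_compose2[OF pj]) (auto intro!: continuous_intros)
      show "continuous_on ({0..1} \<times> {0..1}) (\<lambda>x::real \<times> real. snd x + fst x / 2)"
        by (intro continuous_intros) auto
    qed (use p(3) in \<open>auto simp: fun_eq_iff\<close>)
    then show "continuous_on ({0..1} \<times> {0..1}) (\<lambda>x. h x j)"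
      by (rule continuous_on_eq) (simp add: h_def)
  qed
  have "link_eq (curve_link n \<pi> (\<lambda>s. h (0, s))) (curve_link n \<pi> (\<lambda>s. h (1, s)))"
  proof (rule link_eq_homotopy[OF \<pi> cont])
    have "h x \<in> injections" if "x \<in> {0..1} \<times> {0..1}" for x
    proof -
      have in_p: "p s \<in> injections" if "s \<in> {0..1}" for s
        using that p(2) unfolding path_image_def by blast
      show ?thesis
        using that by (auto simp: h_def intro!: in_p injections_relabel permutes_inj[OF \<pi>])
    qed
    then show "h \<in> {0..1} \<times> {0..1} \<rightarrow> config n" using injections_subset_config by blast
    show "h (\<tau>, 1) = h (\<tau>, 0) \<circ> \<pi>" if "\<tau> \<in> {0..1}" for \<tau>
      using that p(3) by (auto simp: h_def)
  qed
  moreover have "curve_link n \<pi> (\<lambda>s. h (0, s)) = curve_link n \<pi> p"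
    by (intro curve_link_cong) (simp add: h_def)
  moreover have "curve_link n \<pi> (\<lambda>s. h (1, s)) =
      curve_link n \<pi> (\<lambda>s. if s \<le> 1/2 then p (s + 1/2) else p (s - 1/2) \<circ> \<pi>)"
    by (intro curve_link_cong) (auto simp: h_def)
  ultimately show ?thesis by simp
qed

lemma homotopic_snoc:
  "homotopic_paths injections (braid_path (w @ [k]))
     (braid_path w +++ (\<lambda>s. generator_path k s \<circ> braid_perm w))"
proof -
  have "homotopic_paths injections (generator_path k) (generator_path k +++ (\<lambda>_. pathfinish (generator_path k)))"
    using homotopic_refl_generator[of k] by (intro homotopic_paths_join_const) simp_all
  moreover have "generator_path k +++ (\<lambda>_. pathfinish (generator_path k)) = braid_path [k]"
    by (simp add: braid_path_Cons braid_path_Nil pathfinish_generator_path comp_def)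
  ultimately have "homotopic_paths injections (braid_path [k]) (generator_path k)"
    using homotopic_paths_sym by metis
  then have k: "homotopic_paths injections (\<lambda>s. braid_path [k] s \<circ> braid_perm w) (\<lambda>s. generator_path k s \<circ> braid_perm w)"
    by (rule homotopic_paths_relabel) (rule inj_braid_perm)
  have "homotopic_paths injections (braid_path w +++ (\<lambda>s. braid_path [k] s \<circ> braid_perm w))
     (braid_path w +++ (\<lambda>s. generator_path k s \<circ> braid_perm w))"
    by (rule homotopic_paths_join[OF homotopic_refl_braid k])
       (simp add: pathfinish_braid_path pathstart_relabel_braid_path)
  then show ?thesis by (rule homotopic_paths_trans[OF homotopic_append_join])
qed

lemma braid_closure_in_S3: "c \<in> braid_closure n w \<Longrightarrow> c t \<in> S3"
  using curve_component_in_S3 by (auto simp: braid_closure_eq_curve_link curve_link_def simp del: mem_sphere_0)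

lemma braid_closure_homotopic:
  assumes "homotopic_paths injections (braid_path v) (braid_path w)" "braid_perm v = braid_perm w"
    and "set v \<subseteq> {1..<n}"
  shows "link_eq (braid_closure n v) (braid_closure n w)"
  using link_eq_homotopic_paths[OF assms(1) braid_perm_permutes[OF assms(3)]]
  by (simp add: braid_closure_eq_curve_link assms(2) braid_path_0 braid_path_1)

lemma braid_closure_rotate1:
  assumes "set (k # w) \<subseteq> {1..<n}"
  shows "link_eq (braid_closure n (k # w)) (braid_closure n (w @ [k]))"
proof -
  define \<pi> where "\<pi> = braid_perm (k # w)"
  define r where "r = braid_path w +++ (\<lambda>s. generator_path k s \<circ> braid_perm w)"
  have \<pi>: "\<pi> permutes {1..n}" unfolding \<pi>_def by (rule braid_perm_permutes[OF assms])
  have \<tau>: "swap_pos k permutes {1..n}" using assms by (intro permutes_swap_id) auto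
  have perm: "braid_perm (w @ [k]) = swap_pos k \<circ> braid_perm w"
    by (simp add: braid_perm_append fun_eq_iff)
  have "link_eq (curve_link n \<pi> (braid_path (k # w))) (curve_link n \<pi> (\<lambda>s. if s \<le> 1/2
      then braid_path (k # w) (s + 1/2) else braid_path (k # w) (s - 1/2) \<circ> \<pi>))"
    by (rule link_eq_half_rotation[OF \<pi> path_braid_path path_image_braid_path])
       (simp add: \<pi>_def braid_path_0 braid_path_1)
  also have "curve_link n \<pi> (\<lambda>s. if s \<le> 1/2 then braid_path (k # w) (s + 1/2)
      else braid_path (k # w) (s - 1/2) \<circ> \<pi>) = curve_link n \<pi> (\<lambda>s. r s \<circ> swap_pos k)"
  proof (rule curve_link_cong)
    fix s :: real assume s: "s \<in> {0..<1}"
    \<comment> \<open>At \<open>s = 0\<close> the left side still reads the end of the first letter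
      and the right side already the beginning of \<open>w\<close>; the configurations
      agree.\<close>
    consider "s = 0" | "0 < s" "s \<le> 1/2" | "1/2 < s" using s by force
    then show "(if s \<le> 1/2 then braid_path (k # w) (s + 1/2) else braid_path (k # w) (s - 1/2) \<circ> \<pi>)
        = r s \<circ> swap_pos k"
    proof cases
      case 1
      then show ?thesis
        by (simp add: r_def braid_path_Cons joinpaths_def generator_path_1 braid_path_0)
    next
      case 2
      then show ?thesis by (simp add: r_def braid_path_Cons joinpaths_def algebra_simps)
    next
      case 3
      then show ?thesis using s
        by (simp add: r_def braid_path_Cons joinpaths_def \<pi>_def fun_eq_iff algebra_simps)
    qed
  qed
  also have "\<dots> = curve_link n (braid_perm (w @ [k])) r"
    by (rule curve_link_relabel[OF \<tau>]) (simp add: \<pi>_def perm fun_eq_iff)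
  finally have 1: "link_eq (braid_closure n (k # w)) (curve_link n (braid_perm (w @ [k])) r)"
    unfolding braid_closure_eq_curve_link \<pi>_def .
  have "link_eq (curve_link n (braid_perm (w @ [k])) r) (braid_closure n (w @ [k]))"
    unfolding braid_closure_eq_curve_link
  proof (rule link_eq_homotopic_paths)
    show "homotopic_paths injections r (braid_path (w @ [k]))"
      unfolding r_def by (rule homotopic_paths_sym[OF homotopic_snoc])
    show "braid_perm (w @ [k]) permutes {1..n}" using assms by (intro braid_perm_permutes) auto
    show "r 1 = r 0 \<circ> braid_perm (w @ [k])"
      by (simp add: r_def joinpaths_def generator_path_1 braid_path_0 perm fun_eq_iff)
  qed
  then show ?thesis by (rule link_eq_trans[OF 1])
qed

lemma braid_closure_rotate:
  "set (u @ v) \<subseteq> {1..<n} \<Longrightarrow> link_eq (braid_closure n (u @ v)) (braid_closure n (v @ u))"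
proof (induction u arbitrary: v)
  case (Cons k u)
  have "link_eq (braid_closure n (k # u @ v)) (braid_closure n ((u @ v) @ [k]))"
    using Cons.prems by (intro braid_closure_rotate1) simp
  also have "(u @ v) @ [k] = u @ (v @ [k])" by simp
  also have "link_eq (braid_closure n (u @ (v @ [k]))) (braid_closure n ((v @ [k]) @ u))"
    using Cons.prems by (intro Cons.IH) simp
  finally show ?case by simp
qed (simp add: link_eq_refl)

lemma braid_closure_braid_step:
  assumes "braid_step v w" "set v \<subseteq> {1..<n}"
  shows "link_eq (braid_closure n v) (braid_closure n w)"
  using assms(1)
proof cases
  case (far i j a b)
  have perm: "braid_perm [i, j] = braid_perm [j, i]"
    using far(3) by (auto simp: fun_eq_iff Transposition.transpose_def)
  have "braid_perm v = braid_perm w" unfolding far braid_perm_append perm ..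
  then show ?thesis
    using assms(2) far(1,2) homotopic_append_left[OF homotopic_append_right[OF homotopic_far[OF far(3)] perm], of a b]
    by (intro braid_closure_homotopic) simp_all
next
  case (near a i b)
  have perm: "braid_perm [i, Suc i, i] = braid_perm [Suc i, i, Suc i]"
    by (auto simp: fun_eq_iff Transposition.transpose_def)
  have "braid_perm v = braid_perm w" unfolding near braid_perm_append perm ..
  then show ?thesis
    using assms(2) near(1,2) homotopic_append_left[OF homotopic_append_right[OF homotopic_near perm], of a b]
    by (intro braid_closure_homotopic) simp_all
qed

lemma braid_closure_braid_equiv:
  assumes "braid_equiv v w" "set v \<subseteq> {1..<n}"
  shows "link_eq (braid_closure n v) (braid_closure n w)"
  using assms(1) unfolding braid_equiv_def
proof (induction rule: equivclp_induct)
  case base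
  show ?case by (rule link_eq_refl)
next
  case (step y z)
  have "set y = set v" using step(1) braid_equiv_set[of v y] by (simp add: braid_equiv_def)
  have "set z = set v" using step(1,2) braid_equiv_set[of v z]
    by (simp add: braid_equiv_def equivclp_into_equivclp)
  from step(2) have "link_eq (braid_closure n y) (braid_closure n z)"
  proof
    assume "braid_step y z"
    then show ?thesis using assms(2) \<open>set y = set v\<close> by (intro braid_closure_braid_step) auto
  next
    assume "braid_step z y"
    then have "link_eq (braid_closure n z) (braid_closure n y)"
      using assms(2) \<open>set z = set v\<close> by (intro braid_closure_braid_step) auto
    then show ?thesis by (rule link_eq_sym) (rule braid_closure_in_S3)
  qed
  then show ?case by (rule link_eq_trans[OF step.IH])
qed

section \<open>Destabilization\<close>

lemma loop_eq_reparametrize: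
  assumes cont: "continuous_on {0..1} g" and mono: "strict_mono_on {0..1} g"
    and g01: "g 0 = 0" "g 1 = (1::real)"
    and eq: "\<And>t. 0 \<le> t \<Longrightarrow> t < 1 \<Longrightarrow> d t = c (g t)"
  shows "loop_eq c d"
proof -
  define H where "H t = of_int \<lfloor>t\<rfloor> + g (frac t)" for t
  have g_bd: "0 \<le> g (frac t)" "g (frac t) < 1" for t
  proof -
    show "g (frac t) < 1"
      using strict_mono_onD[OF mono, of "frac t" 1] g01 by (simp add: frac_lt_1 less_imp_le)
    show "0 \<le> g (frac t)"
    proof (cases "frac t = 0")
      case True
      show ?thesis unfolding True g01 by simp
    next
      case False
      then have "0 < frac t" using frac_ge_0[of t] by linarith
      then show ?thesis
        using strict_mono_onD[OF mono, of 0 "frac t"] g01 by (simp add: frac_lt_1 less_imp_le)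
    qed
  qed
  have "isCont H t" for t
  proof -
    define k where "k = \<lfloor>t\<rfloor>"
    have piece: "continuous_on {of_int m..of_int m + 1} H" for m :: int
    proof -
      have "continuous_on {of_int m..of_int m + 1} (\<lambda>t. of_int m + g (t - of_int m))"
        by (intro continuous_intros continuous_on_compose2[OF cont]) auto
      moreover have "of_int m + g (t - of_int m) = H t" if "t \<in> {of_int m..of_int m + 1}" for t
      proof (cases "t = of_int m + 1")
        case True
        then show ?thesis using g01 by (simp add: H_def)
      next
        case False
        then have "\<lfloor>t\<rfloor> = m" using that by (simp add: floor_eq_iff)
        then show ?thesis by (simp add: H_def frac_def)
      qed
      ultimately show ?thesis using continuous_on_eq by blast
    qed
    have "continuous_on ({of_int (k - 1)..of_int (k - 1) + 1} \<union> {of_int k..of_int k + 1}) H"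
      by (intro continuous_on_closed_Un piece) auto
    then have "continuous_on {of_int k - 1<..<of_int k + 1} H"
      by (rule continuous_on_subset) auto
    moreover have "t \<in> {of_int k - 1<..<of_int k + 1}" unfolding k_def by (simp; linarith)
    ultimately show ?thesis using continuous_on_eq_continuous_at[OF open_greaterThanLessThan] by blast
  qed
  then have "continuous_on UNIV H" by (simp add: continuous_at_imp_continuous_on)
  moreover have "strict_mono H"
  proof
    fix s t :: real assume st: "s < t"
    show "H s < H t"
    proof (cases "\<lfloor>s\<rfloor> = \<lfloor>t\<rfloor>")
      case True
      then have "frac s < frac t" using st by (simp add: frac_def)
      then have "g (frac s) < g (frac t)"
        using strict_mono_onD[OF mono] by (simp add: frac_lt_1 less_imp_le)
      then show ?thesis using True by (simp add: H_def)
    next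
      case False
      then have "\<lfloor>s\<rfloor> + 1 \<le> \<lfloor>t\<rfloor>" using st floor_mono[of s t] by linarith
      then have "of_int \<lfloor>s\<rfloor> + 1 \<le> (of_int \<lfloor>t\<rfloor> :: real)" by linarith
      then show ?thesis using g_bd[of s] g_bd[of t] unfolding H_def by linarith
    qed
  qed
  moreover have "H (t + 1) = H t + 1" for t by (simp add: H_def frac_def)
  moreover have "d (frac t) = c (frac (H t))" for t
  proof -
    have "frac (H t) = g (frac t)" using g_bd[of t] by (simp add: H_def frac_def floor_unique)
    then show ?thesis using eq[of "frac t"] by (simp add: frac_lt_1)
  qed
  ultimately show ?thesis unfolding loop_eq_def by blast
qed

text \<open>Starting at the next point of the orbit is a change of base point by one arc, that is,
  by \<open>1 / L\<close> of the whole loop.\<close>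

lemma loop_eq_component_shift:
  assumes "\<pi> permutes {1..n}"
  shows "loop_eq (curve_component \<pi> p j) (curve_component \<pi> p (\<pi> j))"
proof -
  define L where "L = orbit_period \<pi> j"
  have L: "0 < L" "(\<pi> ^^ L) j = j" using orbit_period[OF assms] by (simp_all add: L_def)
  have "(\<pi> ^^ m) (\<pi> j) = \<pi> j \<longleftrightarrow> (\<pi> ^^ m) j = j" for m
    using permutes_inj[OF assms] by (metis funpow_swap1 injD)
  then have L': "orbit_period \<pi> (\<pi> j) = L" unfolding L_def orbit_period_def by simp
  define H where "H t = t + 1 / real L" for t :: real
  have "curve_component \<pi> p (\<pi> j) (frac t) = curve_component \<pi> p j (frac (H t))" for t
  proof -
    define s where "s = frac t"
    define x where "x = real L * s"
    have s: "0 \<le> s" "s < 1" by (simp_all add: s_def frac_lt_1)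
    have x: "0 \<le> x" "x < real L" using s L by (simp_all add: x_def)
    have lhs: "curve_component \<pi> p (\<pi> j) s = sgn (p (frac x) ((\<pi> ^^ Suc (nat \<lfloor>x\<rfloor>)) j), cis (2 * pi * frac x))"
      by (simp add: curve_component_def Let_def L' x_def funpow_swap1)
    have "H t = (s + 1 / real L) + of_int \<lfloor>t\<rfloor>" by (simp add: H_def s_def frac_def)
    then have "frac (H t) = frac (s + 1 / real L)" by (simp add: frac_def)
    also have "curve_component \<pi> p j (frac (s + 1 / real L)) =
        sgn (p (frac x) ((\<pi> ^^ Suc (nat \<lfloor>x\<rfloor>)) j), cis (2 * pi * frac x))"
    proof (cases "s + 1 / real L < 1")
      case True
      then have "frac (s + 1 / real L) = s + 1 / real L" using s by (simp add: frac_eq)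
      moreover have "real L * (s + 1 / real L) = x + 1" using L by (simp add: x_def distrib_left)
      moreover have "nat \<lfloor>x + 1\<rfloor> = Suc (nat \<lfloor>x\<rfloor>)" using x by (simp add: nat_add_distrib)
      moreover have "frac (x + 1) = frac x" by (simp add: frac_def)
      ultimately show ?thesis by (simp add: curve_component_def Let_def L_def[symmetric] del: funpow.simps)
    next
      case False
      have "1 / real L \<le> 1" using L by simp
      then have "frac (s + 1 / real L) = s + 1 / real L - 1"
        using False s by (simp add: frac_unique_iff)
      moreover have "real L * (s + 1 / real L - 1) = x + 1 - real L" using L by (simp add: x_def algebra_simps)
      moreover have fl: "\<lfloor>x\<rfloor> = int L - 1"
      proof -
        have "real L * 1 \<le> real L * (s + 1 / real L)" using False L by (intro mult_left_mono) auto
        then have "real L \<le> x + 1" using L by (simp add: x_def distrib_left)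
        then show ?thesis using x by (simp add: floor_eq_iff)
      qed
      moreover have "frac (x + 1 - real L) = frac x"
      proof -
        have "frac (x + of_int k) = frac x" for k by (simp add: frac_def)
        from this[of "1 - int L"] show ?thesis by (simp add: algebra_simps)
      qed
      moreover have "\<lfloor>x + 1 - real L\<rfloor> = 0"
      proof -
        have "of_int \<lfloor>x\<rfloor> \<le> x" by simp
        then have "real L - 1 \<le> x" unfolding fl by simp
        then show ?thesis using x by (simp add: floor_eq_iff)
      qed
      moreover have "Suc (nat \<lfloor>x\<rfloor>) = L" using fl L by simp
      ultimately show ?thesis by (simp add: curve_component_def Let_def L_def[symmetric] L(2) del: funpow.simps)
    qed
    finally show ?thesis using lhs by (simp add: s_def)
  qed
  moreover have "continuous_on UNIV H" unfolding H_def by (intro continuous_intros)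
  moreover have "strict_mono H" by (simp add: strict_mono_def H_def)
  moreover have "H (t + 1) = H t + 1" for t by (simp add: H_def)
  ultimately show ?thesis unfolding loop_eq_def by blast
qed

lemma loop_eq_component_orbit:
  assumes "\<pi> permutes {1..n}"
  shows "loop_eq (curve_component \<pi> p j) (curve_component \<pi> p ((\<pi> ^^ m) j))"
proof (induction m)
  case (Suc m)
  then show ?case using loop_eq_trans[OF Suc loop_eq_component_shift[OF assms]] by simp
qed simp

lemma link_eq_linear:
  assumes \<pi>: "\<pi> permutes {1..n}"
    and p: "path p" "p 1 = p 0 \<circ> \<pi>" and q: "path q" "q 1 = q 0 \<circ> \<pi>"
    and sep: "\<And>s t i j. \<lbrakk>s \<in> {0..1}; t \<in> {0..1}; i \<in> {1..n}; j \<in> {1..n}; i \<noteq> j\<rbrakk> \<Longrightarrow>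
      (1 - t) *\<^sub>R p s i + t *\<^sub>R q s i \<noteq> (1 - t) *\<^sub>R p s j + t *\<^sub>R q s j"
  shows "link_eq (curve_link n \<pi> p) (curve_link n \<pi> q)"
proof -
  define h where "h x j = (1 - fst x) *\<^sub>R p (snd x) j + fst x *\<^sub>R q (snd x) j" for x :: "real \<times> real" and j
  have "link_eq (curve_link n \<pi> (\<lambda>s. h (0, s))) (curve_link n \<pi> (\<lambda>s. h (1, s)))"
  proof (rule link_eq_homotopy[OF \<pi>])
    show "continuous_on ({0..1} \<times> {0..1}) h"
      using linear_homotopy_continuous[OF p(1) q(1)] by (simp add: h_def[abs_def])
    show "h \<in> {0..1} \<times> {0..1} \<rightarrow> config n"
    proof
      fix x :: "real \<times> real" assume x: "x \<in> {0..1} \<times> {0..1}"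
      then have "snd x \<in> {0..1}" "fst x \<in> {0..1}" by auto
      then show "h x \<in> config n" unfolding config_def h_def
        using sep[of "snd x" "fst x"] by (intro CollectI inj_onI) blast
    qed
  qed (simp add: h_def p(2) q(2) fun_eq_iff)
  moreover have "(\<lambda>s. h (0, s)) = p" "(\<lambda>s. h (1, s)) = q" by (simp_all add: h_def fun_eq_iff)
  ultimately show ?thesis by simp
qed

lemma braid_path_above:
  "set w \<subseteq> {1..<n} \<Longrightarrow> n < j \<Longrightarrow> braid_path w s j = of_nat j"
proof (induction w arbitrary: s)
  case (Cons k w)
  then have "k < n" "swap_pos k j = j" by (auto simp: Transposition.transpose_def)
  with Cons show ?case
    by (simp add: braid_path_Cons joinpaths_def generator_path_def generator_strand_def)
qed (simp add: braid_path_Nil)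

lemma norm_braid_path_le:
  "\<lbrakk>set w \<subseteq> {1..<n}; j \<in> {1..n}\<rbrakk> \<Longrightarrow> norm (braid_path w s j) \<le> real n"
proof (induction w arbitrary: s j)
  case (Cons k w)
  have k: "1 \<le> k" "k < n" using Cons.prems by auto
  have "norm (generator_path k x j) \<le> real n" for x
  proof (cases "j \<in> {k, Suc k}")
    case True
    have half: "norm (cis (pi * x) / 2) = 1 / 2" by (simp add: norm_divide)
    have "norm (of_nat k + 1 / 2 :: complex) = real k + 1 / 2"
    proof -
      have "of_nat k + 1 / 2 = (of_real (real k + 1 / 2) :: complex)" by simp
      then show ?thesis by (simp only: norm_of_real)
    qed
    then have "norm (generator_path k x j) \<le> real k + 1 / 2 + 1 / 2"
      using True half norm_triangle_ineq4[of "of_nat k + 1/2" "cis (pi * x) / 2"]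
        norm_triangle_ineq[of "of_nat k + 1/2" "cis (pi * x) / 2"]
      by (auto simp: generator_path_def generator_strand_def)
    then show ?thesis using k by linarith
  next
    case False
    then show ?thesis using Cons.prems by (auto simp: generator_path_def generator_strand_def)
  qed
  moreover have "swap_pos k j \<in> {1..n}" using k Cons.prems by (auto simp: Transposition.transpose_def)
  ultimately show ?case using Cons by (simp add: braid_path_Cons joinpaths_def)
qed (simp add: braid_path_Nil)

text \<open>Serves to keep the strands away from \<open>z = 0\<close>, where the swapped shear is
  not described by its formula.\<close>

lemma Re_braid_path_ge:
  "\<lbrakk>set w \<subseteq> {1..<n}; j \<in> {1..n}\<rbrakk> \<Longrightarrow> 1 \<le> Re (braid_path w s j)"
proof (induction w arbitrary: s j)
  case (Cons k w)
  have k: "1 \<le> k" "k < n" using Cons.prems by auto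
  have "1 \<le> Re (generator_path k x j)" for x
    using Re_generator_path_bounds[of j k x] k Cons.prems
    by (cases "j \<in> {k, Suc k}") (auto simp: Re_generator_path)
  moreover have "swap_pos k j \<in> {1..n}" using k Cons.prems by (auto simp: Transposition.transpose_def)
  ultimately show ?case using Cons by (simp add: braid_path_Cons joinpaths_def)
qed (simp add: braid_path_Nil)

section \<open>An explicit excursion around the braid axis\<close>

definition clamp01 :: "real \<Rightarrow> real" where "clamp01 x = max 0 (min 1 x)"

lemma clamp01_bounds [simp]: "0 \<le> clamp01 x" "clamp01 x \<le> 1"
  by (auto simp: clamp01_def)

lemma clamp01_eq: "x \<le> 0 \<Longrightarrow> clamp01 x = 0" "1 \<le> x \<Longrightarrow> clamp01 x = 1" "0 \<le> x \<Longrightarrow> x \<le> 1 \<Longrightarrow> clamp01 x = x"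
  by (auto simp: clamp01_def)

lemma clamp01_lipschitz: "\<bar>clamp01 x - clamp01 y\<bar> \<le> \<bar>x - y\<bar>"
  by (auto simp: clamp01_def max_def min_def)

lemma continuous_on_clamp01 [continuous_intros]:
  "continuous_on S f \<Longrightarrow> continuous_on S (\<lambda>x. clamp01 (f x))"
  unfolding clamp01_def by (intro continuous_intros)

text \<open>
  The excursion of the strand that is removed: below the real axis out to radius \<open>4 n\<close>, along the
  arc \<open>\<bar>y\<bar> \<le> 1/2\<close> of that radius during more than one full turn around the axis, and back
  above the real axis.
\<close>

definition level :: "real \<Rightarrow> real" where
  "level t = (2 * clamp01 (4/5 * (t - 5/8)) - clamp01 (16 * t - 8) - clamp01 (16 * t - 31)) / 2"

definition excursion :: "nat \<Rightarrow> real \<Rightarrow> complex" where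
  "excursion n t = of_real (real n + 3 * real n * min (clamp01 (16 * t - 9)) (clamp01 (31 - 16 * t))) *
     Complex (sqrt (1 - (level t)\<^sup>2)) (level t)"

definition unwind :: "real \<Rightarrow> real" where
  "unwind t = t + clamp01 (4 * t - 5/2)"

text \<open>The parameter runs from 1/2 to 2: half an arc for the strand arriving at position
  \<open>n\<close>, then the whole arc with label \<open>Suc n\<close>. The phases are: direction
  lowered at radius \<open>n\<close> (until 9/16), way out (5/8), outer arc (15/8), way in (31/16),
  direction back to the real axis (2). The outer arc takes time 5/4, so it contains a full turn and
  a quarter.\<close>

lemma level_simps:
  "1/2 \<le> t \<Longrightarrow> t \<le> 9/16 \<Longrightarrow> level t = 4 - 8 * t"
  "9/16 \<le> t \<Longrightarrow> t \<le> 5/8 \<Longrightarrow> level t = - 1/2"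
  "5/8 \<le> t \<Longrightarrow> t \<le> 15/8 \<Longrightarrow> level t = 4/5 * t - 1"
  "15/8 \<le> t \<Longrightarrow> t \<le> 31/16 \<Longrightarrow> level t = 1/2"
  "31/16 \<le> t \<Longrightarrow> t \<le> 2 \<Longrightarrow> level t = 16 - 8 * t"
  by (simp_all add: level_def clamp01_eq field_simps)

lemma level_bounds: "\<bar>level t\<bar> \<le> 1/2"
proof -
  consider "t \<le> 1/2" | "1/2 \<le> t" "t \<le> 9/16" | "9/16 \<le> t" "t \<le> 5/8" | "5/8 \<le> t" "t \<le> 15/8"
    | "15/8 \<le> t" "t \<le> 31/16" | "31/16 \<le> t" "t \<le> 2" | "2 \<le> t" by linarith
  then show ?thesis
  proof cases
    case 1
    then show ?thesis by (simp add: level_def clamp01_eq)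
  next
    case 4
    then show ?thesis unfolding level_simps(3)[OF 4] by linarith
  next
    case 7
    then have "clamp01 (4/5 * (t - 5/8)) = 1" "clamp01 (16 * t - 8) = 1" "clamp01 (16 * t - 31) = 1"
      by (auto intro!: clamp01_eq(2))
    then show ?thesis by (simp add: level_def)
  qed (auto simp: level_simps)
qed

text \<open>The sign changes at 5/4, between the times at most 1 of the strand arriving at
  \<open>n\<close> and the times at least 3/2 at which label \<open>Suc n\<close> is met in the
  second half of its arc. So the two parts of the excursion that are present during the crossing lie
  on different sides of the real axis.\<close>

lemma level_sign:
  "1/2 < t \<Longrightarrow> t < 5/4 \<Longrightarrow> level t < 0" "5/4 < t \<Longrightarrow> t < 2 \<Longrightarrow> 0 < level t"
proof -
  assume t: "1/2 < t" "t < 5/4"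
  then consider "t \<le> 9/16" | "9/16 \<le> t" "t \<le> 5/8" | "5/8 \<le> t" by linarith
  then show "level t < 0" by cases (use t in \<open>auto simp: level_simps\<close>)
next
  assume t: "5/4 < t" "t < 2"
  then consider "t \<le> 15/8" | "15/8 \<le> t" "t \<le> 31/16" | "31/16 \<le> t" by linarith
  then show "0 < level t" by cases (use t in \<open>auto simp: level_simps\<close>)
qed

text \<open>The bound 4/5 is a rational number below the square root of 3/4. It suffices, since
  \<open>4 * n * (4/5)\<close> exceeds \<open>n\<close>: the outer arc lies to the right of all
  other strands.\<close>

lemma unit_level:
  "norm (Complex (sqrt (1 - (level t)\<^sup>2)) (level t)) = 1" "4/5 \<le> sqrt (1 - (level t)\<^sup>2)"
proof -
  have "(level t)\<^sup>2 \<le> (1/2)\<^sup>2" using level_bounds[of t] by (intro abs_le_square_iff[THEN iffD1]) simp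
  then have le: "(level t)\<^sup>2 \<le> 1/4" by (simp add: power2_eq_square)
  then show "norm (Complex (sqrt (1 - (level t)\<^sup>2)) (level t)) = 1" by (simp add: cmod_def)
  show "4/5 \<le> sqrt (1 - (level t)\<^sup>2)" using le by (intro real_le_rsqrt) (simp add: power2_eq_square)
qed

lemma norm_excursion:
  "norm (excursion n t) = real n + 3 * real n * min (clamp01 (16 * t - 9)) (clamp01 (31 - 16 * t))"
  unfolding excursion_def norm_mult unit_level(1) norm_of_real by (simp add: min_def)

lemma norm_excursion_ge: "real n \<le> norm (excursion n t)"
  by (simp add: norm_excursion min_def)

lemma norm_excursion_outer: "5/8 \<le> t \<Longrightarrow> t \<le> 15/8 \<Longrightarrow> norm (excursion n t) = 4 * real n"
  by (simp add: norm_excursion clamp01_eq)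

lemma norm_excursion_inner: "t \<le> 9/16 \<or> 31/16 \<le> t \<Longrightarrow> norm (excursion n t) = real n"
  by (auto simp: norm_excursion clamp01_eq min_def)

lemma excursion_polar: "excursion n t = of_real (norm (excursion n t)) * Complex (sqrt (1 - (level t)\<^sup>2)) (level t)"
  unfolding norm_excursion by (simp add: excursion_def)

lemma Im_excursion: "Im (excursion n t) = norm (excursion n t) * level t"
  by (subst excursion_polar) simp

lemma Re_excursion: "Re (excursion n t) = norm (excursion n t) * sqrt (1 - (level t)\<^sup>2)"
  by (subst excursion_polar) simp

lemma excursion_ends: "excursion n (1/2) = of_nat n" "excursion n 2 = of_nat n"
  by (simp_all add: excursion_def level_simps clamp01_eq complex_eq_iff)

lemma Im_sgn_excursion: "0 < n \<Longrightarrow> Im (sgn (excursion n t)) = level t"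
proof -
  assume "0 < n"
  then have "norm (excursion n t) > 0" using norm_excursion_ge[of n t] by (simp only: of_nat_0_less_iff less_le_trans)
  then show ?thesis by (simp add: sgn_div_norm Im_excursion)
qed

lemma continuous_on_level: "continuous_on S level"
  unfolding level_def by (rule continuous_on_divide) (intro continuous_intros | simp)+

lemma continuous_on_excursion: "continuous_on S (excursion n)"
  unfolding excursion_def Complex_eq by (intro continuous_intros continuous_on_level)

lemma Re_excursion_outer:
  assumes "0 < n" "5/8 \<le> t" "t \<le> 15/8"
  shows "real n < Re (excursion n t)"
proof -
  have "4 * real n * (4/5) \<le> Re (excursion n t)"
    unfolding Re_excursion norm_excursion_outer[OF assms(2,3)] by (intro mult_left_mono unit_level(2)) simp
  then show ?thesis using assms(1) by simp
qed

lemma excursion_real: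
  assumes "0 < n" "1/2 \<le> t" "t \<le> 2" "Im (excursion n t) = 0"
  shows "real n \<le> Re (excursion n t)"
proof -
  have "level t = 0" using assms norm_excursion_ge[of n t] by (auto simp: Im_excursion)
  then show ?thesis using norm_excursion_ge[of n t] by (simp add: Re_excursion)
qed

lemma Im_excursion_sign:
  assumes "0 < n"
  shows "1/2 < t \<Longrightarrow> t < 5/4 \<Longrightarrow> Im (excursion n t) < 0" "5/4 < t \<Longrightarrow> t < 2 \<Longrightarrow> 0 < Im (excursion n t)"
  using norm_excursion_ge[of n t] assms level_sign[of t]
  by (auto simp: Im_excursion mult_pos_neg intro!: mult_pos_pos mult_pos_neg)

text \<open>The outer arc, of duration 5/4, is traversed between 5/8 and 7/8 at speed 5. Before it
  \<open>unwind s\<close> is \<open>s\<close> and after it \<open>s + 1\<close>, so outside the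
  outer arc the angles of \<open>s\<close> and of \<open>unwind s\<close> agree.\<close>

lemma unwind_simps:
  "t \<le> 5/8 \<Longrightarrow> unwind t = t" "5/8 \<le> t \<Longrightarrow> t \<le> 7/8 \<Longrightarrow> unwind t = 5 * t - 5/2" "7/8 \<le> t \<Longrightarrow> unwind t = t + 1"
  by (simp_all add: unwind_def clamp01_eq)

lemma cis_period: "cis (a + 2 * pi) = cis a"
  by (simp add: complex_eq_iff)

text \<open>
  With the two coordinates exchanged, the arc of radius \<open>4 n\<close> is a single strand over the level
  \<open>Im (sgn z)\<close> which winds around \<open>0\<close> at distance \<open>1 / (4 n)\<close>, while all other strands stay at
  distance at least \<open>1 / n\<close>. Hence there is room for a shear with Lipschitz constant \<open>2/3\<close> that
  takes one turn off the arc.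
\<close>

lemma exists_unwinding_map:
  assumes n: "0 < n"
  obtains f where "ambient_isotopy_map f"
    "\<And>z u. \<lbrakk>z \<noteq> 0; norm z \<le> real n; norm u = 1\<rbrakk> \<Longrightarrow> f (sgn (z, u)) = sgn (z, u)"
    "\<And>s. \<lbrakk>1/2 \<le> s; s \<le> 1\<rbrakk> \<Longrightarrow> f (sgn (excursion n (unwind s), cis (2 * pi * unwind s))) =
        sgn (excursion n (unwind s), cis (2 * pi * s))"
proof -
  define c where "c y = max (-1/2) (min (1/2) y)" for y :: real
  \<comment> \<open>On the outer arc the level \<open>y\<close> determines both times:
    \<open>t = 5/4 + 5/4 * y\<close> by \<open>level_simps\<close>, and
    \<open>s = 3/4 + y / 4\<close> by \<open>t = unwind s\<close>. The value is the displacement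
    from the angle of \<open>t\<close> to that of \<open>s\<close>; it vanishes for \<open>y\<close>
    outside the open interval from -1/2 to 1/2, because there \<open>t - s\<close> is 0 or
    1.\<close>
  define \<Theta> where "\<Theta> y = cis (2 * pi * (3/4 + c y / 4)) - cis (2 * pi * (5/4 + 5/4 * c y))" for y
  \<comment> \<open>The cutoff is 1 at distance \<open>1 / (4 n)\<close>, where the arc lies, and 0
    from \<open>1 / n\<close> on, where the other strands lie. Its slope is at most
    \<open>4 n / 3\<close>; with the factor \<open>1 / (4 n)\<close> and the bound 2 for \<Theta>
    this yields 2/3.\<close>
  define \<beta> where "\<beta> a = clamp01 (4/3 * (1 - real n * a))" for a
  define D where "D v e = (\<beta> (norm v) / (4 * real n)) *\<^sub>R \<Theta> (Im e)" for v e :: complex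
  have norm_\<Theta>: "norm (\<Theta> y) \<le> 2" for y
    unfolding \<Theta>_def by (rule order_trans[OF norm_triangle_ineq4]) simp
  have cont: "continuous_on (UNIV \<times> sphere 0 1) (\<lambda>(v, e). D v e)"
    unfolding D_def \<beta>_def \<Theta>_def c_def case_prod_unfold cis_conv_exp
    by (intro continuous_intros) (use n in auto)
  have bound: "norm (D v e) \<le> 1" for v e
  proof -
    have "norm (D v e) = \<beta> (norm v) / (4 * real n) * norm (\<Theta> (Im e))" by (simp add: D_def \<beta>_def)
    also have "\<dots> \<le> (1 / 4) * 2"
      using n norm_\<Theta> by (intro mult_mono frac_le) (auto simp: \<beta>_def)
    finally show ?thesis by simp
  qed
  have lip: "norm (D v e - D v' e) \<le> 2/3 * norm (v - v')" for v v' e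
  proof -
    have "\<bar>\<beta> (norm v) - \<beta> (norm v')\<bar> \<le> \<bar>4/3 * (1 - real n * norm v) - 4/3 * (1 - real n * norm v')\<bar>"
      unfolding \<beta>_def by (rule clamp01_lipschitz)
    also have "4/3 * (1 - real n * norm v) - 4/3 * (1 - real n * norm v') = 4/3 * real n * (norm v' - norm v)"
      by (simp add: field_simps)
    also have "\<bar>4/3 * real n * (norm v' - norm v)\<bar> = 4/3 * real n * \<bar>norm v' - norm v\<bar>"
      by (simp add: abs_mult)
    also have "\<dots> \<le> 4/3 * real n * norm (v - v')"
      using norm_triangle_ineq3[of v' v] by (intro mult_left_mono) (auto simp: norm_minus_commute)
    finally have \<beta>: "\<bar>\<beta> (norm v) - \<beta> (norm v')\<bar> \<le> 4/3 * real n * norm (v - v')" .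
    have "D v e - D v' e = ((\<beta> (norm v) - \<beta> (norm v')) / (4 * real n)) *\<^sub>R \<Theta> (Im e)"
      by (simp add: D_def scaleR_diff_left[symmetric] diff_divide_distrib)
    then have "norm (D v e - D v' e) = \<bar>\<beta> (norm v) - \<beta> (norm v')\<bar> / (4 * real n) * norm (\<Theta> (Im e))"
      by (simp add: abs_divide)
    also have "\<dots> \<le> (4/3 * real n * norm (v - v')) / (4 * real n) * 2"
      using \<beta> norm_\<Theta> n by (intro mult_mono divide_right_mono) auto
    also have "\<dots> = 2/3 * norm (v - v')" using n by (simp add: field_simps)
    finally show ?thesis .
  qed
  obtain f where f: "ambient_isotopy_map f"
    "\<And>z u. z \<noteq> 0 \<Longrightarrow> f (sgn (z, u)) = sgn (z, u + norm z *\<^sub>R D (u /\<^sub>R norm z) (sgn z))"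
    using exists_ambient_shear_swapped[OF cont bound _ _ lip] by auto
  have fixed: "f (sgn (z, u)) = sgn (z, u)"
    if "z \<noteq> 0" "norm u = 1" "norm z \<le> real n \<or> 1/2 \<le> \<bar>Im (sgn z)\<bar>" for z u
  proof -
    have "D (u /\<^sub>R norm z) (sgn z) = 0"
    proof (cases "norm z \<le> real n")
      case True
      then have "1 \<le> real n * (1 / norm z)" using that(1) by (simp add: field_simps)
      moreover have "norm (u /\<^sub>R norm z) = 1 / norm z"
        using that(1,2) by (simp add: divide_inverse)
      ultimately have "\<beta> (norm (u /\<^sub>R norm z)) = 0"
        unfolding \<beta>_def by (intro clamp01_eq(1)) simp
      then show ?thesis by (simp add: D_def)
    next
      case False
      then have "1/2 \<le> Im (sgn z) \<or> Im (sgn z) \<le> - 1/2" using that(3) by linarith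
      then have "\<Theta> (Im (sgn z)) = 0"
      proof
        assume "1/2 \<le> Im (sgn z)"
        then have c: "c (Im (sgn z)) = 1/2" by (simp add: c_def)
        have "2 * pi * (5/4 + 5/4 * (1/2)) = 2 * pi * (3/4 + 1/2 / 4) + 2 * pi" by (simp add: field_simps)
        then show ?thesis unfolding \<Theta>_def c by (simp only: cis_period) simp
      next
        assume "Im (sgn z) \<le> - 1/2"
        then have "c (Im (sgn z)) = - 1/2" by (simp add: c_def)
        then show ?thesis by (simp add: \<Theta>_def)
      qed
      then show ?thesis by (simp add: D_def)
    qed
    then show ?thesis using f(2)[OF that(1), of u] by simp
  qed
  have unwinding: "f (sgn (excursion n (unwind s), cis (2 * pi * unwind s))) =
      sgn (excursion n (unwind s), cis (2 * pi * s))" if s: "1/2 \<le> s" "s \<le> 1" for s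
  proof -
    define t where "t = unwind s"
    define z where "z = excursion n t"
    have z: "z \<noteq> 0" using norm_excursion_ge[of n t] n by (auto simp: z_def)
    have Im_z: "Im (sgn z) = level t" unfolding z_def by (rule Im_sgn_excursion[OF n])
    consider "s \<le> 5/8" | "5/8 \<le> s" "s \<le> 7/8" | "7/8 \<le> s" by linarith
    then have "f (sgn (z, cis (2 * pi * t))) = sgn (z, cis (2 * pi * s))"
    proof cases
      case 1
      then have t: "t = s" by (simp add: t_def unwind_simps)
      have "norm z \<le> real n \<or> 1/2 \<le> \<bar>Im (sgn z)\<bar>"
        using norm_excursion_inner[of s n] 1 level_simps(2)[of s] unfolding Im_z
        by (cases "s \<le> 9/16") (auto simp: z_def t)
      then show ?thesis using fixed[OF z] t by simp
    next
      case 3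
      then have t: "t = s + 1" by (simp add: t_def unwind_simps)
      have "norm z \<le> real n \<or> 1/2 \<le> \<bar>Im (sgn z)\<bar>"
        using norm_excursion_inner[of t n] 3 s level_simps(4)[of t] unfolding Im_z
        by (cases "31/16 \<le> t") (auto simp: z_def t)
      moreover have "cis (2 * pi * t) = cis (2 * pi * s)"
        using cis_period[of "2 * pi * s"] by (simp add: t distrib_left)
      ultimately show ?thesis using fixed[OF z] by simp
    next
      case 2
      then have t: "t = 5 * s - 5/2" "5/8 \<le> t" "t \<le> 15/8" by (simp_all add: t_def unwind_simps)
      have nz: "norm z = 4 * real n" using t by (simp add: z_def norm_excursion_outer)
      have lv: "level t = 4 * s - 3" using level_simps(3)[OF t(2,3)] t(1) by linarith
      then have c: "c (Im (sgn z)) = 4 * s - 3" using 2 unfolding Im_z by (simp add: c_def)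
      then have \<Theta>: "\<Theta> (Im (sgn z)) = cis (2 * pi * s) - cis (2 * pi * t)"
      proof -
        have "3/4 + (4 * s - 3) / 4 = s" "5/4 + 5/4 * (4 * s - 3) = t"
          unfolding t(1) by (simp_all add: field_simps)
        then show ?thesis unfolding \<Theta>_def c by (simp only:)
      qed
      have v: "norm (cis (2 * pi * t) /\<^sub>R (4 * real n)) = inverse (4 * real n)" by simp
      have "real n * inverse (4 * real n) = 1/4" using n by (simp add: field_simps)
      then have \<beta>: "\<beta> (norm (cis (2 * pi * t) /\<^sub>R norm z)) = 1"
        unfolding \<beta>_def nz v by (simp only:) (simp add: clamp01_eq)
      have "norm z *\<^sub>R D (cis (2 * pi * t) /\<^sub>R norm z) (sgn z) = cis (2 * pi * s) - cis (2 * pi * t)"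
        unfolding D_def \<beta> \<Theta> using n by (simp add: nz)
      then show ?thesis by (simp only: f(2)[OF z]) simp
    qed
    then show ?thesis by (simp add: z_def t_def)
  qed
  show thesis using that[OF f(1)] fixed unwinding by blast
qed

lemma path_cases_half:
  fixes p q :: "real \<Rightarrow> complex"
  assumes "continuous_on {0..1/2} p" "continuous_on {1/2..1} q" "p (1/2) = q (1/2)"
  shows "path (\<lambda>s. if s \<le> 1/2 then p s else q s)"
  unfolding path_def
proof (rule continuous_on_cases_le)
  show "continuous_on {t \<in> {0..1}. t \<le> 1/2} p" "continuous_on {t \<in> {0..1}. 1/2 \<le> t} q"
    using assms(1,2) by (auto elim!: continuous_on_subset)
  show "p s = q s" if "s = 1/2" for s
    unfolding that by (rule assms(3))
qed simp

section \<open>Removing the last strand\<close>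

locale destabilization =
  fixes n :: nat and w :: "nat list"
  assumes n: "0 < n" and w: "set w \<subseteq> {1..<n}"
begin

definition \<rho> :: "nat \<Rightarrow> nat" where "\<rho> = braid_perm w"

definition \<pi> :: "nat \<Rightarrow> nat" where "\<pi> = braid_perm (w @ [n])"

text \<open>The last crossing and the strand \<open>Suc n\<close> are replaced by the excursion: the
  strand that \<open>w\<close> brings to position \<open>n\<close> runs through the times up to 1,
  and label \<open>Suc n\<close> continues with the times from 1 to 2.\<close>

definition kinked :: "real \<Rightarrow> nat \<Rightarrow> complex" where
  "kinked s j = (if j = Suc n then excursion n (1 + s)
     else if s \<le> 1/2 then braid_path w (2 * s) j
     else if \<rho> j = n then excursion n s else of_nat (\<rho> j))"

text \<open>The excursion has the same first coordinates as in \<open>kinked\<close>, but is passed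
  within the second half of a single arc, at the speed of \<open>unwind\<close>.\<close>

definition unkinked :: "real \<Rightarrow> nat \<Rightarrow> complex" where
  "unkinked s j = (if s \<le> 1/2 then braid_path w (2 * s) j
     else if \<rho> j = n then excursion n (unwind s) else of_nat (\<rho> j))"

lemma \<rho>: "\<rho> permutes {1..n}"
  unfolding \<rho>_def by (rule braid_perm_permutes[OF w])

lemma \<rho>_in: "j \<in> {1..n} \<Longrightarrow> \<rho> j \<in> {1..n}"
  using permutes_in_image[OF \<rho>] by blast

lemma \<rho>_above: "n < j \<Longrightarrow> \<rho> j = j"
  using permutes_not_in[OF \<rho>, of j] by simp

lemma \<pi>_eq: "\<pi> j = swap_pos n (\<rho> j)"
  by (simp add: \<pi>_def \<rho>_def braid_perm_append)

lemma \<pi>: "\<pi> permutes {1..Suc n}"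
  unfolding \<pi>_def using w n by (intro braid_perm_permutes) auto

lemma \<rho>_inj: "\<rho> i = \<rho> j \<longleftrightarrow> i = j"
  using permutes_inj[OF \<rho>] by (simp add: inj_eq)

lemma braid_path_continuous: "continuous_on {0..1} (\<lambda>s. braid_path w s j)"
  using path_braid_path unfolding path_fun_iff path_def by blast

lemma path_kinked: "path kinked"
  unfolding path_fun_iff
proof
  fix j
  show "path (\<lambda>s. kinked s j)"
  proof (cases "j = Suc n")
    case True
    have "continuous_on {0..1} (\<lambda>s. excursion n (1 + s))"
      by (intro continuous_on_compose2[OF continuous_on_excursion[of UNIV]] continuous_intros) simp
    then show ?thesis using True by (simp add: kinked_def path_def)
  next
    case False
    have "path (\<lambda>s. if s \<le> 1/2 then braid_path w (2 * s) j else if \<rho> j = n then excursion n s else of_nat (\<rho> j))"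
    proof (rule path_cases_half)
      show "continuous_on {0..1/2} (\<lambda>s. braid_path w (2 * s) j)"
        by (rule continuous_on_compose2[OF braid_path_continuous]) (auto intro!: continuous_intros)
      show "continuous_on {1/2..1} (\<lambda>s. if \<rho> j = n then excursion n s else of_nat (\<rho> j))"
        by (cases "\<rho> j = n") (simp_all add: continuous_on_excursion)
    qed (auto simp: braid_path_1 \<rho>_def[symmetric] excursion_ends)
    then show ?thesis using False by (simp add: kinked_def)
  qed
qed

lemma path_unkinked: "path unkinked"
  unfolding path_fun_iff
proof
  fix j
  show "path (\<lambda>s. unkinked s j)"
    unfolding unkinked_def
  proof (rule path_cases_half)
    show "continuous_on {0..1/2} (\<lambda>s. braid_path w (2 * s) j)"
      by (rule continuous_on_compose2[OF braid_path_continuous]) (auto intro!: continuous_intros)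
    have "continuous_on {1/2..1} (\<lambda>s. excursion n (unwind s))"
      unfolding unwind_def
      by (rule continuous_on_compose2[OF continuous_on_excursion[of UNIV]]) (auto intro!: continuous_intros)
    then show "continuous_on {1/2..1} (\<lambda>s. if \<rho> j = n then excursion n (unwind s) else of_nat (\<rho> j))"
      by (cases "\<rho> j = n") simp_all
  qed (auto simp: braid_path_1 \<rho>_def[symmetric] excursion_ends unwind_simps)
qed

lemma kinked_closed: "kinked 1 = kinked 0 \<circ> \<pi>"
proof
  fix j
  show "kinked 1 j = (kinked 0 \<circ> \<pi>) j"
  proof (cases "j = Suc n")
    case True
    then have "\<pi> j = n" by (simp add: \<pi>_eq \<rho>_above)
    then show ?thesis using True by (simp add: kinked_def braid_path_0 excursion_ends)
  next
    case False
    have "\<rho> j \<noteq> Suc n" using False \<rho>_inj[of j "Suc n"] \<rho>_above[of "Suc n"] by simp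
    then show ?thesis using False
      by (cases "\<rho> j = n") (simp_all add: kinked_def braid_path_0 \<pi>_eq Transposition.transpose_def)
  qed
qed

lemma unkinked_closed: "unkinked 1 = unkinked 0 \<circ> \<rho>"
  by (auto simp: unkinked_def braid_path_0 unwind_simps excursion_ends fun_eq_iff)

text \<open>Straight-line homotopy. In the first half label \<open>Suc n\<close> stays to the right
  of the others. In the second half the strand coming from \<open>n\<close> passes strictly below
  the real axis, label \<open>Suc n\<close> stays weakly above it, and the remaining strands rest at
  integers below \<open>n\<close>.\<close>

lemma link_eq_kinked: "link_eq (braid_closure (Suc n) (w @ [n])) (curve_link (Suc n) \<pi> kinked)"
proof -
  define p where "p = braid_path w +++ (\<lambda>s. generator_path n s \<circ> \<rho>)"
  have p_hom: "homotopic_paths injections (braid_path (w @ [n])) p"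
    unfolding p_def \<rho>_def by (rule homotopic_snoc)
  have p_inj: "p s \<in> injections" if "s \<in> {0..1}" for s
    using homotopic_paths_imp_subset[OF p_hom] that unfolding path_image_def by blast
  have p_path: "path p" using homotopic_paths_imp_path[OF p_hom] by blast
  have p_closed: "p 1 = p 0 \<circ> \<pi>"
    by (simp add: p_def joinpaths_def braid_path_0 generator_path_1 \<pi>_eq fun_eq_iff)
  have p_early: "p s j = braid_path w (2 * s) j" if "s \<le> 1/2" for s j
    using that by (simp add: p_def joinpaths_def)
  have p_late: "p s j = generator_path n (2 * s - 1) (\<rho> j)" if "1/2 < s" for s j
    using that by (simp add: p_def joinpaths_def)
  have "link_eq (braid_closure (Suc n) (w @ [n])) (curve_link (Suc n) \<pi> p)"
    unfolding braid_closure_eq_curve_link \<pi>_def[symmetric]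
    by (rule link_eq_homotopic_paths[OF p_hom \<pi>]) (simp add: braid_path_0 braid_path_1 \<pi>_def)
  also have "link_eq (curve_link (Suc n) \<pi> p) (curve_link (Suc n) \<pi> kinked)"
  proof (rule link_eq_linear[OF \<pi> p_path p_closed path_kinked kinked_closed])
    fix s t :: real and i j assume st: "s \<in> {0..1}" "t \<in> {0..1}" and ij: "i \<in> {1..Suc n}" "j \<in> {1..Suc n}" "i \<noteq> j"
    define m where "m k = (1 - t) *\<^sub>R p s k + t *\<^sub>R kinked s k" for k
    have Re_m: "Re (m k) = (1 - t) * Re (p s k) + t * Re (kinked s k)"
      and Im_m: "Im (m k) = (1 - t) * Im (p s k) + t * Im (kinked s k)" for k
      by (simp_all add: m_def)
    have pne: "p s i \<noteq> p s j" using p_inj[OF st(1)] ij(3) by (simp add: injections_def inj_eq)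
    have "m i \<noteq> m j"
    proof (cases "t = 0")
      case True
      then show ?thesis using pne by (simp add: m_def)
    next
      case t: False
      show ?thesis
      proof (cases "s \<le> 1/2")
        case early: True
        have top: "Re (m k) < Re (m (Suc n))" if k: "k \<in> {1..n}" for k
        proof -
          have "Re (braid_path w (2 * s) k) \<le> real n"
            using norm_braid_path_le[OF w k, of "2 * s"] complex_Re_le_cmod[of "braid_path w (2 * s) k"] by linarith
          then have "Re (m k) \<le> (1 - t) * real n + t * real n"
            unfolding Re_m using st k early
            by (intro add_mono mult_left_mono) (auto simp: p_early kinked_def)
          moreover have "real n < Re (kinked s (Suc n))"
            using Re_excursion_outer[OF n, of "1 + s"] early st by (simp add: kinked_def)
          then have "(1 - t) * real n + t * real n < Re (m (Suc n))"
            unfolding Re_m using st t early braid_path_above[OF w, of "Suc n" "2 * s"]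
            by (intro add_le_less_mono mult_left_mono mult_strict_left_mono) (auto simp: p_early)
          ultimately show ?thesis by linarith
        qed
        have low: "m k = p s k" if "k \<noteq> Suc n" for k
          using that early by (simp add: m_def p_early kinked_def algebra_simps)
        consider "i = Suc n" "j \<in> {1..n}" | "j = Suc n" "i \<in> {1..n}" | "i \<noteq> Suc n" "j \<noteq> Suc n"
          using ij by fastforce
        then show ?thesis
        proof cases
          case 1
          then show ?thesis using top[of j] by auto
        next
          case 2
          then show ?thesis using top[of i] by auto
        next
          case 3
          then show ?thesis using low pne by simp
        qed
      next
        case late: False
        define \<theta> where "\<theta> = 2 * s - 1"
        have \<theta>: "0 < \<theta>" "\<theta> \<le> 1" using late st by (auto simp: \<theta>_def)
        define P where "P a = generator_path n \<theta> a" for a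
        define E where "E a = (if a = Suc n then excursion n (1 + s) else if a = n then excursion n s else of_nat a)" for a
        have m_eq: "m k = (1 - t) *\<^sub>R P (\<rho> k) + t *\<^sub>R E (\<rho> k)" if "k \<in> {1..Suc n}" for k
        proof -
          have "\<rho> k = Suc n \<longleftrightarrow> k = Suc n" using \<rho>_above[of "Suc n"] \<rho>_inj[of k "Suc n"] by auto
          then show ?thesis using late \<rho>_above[of "Suc n"]
            by (auto simp: m_def p_late kinked_def P_def E_def \<theta>_def)
        qed
        have t01: "0 < t" "t \<le> 1" using t st by auto
        have sin: "0 \<le> sin (pi * \<theta>)" using \<theta> by (intro sin_ge_zero) auto
        have ImE: "Im (E n) < 0" "Im (E (Suc n)) > 0 \<or> s = 1"
          using Im_excursion_sign[OF n, of s] Im_excursion_sign[OF n, of "1 + s"] late st by (auto simp: E_def)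
        have ImE': "0 \<le> Im (E (Suc n))" using ImE(2) by (auto simp: E_def excursion_ends)
        have ImP: "Im (P n) \<le> 0" "0 \<le> Im (P (Suc n))" using sin by (auto simp: P_def Im_generator_path)
        have ne: "(1 - t) *\<^sub>R P a + t *\<^sub>R E a \<noteq> (1 - t) *\<^sub>R P b + t *\<^sub>R E b"
          if ab: "a < b" "b \<le> Suc n" for a b
        proof -
          define X where "X c = (1 - t) *\<^sub>R P c + t *\<^sub>R E c" for c
          have Re_X: "Re (X c) = (1 - t) * Re (P c) + t * Re (E c)"
            and Im_X: "Im (X c) = (1 - t) * Im (P c) + t * Im (E c)" for c by (simp_all add: X_def)
          have const: "X c = of_nat c" if "c < n" for c
            using that by (simp add: X_def P_def E_def generator_path_def generator_strand_def
                scaleR_left_distrib[symmetric])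
          have neg: "Im (X n) < 0"
            unfolding Im_X using t01 ImE(1) ImP(1) by (intro add_nonpos_neg mult_nonneg_nonpos mult_pos_neg) auto
          have nonneg: "0 \<le> Im (X (Suc n))"
            unfolding Im_X using t01 ImE' ImP(2) by simp
          \<comment> \<open>At time 1 label \<open>Suc n\<close> is back on the real axis, but at
            \<open>n\<close>, to the right of the resting strands.\<close>
          have top: "Im (X (Suc n)) > 0 \<or> Re (X (Suc n)) = real n"
            using ImE(2)
          proof
            assume "Im (E (Suc n)) > 0"
            then show ?thesis unfolding Im_X using t01 ImP(2) by (simp add: add_nonneg_pos)
          next
            assume s: "s = 1"
            have "E (Suc n) = of_nat n" "P (Suc n) = of_nat n"
              using excursion_ends(2)[of n] by (simp_all add: E_def P_def s \<theta>_def generator_path_1)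
            then show ?thesis by (simp add: X_def scaleR_left_distrib[symmetric])
          qed
          have "X a \<noteq> X b"
          proof (cases "b < n")
            case True
            then show ?thesis using const ab by simp
          next
            case False
            then consider "a < n" "b = n" | "a < n" "b = Suc n" | "a = n" "b = Suc n"
              using ab by linarith
            then show ?thesis
            proof cases
              case 1
              then have "Im (X a) = 0" using const by simp
              then show ?thesis using neg 1 by (metis order_less_irrefl)
            next
              case 2
              then have "Im (X a) = 0" "Re (X a) < real n" using const by simp_all
              then show ?thesis using top 2 by (metis order_less_irrefl)
            next
              case 3
              then show ?thesis using neg nonneg by auto
            qed
          qed
          then show ?thesis by (simp add: X_def)
        qed
        have "\<rho> k \<le> Suc n" if "k \<in> {1..Suc n}" for k
          using that \<rho>_in[of k] \<rho>_above[of k] by (cases "k \<le> n") auto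
        then have "\<rho> i \<le> Suc n" "\<rho> j \<le> Suc n" using ij by auto
        moreover have "\<rho> i \<noteq> \<rho> j" using ij(3) \<rho>_inj by simp
        ultimately show ?thesis
          using ne[of "\<rho> i" "\<rho> j"] ne[of "\<rho> j" "\<rho> i"] m_eq[OF ij(1)] m_eq[OF ij(2)]
          by (metis linorder_neqE_nat)
      qed
    qed
    then show "(1 - t) *\<^sub>R p s i + t *\<^sub>R kinked s i \<noteq> (1 - t) *\<^sub>R p s j + t *\<^sub>R kinked s j"
      by (simp add: m_def)
  qed
  finally show ?thesis .
qed

text \<open>Without its full turn the excursion is a loop based at \<open>n\<close> that meets the
  real axis only at points not to the left of \<open>n\<close>. Shrinking it linearly to
  \<open>n\<close> therefore avoids the strands at the integers below \<open>n\<close>.\<close>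

lemma link_eq_unkinked: "link_eq (curve_link n \<rho> unkinked) (braid_closure n w)"
proof -
  define q where "q = braid_path w +++ (\<lambda>_. pathfinish (braid_path w))"
  have q_hom: "homotopic_paths injections (braid_path w) q"
    unfolding q_def by (rule homotopic_paths_join_const[OF path_braid_path path_image_braid_path])
  have q_path: "path q" using homotopic_paths_imp_path[OF q_hom] by blast
  have q_inj: "q s \<in> injections" if "s \<in> {0..1}" for s
    using homotopic_paths_imp_subset[OF q_hom] that unfolding path_image_def by blast
  have q_late: "q s j = of_nat (\<rho> j)" if "1/2 < s" for s j
    using that by (simp add: q_def joinpaths_def pathfinish_braid_path \<rho>_def)
  have q_closed: "q 1 = q 0 \<circ> \<rho>"
    by (simp add: q_def joinpaths_def braid_path_0 pathfinish_braid_path \<rho>_def fun_eq_iff)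
  have "link_eq (curve_link n \<rho> unkinked) (curve_link n \<rho> q)"
  proof (rule link_eq_linear[OF \<rho> path_unkinked unkinked_closed q_path q_closed])
    fix s t :: real and i j assume st: "s \<in> {0..1}" "t \<in> {0..1}" and ij: "i \<in> {1..n}" "j \<in> {1..n}" "i \<noteq> j"
    define m where "m k = (1 - t) *\<^sub>R unkinked s k + t *\<^sub>R q s k" for k
    have "m i \<noteq> m j"
    proof (cases "s \<le> 1/2")
      case True
      then have "m k = q s k" for k
        by (simp add: m_def unkinked_def q_def joinpaths_def scaleR_left_distrib[symmetric])
      then show ?thesis using q_inj[OF st(1)] ij(3) by (simp add: injections_def inj_eq)
    next
      case False
      have const: "m k = of_nat (\<rho> k)" if "\<rho> k \<noteq> n" for k
        using that False by (simp add: m_def unkinked_def q_late scaleR_left_distrib[symmetric])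
      have far: "m k \<noteq> of_nat a" if "\<rho> k = n" "a < n" for k a
      proof -
        define E where "E = excursion n (unwind s)"
        have mk: "m k = (1 - t) *\<^sub>R E + t *\<^sub>R of_nat n"
          using that False by (simp add: m_def unkinked_def q_late E_def)
        have "1/2 \<le> unwind s" "unwind s \<le> 2"
          using False st by (auto simp: unwind_def intro: order_trans[OF add_mono[OF _ clamp01_bounds(2)]] add_nonneg_nonneg)
            (use clamp01_bounds in \<open>smt (verit)\<close>)+
        then have E: "Im E = 0 \<Longrightarrow> real n \<le> Re E" unfolding E_def using excursion_real[OF n] by blast
        show ?thesis
        proof
          assume eq: "m k = of_nat a"
          have "(1 - t) * Im E = 0" using arg_cong[OF eq, of Im] by (simp add: mk)
          then have "(1 - t) * real n \<le> (1 - t) * Re E" using E st by (cases "t = 1") auto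
          moreover have "(1 - t) * Re E + t * real n = real a" using arg_cong[OF eq, of Re] by (simp add: mk)
          ultimately have "real n \<le> real a" by (simp add: algebra_simps)
          then show False using that by simp
        qed
      qed
      have lt: "\<rho> k < n" if "k \<in> {1..n}" "\<rho> k \<noteq> n" for k using \<rho>_in[OF that(1)] that(2) by auto
      have "\<rho> i \<noteq> \<rho> j" using ij(3) \<rho>_inj by simp
      then consider "\<rho> i \<noteq> n" "\<rho> j \<noteq> n" | "\<rho> i = n" "\<rho> j \<noteq> n" | "\<rho> i \<noteq> n" "\<rho> j = n" by auto
      then show ?thesis
      proof cases
        case 1
        then show ?thesis using const \<open>\<rho> i \<noteq> \<rho> j\<close> by simp
      next
        case 2
        then show ?thesis using const[of j] far[of i "\<rho> j"] lt[OF ij(2)] by simp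
      next
        case 3
        then show ?thesis using const[of i] far[of j "\<rho> i"] lt[OF ij(1)] by simp
      qed
    qed
    then show "(1 - t) *\<^sub>R unkinked s i + t *\<^sub>R q s i \<noteq> (1 - t) *\<^sub>R unkinked s j + t *\<^sub>R q s j"
      by (simp add: m_def)
  qed
  also have "link_eq (curve_link n \<rho> q) (braid_closure n w)"
    unfolding braid_closure_eq_curve_link \<rho>_def[symmetric]
    by (rule link_eq_homotopic_paths[OF homotopic_paths_sym[OF q_hom] \<rho> q_closed])
  finally show ?thesis .
qed

lemma low_point:
  assumes "k \<in> {1..n}" "s \<le> 1/2 \<or> \<rho> k \<noteq> n"
  shows "kinked s k = unkinked s k" "norm (unkinked s k) \<le> real n" "unkinked s k \<noteq> 0"
proof -
  show "kinked s k = unkinked s k" using assms by (auto simp: kinked_def unkinked_def)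
  have "norm (unkinked s k) \<le> real n \<and> unkinked s k \<noteq> 0"
  proof (cases "s \<le> 1/2")
    case True
    have "braid_path w (2 * s) k \<noteq> 0" using Re_braid_path_ge[OF w assms(1), of "2 * s"] by auto
    then show ?thesis using True norm_braid_path_le[OF w assms(1)] by (simp add: unkinked_def)
  next
    case False
    then show ?thesis using assms \<rho>_in[OF assms(1)] by (auto simp: unkinked_def)
  qed
  then show "norm (unkinked s k) \<le> real n" "unkinked s k \<noteq> 0" by auto
qed

lemma \<pi>_funpow_avoiding:
  assumes "j \<in> {1..n}" "\<And>m. m \<le> M \<Longrightarrow> 0 < m \<Longrightarrow> (\<rho> ^^ m) j \<noteq> n"
  shows "m \<le> M \<Longrightarrow> (\<pi> ^^ m) j = (\<rho> ^^ m) j"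
proof (induction m)
  case (Suc m)
  have "(\<rho> ^^ Suc m) j \<in> {1..n}" by (rule permutes_funpow_in[OF \<rho> assms(1)])
  moreover have "(\<rho> ^^ Suc m) j \<noteq> n" using assms(2) Suc.prems by blast
  ultimately have "swap_pos n ((\<rho> ^^ Suc m) j) = (\<rho> ^^ Suc m) j"
    by (auto simp: Transposition.transpose_def simp del: funpow.simps)
  then show ?case using Suc by (simp add: \<pi>_eq)
qed simp

text \<open>The unwinding map fixes everything outside the excursion and changes only the angle on
  it, so it carries arcs to arcs. Components that miss \<open>n\<close> are kept with their
  parametrization; the component through \<open>n\<close> has one arc more in the first link, so
  there the parameter has to be adjusted.\<close>

lemma destabilize:
  "link_eq (curve_link (Suc n) \<pi> kinked) (curve_link n \<rho> unkinked)"
proof -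
  obtain f where f: "ambient_isotopy_map f"
    "\<And>z u. \<lbrakk>z \<noteq> 0; norm z \<le> real n; norm u = 1\<rbrakk> \<Longrightarrow> f (sgn (z, u)) = sgn (z, u)"
    "\<And>s. \<lbrakk>1/2 \<le> s; s \<le> 1\<rbrakk> \<Longrightarrow> f (sgn (excursion n (unwind s), cis (2 * pi * unwind s))) =
        sgn (excursion n (unwind s), cis (2 * pi * s))"
    using exists_unwinding_map[OF n] by blast
  define K where "K = curve_component \<pi> kinked"
  define C where "C = curve_component \<rho> unkinked"
  have fixed: "f (sgn (kinked s k, cis a)) = sgn (unkinked s k, cis a)"
    if "k \<in> {1..n}" "s \<le> 1/2 \<or> \<rho> k \<noteq> n" for s k a
    using low_point[OF that] f(2) by simp
  have avoid: "f \<circ> K j = C j" if j: "j \<in> {1..n}" and no: "\<And>m. (\<rho> ^^ m) j \<noteq> n" for j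
  proof -
    have pow: "(\<pi> ^^ m) j = (\<rho> ^^ m) j" for m
      by (rule \<pi>_funpow_avoiding[OF j, of m]) (use no in auto)
    then have "orbit_period \<pi> j = orbit_period \<rho> j" by (simp add: orbit_period_def)
    moreover have "f (sgn (kinked s ((\<rho> ^^ m) j), cis a)) = sgn (unkinked s ((\<rho> ^^ m) j), cis a)" for s m a
      by (rule fixed) (use permutes_funpow_in[OF \<rho> j] no[of "Suc m"] in auto)
    ultimately show ?thesis unfolding K_def C_def by (auto simp: curve_component_def Let_def pow)
  qed
  have through: "loop_eq (f \<circ> K n) (C n)"
  proof -
    have nn: "n \<in> {1..n}" using n by simp
    define L where "L = orbit_period \<rho> n"
    have L: "0 < L" "(\<rho> ^^ L) n = n" using orbit_period[OF \<rho>] by (simp_all add: L_def)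
    have L_min: "(\<rho> ^^ m) n \<noteq> n" if "0 < m" "m < L" for m
      using that not_less_Least[of m "\<lambda>m. 0 < m \<and> (\<rho> ^^ m) n = n"] by (auto simp: L_def orbit_period_def)
    obtain L' where L': "L = Suc L'" using L by (cases L) auto
    have pow: "(\<pi> ^^ m) n = (\<rho> ^^ m) n" if "m < L" for m
      by (rule \<pi>_funpow_avoiding[OF nn, of L']) (use that L_min L' in auto)
    have powL: "(\<pi> ^^ L) n = Suc n"
      using pow[of L'] L(2) by (simp add: L' \<pi>_eq)
    have powSL: "(\<pi> ^^ Suc L) n = n"
      using powL \<rho>_above[of "Suc n"] by (simp add: \<pi>_eq)
    have period: "orbit_period \<pi> n = Suc L"
      unfolding orbit_period_def
    proof (rule Least_equality)
      fix m assume "0 < m \<and> (\<pi> ^^ m) n = n"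
      then show "Suc L \<le> m"
        using L_min[of m] pow[of m] powL by (metis not_less_eq_eq less_linear n_not_Suc_n not_le)
    qed (use powSL in simp)
    \<comment> \<open>On the last arc before the return to \<open>n\<close>, which has number
      \<open>L'\<close>, this is \<open>unwind\<close>; before that arc it is the identity. In total
      it lengthens the parameter interval from \<open>L\<close> to \<open>L + 1\<close>
      arcs.\<close>
    define stretch where "stretch x = x + clamp01 (4 * (x - real L') - 5/2)" for x
    define g where "g s = stretch (real L * s) / real (Suc L)" for s
    show ?thesis
    proof (rule loop_eq_reparametrize)
      show "continuous_on {0..1} g"
        unfolding g_def stretch_def by (intro continuous_intros) auto
      have "stretch x < stretch y" if "x < y" for x y
        using that unfolding stretch_def clamp01_def by (auto simp: max_def min_def)
      then show "strict_mono_on {0..1} g"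
        using L(1) by (auto intro!: strict_mono_onI divide_strict_right_mono simp: g_def)
      show "g 0 = 0" by (simp add: g_def stretch_def clamp01_eq)
      show "g 1 = 1" by (simp add: g_def stretch_def clamp01_eq L')
      fix s :: real assume s: "0 \<le> s" "s < 1"
      define x where "x = real L * s"
      define k where "k = nat \<lfloor>x\<rfloor>"
      define \<theta> where "\<theta> = frac x"
      have x: "0 \<le> x" "x < real L" using s L(1) by (auto simp: x_def)
      have x_eq: "x = real k + \<theta>" using x by (simp add: k_def \<theta>_def frac_def)
      have \<theta>: "0 \<le> \<theta>" "\<theta> < 1" by (simp_all add: \<theta>_def frac_lt_1)
      have "real k < real L" using x x_eq \<theta> by linarith
      then have k: "k < L" by simp
      have lhs: "C n s = sgn (unkinked \<theta> ((\<rho> ^^ k) n), cis (2 * pi * \<theta>))"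
        by (simp add: C_def curve_component_def Let_def L_def[symmetric] x_def[symmetric] k_def \<theta>_def)
      have rhs: "K n (g s) = sgn (kinked (frac (stretch x)) ((\<pi> ^^ nat \<lfloor>stretch x\<rfloor>) n), cis (2 * pi * frac (stretch x)))"
      proof -
        have "real (Suc L) * g s = stretch x" by (simp add: g_def x_def)
        then show ?thesis by (simp only: K_def curve_component_def period Let_def)
      qed
      have kin: "(\<rho> ^^ k) n \<in> {1..n}" by (rule permutes_funpow_in[OF \<rho> nn])
      have fl: "\<lfloor>real i + a\<rfloor> = int i" if "0 \<le> a" "a < 1" for i a
        using that by (intro floor_unique) auto
      have split: "frac (real i + a) = a" "nat \<lfloor>real i + a\<rfloor> = i" if "0 \<le> a" "a < 1" for i a
        unfolding frac_def fl[OF that] by simp_all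
      show "C n s = (f \<circ> K n) (g s)"
      proof (cases "k = L' \<and> 1/2 < \<theta>")
        case False
        have "k < L' \<or> k = L' \<and> \<theta> \<le> 1/2" using False k L' by auto
        then have "4 * (x - real L') - 5/2 \<le> 0"
        proof
          assume "k < L'"
          then have "real k + 1 \<le> real L'" by linarith
          then have "x \<le> real L'" using x_eq \<theta> by linarith
          then show ?thesis by simp
        qed (use x_eq in simp)
        then have st: "stretch x = real k + \<theta>" using x_eq by (simp add: stretch_def clamp01_eq)
        have "\<theta> \<le> 1/2 \<or> \<rho> ((\<rho> ^^ k) n) \<noteq> n"
          using False L_min[of "Suc k"] k L' by (cases "k = L'") auto
        then have "f (sgn (kinked \<theta> ((\<rho> ^^ k) n), cis (2 * pi * \<theta>))) = sgn (unkinked \<theta> ((\<rho> ^^ k) n), cis (2 * pi * \<theta>))"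
          by (rule fixed[OF kin])
        then show ?thesis unfolding lhs comp_apply rhs st by (simp add: split[OF \<theta>] fl[OF \<theta>] pow[OF k])
      next
        case True
        then have late: "k = L'" "1/2 < \<theta>" by auto
        have \<rho>k: "\<rho> ((\<rho> ^^ L') n) = n" using L(2) by (simp add: L')
        define t where "t = unwind \<theta>"
        have st: "stretch x = real L' + t"
          using x_eq late by (simp add: stretch_def t_def unwind_def)
        have t: "\<theta> \<le> t" "t < 2" using \<theta> clamp01_bounds[of "4 * \<theta> - 5/2"] unfolding t_def unwind_def by linarith+
        have "K n (g s) = sgn (excursion n t, cis (2 * pi * t))"
        proof (cases "t < 1")
          case True
          have "0 \<le> t" using t \<theta> by linarith
          have "(\<pi> ^^ L') n = (\<rho> ^^ L') n" by (rule pow) (simp add: L')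
          then have "K n (g s) = sgn (kinked t ((\<rho> ^^ L') n), cis (2 * pi * t))"
            unfolding rhs st by (simp only: split[OF \<open>0 \<le> t\<close> True])
          moreover have "kinked t ((\<rho> ^^ L') n) = excursion n t"
            using kin late t \<rho>k by (auto simp: kinked_def)
          ultimately show ?thesis by simp
        next
          case False
          then have t': "0 \<le> t - 1" "t - 1 < 1" using t by auto
          have "real L' + t = real L + (t - 1)" by (simp add: L')
          then have "K n (g s) = sgn (kinked (t - 1) (Suc n), cis (2 * pi * (t - 1)))"
            unfolding rhs st by (simp only: split[OF t'] powL)
          moreover have "cis (2 * pi * (t - 1)) = cis (2 * pi * t)"
            using cis_period[of "2 * pi * (t - 1)"] by (simp add: algebra_simps)
          ultimately show ?thesis by (simp add: kinked_def)
        qed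
        then have "f (K n (g s)) = sgn (excursion n t, cis (2 * pi * \<theta>))"
          using f(3)[of \<theta>] late \<theta> by (simp add: t_def)
        moreover have "unkinked \<theta> ((\<rho> ^^ k) n) = excursion n t"
          using late \<rho>k by (simp add: unkinked_def t_def)
        ultimately show ?thesis by (simp add: lhs)
      qed
    qed
  qed
  show ?thesis
    unfolding link_eq_def curve_link_def K_def[symmetric] C_def[symmetric]
  proof (intro exI[of _ f] conjI ballI f(1); elim imageE)
    fix c j assume c: "c = K j" and j: "j \<in> {1..Suc n}"
    show "\<exists>d\<in>C ` {1..n}. loop_eq (f \<circ> c) d"
    \<comment> \<open>Every orbit that meets \<open>n\<close> gives the same component up to the
      base point; the orbit of \<open>Suc n\<close> is among them, since \<pi> sends
      \<open>Suc n\<close> to \<open>n\<close>.\<close>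
    proof (cases "\<exists>m. (\<pi> ^^ m) j = n")
      case True
      then obtain m where "(\<pi> ^^ m) j = n" by blast
      then have "loop_eq (K j) (K n)" unfolding K_def using loop_eq_component_orbit[OF \<pi>] by metis
      then have "loop_eq (f \<circ> c) (C n)" unfolding c using loop_eq_trans[OF loop_eq_image through] by blast
      moreover have "C n \<in> C ` {1..n}" using n by auto
      ultimately show ?thesis by blast
    next
      case False
      have "j \<noteq> Suc n"
      proof
        assume "j = Suc n"
        then have "(\<pi> ^^ 1) j = n" by (simp add: \<pi>_eq \<rho>_above)
        then show False using False by blast
      qed
      then have j': "j \<in> {1..n}" using j by auto
      have "(\<pi> ^^ m) j = (\<rho> ^^ m) j" for m
      proof (induction m)
        case (Suc m)
        have in_n: "(\<rho> ^^ Suc m) j \<in> {1..n}" by (rule permutes_funpow_in[OF \<rho> j'])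
        have \<pi>_Suc: "(\<pi> ^^ Suc i) j = swap_pos n (\<rho> ((\<pi> ^^ i) j))" for i
          unfolding funpow.simps comp_apply by (rule \<pi>_eq)
        have "(\<rho> ^^ Suc m) j \<noteq> n"
        proof
          assume "(\<rho> ^^ Suc m) j = n"
          then have "(\<pi> ^^ Suc m) j = Suc n" unfolding \<pi>_Suc Suc.IH by simp
          then have "(\<pi> ^^ Suc (Suc m)) j = n" unfolding \<pi>_Suc[of "Suc m"] by (simp add: \<rho>_above)
          then show False using False by blast
        qed
        then show ?case using in_n unfolding \<pi>_Suc Suc.IH by (auto simp: Transposition.transpose_def)
      qed simp
      then have "(\<rho> ^^ m) j \<noteq> n" for m using False by metis
      then have "f \<circ> c = C j" unfolding c by (rule avoid[OF j'])
      then show ?thesis using j' by (intro bexI[of _ "C j"]) simp_all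
    qed
  next
    fix d j assume d: "d = C j" and j: "j \<in> {1..n}"
    show "\<exists>c\<in>K ` {1..Suc n}. loop_eq (f \<circ> c) d"
    proof (cases "\<exists>m. (\<rho> ^^ m) j = n")
      case True
      then obtain m where "(\<rho> ^^ m) j = n" by blast
      then have "loop_eq (C j) (C n)" unfolding C_def using loop_eq_component_orbit[OF \<rho>] by metis
      then have "loop_eq (f \<circ> K n) d" unfolding d using loop_eq_trans[OF through loop_eq_sym] by blast
      moreover have "K n \<in> K ` {1..Suc n}" using n by auto
      ultimately show ?thesis by blast
    next
      case False
      then have "f \<circ> K j = d" unfolding d by (intro avoid[OF j]) blast
      then show ?thesis using j by (intro bexI[of _ "K j"]) auto
    qed
  qed
qed

end

section \<open>From Markov moves to isotopies of closures\<close>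

lemma braid_closure_destabilize:
  assumes "0 < n" "set w \<subseteq> {1..<n}"
  shows "link_eq (braid_closure (Suc n) (w @ [n])) (braid_closure n w)"
proof -
  interpret destabilization n w by unfold_locales (fact assms)+
  show ?thesis using link_eq_trans[OF link_eq_kinked link_eq_trans[OF destabilize link_eq_unkinked]] .
qed

text \<open>The chain of moves may go in either direction, so the induction also carries the bound
  on the letters and the positive number of strands. Both are equivalent before and after a move,
  and the claim is made for all words representing the two classes.\<close>

lemma link_eq_markov:
  assumes "markov (n, abs_braid v) (m, abs_braid w)" "set v \<subseteq> {1..<n}" "1 \<le> n"
  shows "link_eq (braid_closure n v) (braid_closure m w)"
proof -
  have letters_abs: "letters (abs_braid u) = set u" for u by (simp add: letters.abs_eq)
  have equivD: "braid_equiv u u'" if "abs_braid u = abs_braid u'" for u u'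
    using that by (simp add: braid.abs_eq_iff)
  have step': "letters (snd q) \<subseteq> {1..<fst q} \<and> 1 \<le> fst q \<and>
      (\<forall>a b. snd p = abs_braid a \<longrightarrow> snd q = abs_braid b \<longrightarrow>
        link_eq (braid_closure (fst p) a) (braid_closure (fst q) b) \<and>
        link_eq (braid_closure (fst q) b) (braid_closure (fst p) a))"
    if pq: "markov_step p q \<or> markov_step q p" and p: "letters (snd p) \<subseteq> {1..<fst p}" "1 \<le> fst p" for p q
  proof -
    have forward: "(letters (snd p) \<subseteq> {1..<fst p} \<longleftrightarrow> letters (snd q) \<subseteq> {1..<fst q}) \<and> (1 \<le> fst p \<longleftrightarrow> 1 \<le> fst q) \<and>
      (\<forall>a b. snd p = abs_braid a \<longrightarrow> snd q = abs_braid b \<longrightarrow>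
        link_eq (braid_closure (fst p) a) (braid_closure (fst q) b))" if "markov_step p q" for p q
      using that
    proof cases
      case (rotate x y n)
      obtain u v where uv: "x = abs_braid u" "y = abs_braid v"
        by (metis Quotient3_abs_rep[OF Quotient3_braid])
      have "link_eq (braid_closure n a) (braid_closure n b)"
        if "x * y = abs_braid a" "y * x = abs_braid b" for a b
      proof -
        have "braid_equiv a (u @ v)" "braid_equiv (v @ u) b"
          using that by (auto intro!: equivD simp: uv times_braid.abs_eq)
        moreover have "set (u @ v) \<subseteq> {1..<n}" using rotate(3) by (simp add: uv letters_abs)
        ultimately show ?thesis
          using braid_equiv_set[of a "u @ v"] braid_closure_braid_equiv[of a "u @ v" n]
            braid_closure_rotate[of u v n] braid_closure_braid_equiv[of "v @ u" b n] link_eq_trans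
          by (metis set_append sup_commute)
      qed
      then show ?thesis using rotate by (simp add: Un_commute)
    next
      case (destabilize n x)
      obtain u where u: "x = abs_braid u" by (metis Quotient3_abs_rep[OF Quotient3_braid])
      have "link_eq (braid_closure (Suc n) a) (braid_closure n b)"
        if "x * \<sigma> n = abs_braid a" "x = abs_braid b" for a b
      proof -
        have ab: "braid_equiv a (u @ [n])" "braid_equiv u b"
          using that by (auto intro!: equivD simp: u times_braid.abs_eq \<sigma>_def)
        have un: "set u \<subseteq> {1..<n}" using destabilize(4) by (simp add: u letters_abs)
        then have "set a \<subseteq> {1..<Suc n}" using braid_equiv_set[OF ab(1)] destabilize(3) by auto
        then have "link_eq (braid_closure (Suc n) a) (braid_closure (Suc n) (u @ [n]))"
          by (rule braid_closure_braid_equiv[OF ab(1)])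
        also have "link_eq \<dots> (braid_closure n u)"
          using destabilize(3) un by (intro braid_closure_destabilize) auto
        also have "link_eq \<dots> (braid_closure n b)" by (rule braid_closure_braid_equiv[OF ab(2) un])
        finally show ?thesis .
      qed
      then show ?thesis using destabilize by auto
    qed
    have sym: "link_eq (braid_closure k b) (braid_closure l a)" if "link_eq (braid_closure l a) (braid_closure k b)" for k l a b
      using that by (rule link_eq_sym) (rule braid_closure_in_S3)
    show ?thesis using pq
    proof
      assume "markov_step p q"
      then show ?thesis using forward[of p q] p sym by blast
    next
      assume "markov_step q p"
      then show ?thesis using forward[of q p] p sym by blast
    qed
  qed
  have "letters (snd q) \<subseteq> {1..<fst q} \<and> 1 \<le> fst q \<and>
      (\<forall>b. snd q = abs_braid b \<longrightarrow> link_eq (braid_closure n v) (braid_closure (fst q) b))"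
    if "markov (n, abs_braid v) q" for q
    using that
  proof (induction rule: equivclp_induct)
    case base
    show ?case using assms(2,3) braid_closure_braid_equiv equivD by (auto simp: letters_abs)
  next
    case (step y z)
    obtain a where a: "snd y = abs_braid a" by (metis Quotient3_abs_rep[OF Quotient3_braid])
    have "letters (snd z) \<subseteq> {1..<fst z} \<and> 1 \<le> fst z \<and>
      (\<forall>b. snd z = abs_braid b \<longrightarrow> link_eq (braid_closure (fst y) a) (braid_closure (fst z) b))"
      using step'[OF step(2)] step.IH a by blast
    then show ?case using step.IH a link_eq_trans by blast
  qed
  from this[OF assms(1)] show ?thesis by simp
qed

lemma abs_braid_append: "abs_braid (u @ v) = abs_braid u * abs_braid v"
  by (simp add: times_braid.abs_eq)

lemma abs_braid_word_power: "abs_braid (word_power w n) = abs_braid w ^ n"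
  by (induction n) (simp_all add: word_power_def abs_braid_append one_braid_def)

lemma abs_braid_descending_word: "abs_braid (descending_word m) = desc m"
proof (induction m)
  case (Suc m)
  have "descending_word (Suc m) = [Suc m] @ descending_word m" by (simp add: descending_word_def)
  then show ?case by (simp only: abs_braid_append Suc.IH desc.simps \<sigma>_def) simp
qed (simp add: descending_word_def one_braid_def)

lemma set_word_power: "set (word_power w n) \<subseteq> set w"
  by (auto simp: word_power_def)

lemma set_descending_word: "set (descending_word m) = {1..m}"
  by (auto simp: descending_word_def)

theorem theorem1p1:
  fixes p q l n :: nat
  assumes "0 < p" "0 < q" "0 < l" "0 < n"
    and "(q \<ge> l + 1 \<and> l + 1 = p)
       \<or> (q = l \<and> l dvd n \<and> coprime p q \<and> l \<le> p)
       \<or> (l = 2 \<and> n = 2 \<and> coprime p q)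
       \<or> (l = n \<and> int n = int p - 2 \<and>
            (\<exists>k::nat. 0 < k \<and> (int q = int k * int p + 1 \<or> int q = int k * int p - 1)))"
  shows "\<exists>\<omega> t b :: nat. int b \<le> int \<omega> - 2 \<and> 1 \<le> t \<and>
           same_oriented_link
             (braid_closure (max p l) (twisted_torus_word p q l n))
             (braid_closure \<omega> (one_bridge_word \<omega> t b))"
proof -
  have "one_bridge (max p l) (desc (l - 1) ^ n * desc (p - 1) ^ q)"
    by (rule one_bridge_twisted_torus) (fact assms)+
  then obtain \<omega> t b where b: "b + 2 \<le> \<omega>" "1 \<le> t"
    and markov: "markov (max p l, desc (l - 1) ^ n * desc (p - 1) ^ q) (\<omega>, desc b * desc (\<omega> - 1) ^ t)"
    unfolding one_bridge_def by blast
  have tt: "set (twisted_torus_word p q l n) \<subseteq> {1..<max p l}"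
    using set_word_power[of "descending_word (l - 1)" n] set_word_power[of "descending_word (p - 1)" q] assms(1,3)
    by (fastforce simp: twisted_torus_word_def set_descending_word)
  have ob: "set (one_bridge_word \<omega> t b) \<subseteq> {1..<\<omega>}"
    using set_word_power[of "descending_word (\<omega> - 1)" t] b
    by (fastforce simp: one_bridge_word_def set_descending_word)
  have "link_eq (braid_closure (max p l) (twisted_torus_word p q l n)) (braid_closure \<omega> (one_bridge_word \<omega> t b))"
    using markov tt assms(1)
    by (intro link_eq_markov)
       (simp_all add: twisted_torus_word_def one_bridge_word_def abs_braid_append abs_braid_word_power abs_braid_descending_word)
  moreover have "c 0 = c 1" if "c \<in> braid_closure m u" "set u \<subseteq> {1..<m}" for c m u
    using that curve_component_closed[OF braid_perm_permutes]
    by (auto simp: braid_closure_eq_curve_link curve_link_def)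
  ultimately have "same_oriented_link (braid_closure (max p l) (twisted_torus_word p q l n))
      (braid_closure \<omega> (one_bridge_word \<omega> t b))"
    using tt ob by (intro link_eq_imp_same_oriented_link)
  then show ?thesis using b by (intro exI[of _ \<omega>] exI[of _ t] exI[of _ b]) auto
qed

end
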